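(* Fix $h>0$ and let $\beta>\beta_c(h)>0$. Then, in the sense of weak convergence of probability measures on $[-1,1]$, $$\lim_{n\to+\infty}\mathbb{E}\left[\mathcal{G}_{\beta,h,n}^{\otimes2}\{r_n(\sigma,\sigma')\in\cdot\,\}\right]=\frac{\beta_c(h)}{\beta}\,\delta_{(m^* )^2}+\left(1-\frac{\beta_c(h)}{\beta}\right)\delta_1.$$
   Context: For $n\ge1$ let $\Sigma_n=\{-1,1\}^n$; for $\sigma=(\sigma_1,\dots,\sigma_n)\in\Sigma_n$ and $1\le i\le n$ let $\sigma|_i=(\sigma_1,\dots,\sigma_i)\in\Sigma_i$. Let $(U(v))_{v\in\bigcup_{n\ge1}\Sigma_n}$ be i.i.d. standard Gaussian random variables on a probability space with probability $\mathbb{P}$ and expectation $\mathbb{E}$. For $\sigma\in\Sigma_n$ and $h>0$ set $$X_n(\sigma)=\sum_{i=1}^nU(\sigma|_i),\qquad H_n(\sigma,h)=X_n(\sigma)+h\sum_{i=1}^n\sigma_i.$$ For $\beta>0$ the partition function is $Z_{\beta,h,n}=\sum_{\sigma\in\Sigma_n}e^{\beta H_n(\sigma,h)}$, and the (random) Gibbs measure on $\Sigma_n$ is $\mathcal{G}_{\beta,h,n}(\sigma)=e^{\beta H_n(\sigma,h)}/Z_{\beta,h,n}$; $\mathcal{G}_{\beta,h,n}^{\otimes2}$ is its product with itself on $\Sigma_n^2$ (same disorder for both replicas $\sigma,\sigma'$). Let $\psi_h(t)=\frac{t^2}{2}+\log2+\log(\cosh(ht))$ for $t\in\mathbb{R}$,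 and let $\beta_c=\beta_c(h)>0$ be the unique positive real number with $\beta_c\psi_h'(\beta_c)-\psi_h(\beta_c)=0$. Let $m^*=m^*(h)=\tanh(\beta_c(h)\,h)$. The (hypercube) overlap is $r_n(\sigma,\sigma')=\frac1n\sum_{i=1}^n\sigma_i\sigma_i'\in[-1,1]$. $\delta_x$ is the Dirac mass at $x$. *)

theory Defs
  imports "HOL-Probability.Probability"
begin

definition configs :: "nat \<Rightarrow> real list set" where
  "configs n = {\<sigma>. length \<sigma> = n \<and> set \<sigma> \<subseteq> {-1, 1}}"

definition tree_vertices :: "real list set" where
  "tree_vertices = (\<Union>n\<in>{1..}. configs n)"

definition gaussian_disorder :: "'a measure \<Rightarrow> (real list \<Rightarrow> 'a \<Rightarrow> real) \<Rightarrow> bool" where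
  "gaussian_disorder M U \<longleftrightarrow>
     prob_space.indep_vars M (\<lambda>_. borel) U tree_vertices \<and>
     (\<forall>v\<in>tree_vertices. distributed M lborel (U v) std_normal_density)"

text \<open>
  In the following definitions \<open>u\<close> is one realisation of the disorder. List positions are
  numbered from 0, so \<open>\<sigma>\<^sub>i\<close> is \<open>\<sigma> ! (i - 1)\<close>, and \<open>\<sigma>|\<^sub>i\<close> is \<open>take i \<sigma>\<close>.
\<close>

definition branching_energy :: "(real list \<Rightarrow> real) \<Rightarrow> nat \<Rightarrow> real list \<Rightarrow> real" where
  "branching_energy u n \<sigma> = (\<Sum>i=1..n. u (take i \<sigma>))"

definition hamiltonian :: "(real list \<Rightarrow> real) \<Rightarrow> real \<Rightarrow> nat \<Rightarrow> real list \<Rightarrow> real" where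
  "hamiltonian u h n \<sigma> = branching_energy u n \<sigma> + h * (\<Sum>i=1..n. \<sigma> ! (i - 1))"

definition partition_fn :: "(real list \<Rightarrow> real) \<Rightarrow> real \<Rightarrow> real \<Rightarrow> nat \<Rightarrow> real" where
  "partition_fn u \<beta> h n = (\<Sum>\<sigma>\<in>configs n. exp (\<beta> * hamiltonian u h n \<sigma>))"

definition gibbs :: "(real list \<Rightarrow> real) \<Rightarrow> real \<Rightarrow> real \<Rightarrow> nat \<Rightarrow> real list measure" where
  "gibbs u \<beta> h n =
     point_measure (configs n) (\<lambda>\<sigma>. ennreal (exp (\<beta> * hamiltonian u h n \<sigma>) / partition_fn u \<beta> h n))"

definition overlap :: "nat \<Rightarrow> real list \<Rightarrow> real list \<Rightarrow> real" where
  "overlap n \<sigma> \<sigma>' = (1 / real n) * (\<Sum>i=1..n. \<sigma> ! (i - 1) * \<sigma>' ! (i - 1))"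

definition gibbs_overlap_prob ::
    "(real list \<Rightarrow> real) \<Rightarrow> real \<Rightarrow> real \<Rightarrow> nat \<Rightarrow> real set \<Rightarrow> real" where
  "gibbs_overlap_prob u \<beta> h n A =
     measure (gibbs u \<beta> h n \<Otimes>\<^sub>M gibbs u \<beta> h n)
       {(\<sigma>, \<sigma>') \<in> configs n \<times> configs n. overlap n \<sigma> \<sigma>' \<in> A}"

text \<open>
  Laws of the overlap are taken as Borel measures on the real line (concentrated on
  \<open>{-1..1}\<close>), the setting of \<^const>\<open>weak_conv_m\<close>; since \<open>{-1..1}\<close> is closed, weak convergence
  is the same there as on \<open>{-1..1}\<close>.
\<close>

definition mean_overlap_law ::
    "'a measure \<Rightarrow> (real list \<Rightarrow> 'a \<Rightarrow> real) \<Rightarrow> real \<Rightarrow> real \<Rightarrow> nat \<Rightarrow> real measure" where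
  "mean_overlap_law M U \<beta> h n =
     measure_of UNIV (sets borel)
       (\<lambda>A. ennreal (\<integral>\<omega>. gibbs_overlap_prob (\<lambda>v. U v \<omega>) \<beta> h n A \<partial>M))"

definition psi :: "real \<Rightarrow> real \<Rightarrow> real" where
  "psi h t = t\<^sup>2 / 2 + ln 2 + ln (cosh (h * t))"

definition beta_c :: "real \<Rightarrow> real" where
  "beta_c h = (THE t. t > 0 \<and> t * deriv (psi h) t - psi h t = 0)"

definition m_star :: "real \<Rightarrow> real" where
  "m_star h = tanh (beta_c h * h)"

text \<open>The measure \<open>w \<cdot> \<delta>\<^sub>x + (1 - w) \<cdot> \<delta>\<^sub>y\<close>, for \<open>w\<close> in the unit interval.\<close>

definition dirac_mixture :: "real \<Rightarrow> real \<Rightarrow> real \<Rightarrow> real measure" where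
  "dirac_mixture w x y =
     measure_of UNIV (sets borel)
       (\<lambda>A. ennreal w * emeasure (return borel x) A + ennreal (1 - w) * emeasure (return borel y) A)"

lemma DERIV_psi: "(psi h has_real_derivative t + h * tanh (h * t)) (at t)"
  unfolding psi_def [abs_def]
  by (auto intro!: derivative_eq_intros simp: tanh_def cosh_real_nonzero)

lemma deriv_psi: "deriv (psi h) t = t + h * tanh (h * t)"
  by (rule DERIV_imp_deriv [OF DERIV_psi])

lemma beta_c_unique: "\<exists>!t. t > 0 \<and> t * deriv (psi h) t - psi h t = 0"
proof -
  define k where "k t = h * t * tanh (h * t) - ln (cosh (h * t))" for t
  define g where "g t = t * deriv (psi h) t - psi h t" for t
  have g_eq: "g t = t\<^sup>2 / 2 + k t - ln 2" for t
    by (simp add: g_def k_def deriv_psi psi_def power2_eq_square algebra_simps)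
  have k_deriv: "(k has_real_derivative t * (h\<^sup>2 * (1 - (tanh (h * t))\<^sup>2))) (at t)" for t
    unfolding k_def [abs_def]
    by (auto intro!: derivative_eq_intros simp: cosh_real_nonzero)
       (simp add: tanh_def field_simps power2_eq_square)
  have k_mono: "k s \<le> k t" if "0 \<le> s" "s \<le> t" for s t
  proof (rule DERIV_nonneg_imp_nondecreasing [OF that(2)])
    fix x assume "s \<le> x" "x \<le> t"
    have "(tanh (h * x))\<^sup>2 \<le> 1"
      using tanh_real_lt_1 [of "h * x"] tanh_real_gt_neg1 [of "h * x"]
      by (simp add: abs_square_le_1 abs_le_iff)
    then have "0 \<le> x * (h\<^sup>2 * (1 - (tanh (h * x))\<^sup>2))"
      using that \<open>s \<le> x\<close> by simp
    then show "\<exists>y. DERIV k x :> y \<and> 0 \<le> y"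
      using k_deriv by blast
  qed
  have g_strict: "g s < g t" if "0 \<le> s" "s < t" for s t
    using k_mono [of s t] power_strict_mono [of s t 2] that by (simp add: g_eq)
  have g0: "g 0 < 0"
    by (simp add: g_eq k_def)
  have "k 0 \<le> k 2"
    by (rule k_mono) auto
  then have g2: "0 \<le> g 2"
    using ln_2_less_1 by (simp add: g_eq k_def)
  have "continuous_on {0..2} g"
    unfolding g_eq [abs_def]
    by (intro continuous_intros DERIV_continuous_on [OF has_field_derivative_at_within [OF k_deriv]])
       simp
  then obtain t where t: "0 \<le> t" "g t = 0"
    using IVT' [of g 0 0 2] g0 g2 by auto
  then have "t > 0"
    using g0 by (cases "t = 0") auto
  moreover have "s = t" if "s > 0" "g s = 0" for s
    using g_strict [of s t] g_strict [of t s] that t by (cases s t rule: linorder_cases) auto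
  ultimately show ?thesis
    using t unfolding g_def by blast
qed

text \<open>The set functions passed to \<^const>\<open>measure_of\<close> are measures.\<close>

lemma finite_configs: "finite (configs n)"
proof -
  have "configs n = {\<sigma>. set \<sigma> \<subseteq> {-1, 1} \<and> length \<sigma> = n}"
    by (auto simp: configs_def)
  then show ?thesis
    using finite_lists_length_eq [of "{-1, 1 :: real}" n] by simp
qed

lemma partition_fn_pos: "partition_fn u \<beta> h n > 0"
proof -
  have "replicate n 1 \<in> configs n"
    by (auto simp: configs_def)
  then show ?thesis
    unfolding partition_fn_def by (intro sum_pos finite_configs) auto
qed

lemma prob_space_gibbs: "prob_space (gibbs u \<beta> h n)"
proof -
  have "0 \<le> exp (\<beta> * hamiltonian u h n \<sigma>) / partition_fn u \<beta> h n" for \<sigma>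
    using partition_fn_pos [of u \<beta> h n] by simp
  moreover have "(\<Sum>\<sigma>\<in>configs n. exp (\<beta> * hamiltonian u h n \<sigma>) / partition_fn u \<beta> h n) = 1"
    using partition_fn_pos [of u \<beta> h n]
    by (simp add: sum_divide_distrib [symmetric] partition_fn_def)
  ultimately show ?thesis
    unfolding gibbs_def
    by (intro prob_space_point_measure finite_configs) (simp_all add: sum_ennreal)
qed

lemma gibbs_overlap_prob_eq_sum:
  "gibbs_overlap_prob u \<beta> h n A =
     (\<Sum>(\<sigma>, \<sigma>')\<in>configs n \<times> configs n.
        exp (\<beta> * hamiltonian u h n \<sigma>) / partition_fn u \<beta> h n *
        (exp (\<beta> * hamiltonian u h n \<sigma>') / partition_fn u \<beta> h n) * indicator A (overlap n \<sigma> \<sigma>'))"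
proof -
  let ?C = "configs n" and ?G = "gibbs u \<beta> h n"
  let ?g = "\<lambda>\<sigma>. exp (\<beta> * hamiltonian u h n \<sigma>) / partition_fn u \<beta> h n"
  let ?S = "{(\<sigma>, \<sigma>') \<in> ?C \<times> ?C. overlap n \<sigma> \<sigma>' \<in> A}"
  interpret G: prob_space ?G by (rule prob_space_gibbs)
  interpret P: pair_prob_space ?G ?G ..
  have sets_G: "sets ?G = Pow ?C"
    by (simp add: gibbs_def sets_point_measure)
  have "0 \<le> ?g \<sigma>" for \<sigma>
    using partition_fn_pos [of u \<beta> h n] by simp
  then have G_sing: "measure ?G {\<sigma>} = ?g \<sigma>" if "\<sigma> \<in> ?C" for \<sigma>
    using that by (simp add: gibbs_def measure_def emeasure_point_measure_finite finite_configs)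
  have sing: "{p} \<in> sets (?G \<Otimes>\<^sub>M ?G)
      \<and> measure (?G \<Otimes>\<^sub>M ?G) {p} = ?g (fst p) * ?g (snd p)" if "p \<in> ?C \<times> ?C" for p
  proof -
    have p: "{p} = {fst p} \<times> {snd p}" by auto
    have f: "{fst p} \<in> sets ?G" "{snd p} \<in> sets ?G"
      using that by (auto simp: sets_G)
    have "emeasure (?G \<Otimes>\<^sub>M ?G) ({fst p} \<times> {snd p})
        = emeasure ?G {fst p} * emeasure ?G {snd p}"
      by (rule G.emeasure_pair_measure_Times [OF f])
    then have "measure (?G \<Otimes>\<^sub>M ?G) ({fst p} \<times> {snd p})
        = measure ?G {fst p} * measure ?G {snd p}"
      by (simp add: measure_def enn2real_mult)
    then show ?thesis
      using that f by (metis G_sing mem_Times_iff p pair_measureI)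
  qed
  have fin: "finite ?S"
    by (rule finite_subset [of _ "?C \<times> ?C"]) (auto intro: finite_configs)
  have "gibbs_overlap_prob u \<beta> h n A = (\<Sum>p\<in>?S. measure (?G \<Otimes>\<^sub>M ?G) {p})"
    unfolding gibbs_overlap_prob_def
    by (rule P.finite_measure_eq_sum_singleton [OF fin]) (use sing in auto)
  also have "\<dots> = (\<Sum>p\<in>?S. ?g (fst p) * ?g (snd p))"
    by (rule sum.cong) (use sing in auto)
  also have "\<dots> = (\<Sum>p\<in>?C \<times> ?C. ?g (fst p) * ?g (snd p) * indicator A (overlap n (fst p) (snd p)))"
    by (rule sum.mono_neutral_cong_left) (auto intro: finite_configs simp: indicator_def split: if_splits)
  finally show ?thesis
    by (simp add: case_prod_unfold)
qed

lemma hamiltonian_measurable: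
  assumes "prob_space M" "gaussian_disorder M U" "\<sigma> \<in> configs n"
  shows "(\<lambda>\<omega>. hamiltonian (\<lambda>v. U v \<omega>) h n \<sigma>) \<in> borel_measurable M"
proof -
  have "take i \<sigma> \<in> tree_vertices" if "i \<in> {1..n}" for i
    using that assms(3) set_take_subset [of i \<sigma>]
    by (auto simp: tree_vertices_def configs_def intro!: bexI [of _ i])
  then have "(\<lambda>\<omega>. U (take i \<sigma>) \<omega>) \<in> borel_measurable M" if "i \<in> {1..n}" for i
    using that assms(1,2)
    by (auto simp: gaussian_disorder_def prob_space.indep_vars_def)
  then show ?thesis
    unfolding hamiltonian_def branching_energy_def by measurable
qed

lemma gibbs_overlap_prob_measurable:
  assumes "prob_space M" "gaussian_disorder M U"
  shows "(\<lambda>\<omega>. gibbs_overlap_prob (\<lambda>v. U v \<omega>) \<beta> h n A) \<in> borel_measurable M"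
proof -
  note [measurable] = hamiltonian_measurable [OF assms]
  show ?thesis
    unfolding gibbs_overlap_prob_eq_sum partition_fn_def case_prod_unfold
    by (intro borel_measurable_sum borel_measurable_times borel_measurable_divide
          borel_measurable_const borel_measurable_exp hamiltonian_measurable [OF assms]
          measurable_compose [OF _ borel_measurable_exp]) auto
qed

lemma gibbs_overlap_prob_bounds:
  "0 \<le> gibbs_overlap_prob u \<beta> h n A" "gibbs_overlap_prob u \<beta> h n A \<le> 1"
proof -
  interpret G: prob_space "gibbs u \<beta> h n" by (rule prob_space_gibbs)
  interpret P: pair_prob_space "gibbs u \<beta> h n" "gibbs u \<beta> h n" ..
  show "0 \<le> gibbs_overlap_prob u \<beta> h n A" "gibbs_overlap_prob u \<beta> h n A \<le> 1"
    by (simp_all add: gibbs_overlap_prob_def)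
qed

lemma emeasure_mean_overlap_law:
  assumes M: "prob_space M" and U: "gaussian_disorder M U" and A: "A \<in> sets borel"
  shows "emeasure (mean_overlap_law M U \<beta> h n) A =
           ennreal (\<integral>\<omega>. gibbs_overlap_prob (\<lambda>v. U v \<omega>) \<beta> h n A \<partial>M)"
proof -
  interpret M: prob_space M by (rule M)
  let ?P = "\<lambda>\<omega> A. gibbs_overlap_prob (\<lambda>v. U v \<omega>) \<beta> h n A"
  have nn: "ennreal (\<integral>\<omega>. ?P \<omega> B \<partial>M) = (\<integral>\<^sup>+\<omega>. ennreal (?P \<omega> B) \<partial>M)" for B
    by (rule nn_integral_eq_integral [symmetric])
       (auto intro!: M.integrable_const_bound [where B = 1] gibbs_overlap_prob_measurable [OF M U]
             simp: gibbs_overlap_prob_bounds)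
  have sums: "(\<lambda>i. ?P \<omega> (B i)) sums ?P \<omega> (\<Union>i. B i)" if "disjoint_family B" for \<omega> B
    unfolding gibbs_overlap_prob_eq_sum case_prod_unfold
    by (intro sums_sum sums_mult indicator_sums) (use that in \<open>auto simp: disjoint_family_on_def\<close>)
  show ?thesis
  proof (rule emeasure_measure_of [OF mean_overlap_law_def])
    show "countably_additive (sets (mean_overlap_law M U \<beta> h n))
            (\<lambda>A. ennreal (\<integral>\<omega>. ?P \<omega> A \<partial>M))"
    proof (rule countably_additiveI)
      fix B :: "nat \<Rightarrow> real set"
      assume "disjoint_family B"
      then have "ennreal (?P \<omega> (\<Union>i. B i)) = (\<Sum>i. ennreal (?P \<omega> (B i)))" for \<omega>
        using sums [of B \<omega>] by (subst suminf_ennreal_eq) (auto simp: gibbs_overlap_prob_bounds)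
      then show "(\<Sum>i. ennreal (\<integral>\<omega>. ?P \<omega> (B i) \<partial>M)) = ennreal (\<integral>\<omega>. ?P \<omega> (\<Union>i. B i) \<partial>M)"
        unfolding nn
        by (subst nn_integral_suminf [symmetric])
           (use gibbs_overlap_prob_measurable [OF M U] in auto)
    qed
    show "positive (sets (mean_overlap_law M U \<beta> h n)) (\<lambda>A. ennreal (\<integral>\<omega>. ?P \<omega> A \<partial>M))"
      by (simp add: positive_def gibbs_overlap_prob_def)
    show "A \<in> sets (mean_overlap_law M U \<beta> h n)"
      using A sets.sigma_sets_eq [of "borel :: real measure"]
      by (simp add: mean_overlap_law_def sets_measure_of)
  qed simp
qed

lemma emeasure_dirac_mixture:
  assumes "A \<in> sets borel"
  shows "emeasure (dirac_mixture w x y) A =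
           ennreal w * indicator A x + ennreal (1 - w) * indicator A y"
proof -
  have sets_eq: "sets (dirac_mixture w x y) = sets borel"
    using sets.sigma_sets_eq [of "borel :: real measure"]
    by (simp add: dirac_mixture_def sets_measure_of)
  have "emeasure (dirac_mixture w x y) A =
      ennreal w * emeasure (return borel x) A + ennreal (1 - w) * emeasure (return borel y) A"
  proof (rule emeasure_measure_of [OF dirac_mixture_def])
    show "countably_additive (sets (dirac_mixture w x y))
            (\<lambda>A. ennreal w * emeasure (return borel x) A + ennreal (1 - w) * emeasure (return borel y) A)"
      unfolding sets_eq
      by (rule countably_additiveI)
         (simp add: suminf_add [symmetric] suminf_indicator image_subset_iff)
  qed (use assms in \<open>auto simp: positive_def sets_eq\<close>)
  then show ?thesis
    using assms by simp
qed

end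

theory Submission
  imports Defs "HOL-Real_Asymp.Real_Asymp"
begin

text \<open>
  Write \<open>b = \<beta>\<^sub>c(h)\<close>, \<open>\<psi> = \<psi>\<^sub>h\<close>, \<open>\<theta> = b / \<beta> < 1\<close> and \<open>f = \<psi>(b) / \<theta>\<close>. The model is a branching random
  walk below its critical temperature: two replicas either separate near the root, with limiting
  probability \<open>\<theta>\<close>, or separate near the leaves. In the first case their spins behave like independent
  samples with mean \<open>m\<^sup>*\<close>, so that the hypercube overlap is near \<open>(m\<^sup>*)\<^sup>2\<close>; in the second case it is near
  \<open>1\<close>.

  All upper bounds come from one inequality. For \<open>0 < \<theta> \<le> 1\<close> the power \<open>\<theta>\<close> of a sum of Boltzmann
  factors at \<open>\<beta>\<close> is at most the sum of the factors at \<open>\<theta> \<beta> = b\<close>, whose expectation is explicit.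
  Applied to \<open>Z\<^sub>n\<close> it gives \<open>E ln Z\<^sub>n \<le> n f\<close>.

  The matching lower bound on \<open>E ln Z\<^sub>n\<close> is the point where the tree structure is used. Below \<open>b\<close> the
  normalised partition function is bounded in \<open>L\<^sup>p\<close> for some \<open>p > 1\<close> (\<open>partition_fn_powr_moment_bound\<close>,
  by recursion over the root), hence it is not small with positive probability; since both branches
  at the root must be small for the whole to be small, this improves to probability tending to one
  (\<open>partition_fn_lower_tail\<close>). So \<open>E ln Z\<^sub>n / n\<close> converges to \<open>\<psi>\<close> below \<open>b\<close>, and convexity continues
  this above \<open>b\<close> along the tangent, whose value at \<open>\<beta>\<close> is \<open>f\<close> (\<open>free_energy_low_temperature\<close>).

  For the genealogical overlap, let the disorder of the first \<open>k\<close> levels carry an extra weight \<open>s\<close>. By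
  convexity the response of \<open>E ln Z\<^sub>n\<close> bounds the mean energy in these levels, and Gaussian integration
  by parts turns that energy into \<open>\<beta> \<Sum>\<^sub>i\<^sub>\<le>\<^sub>k (1 - P\<^sub>i)\<close>, where \<open>P\<^sub>i\<close> is the mean probability that two
  replicas agree up to level \<open>i\<close>. The fractional moment of order \<open>\<theta>\<close> gives the correct first-order
  response for both signs of \<open>s\<close>; hence \<open>\<Sum>\<^sub>i\<^sub>\<le>\<^sub>k P\<^sub>i = k (1 - \<theta>) + o(n)\<close> for every \<open>k\<close>, and by
  monotonicity \<open>P\<^sub>i\<close> is close to \<open>1 - \<theta>\<close> at all levels of order \<open>n\<close> away from the ends
  (\<open>coincidence_limit\<close>).

  For the hypercube overlap of replicas that separate before level \<open>\<delta> n\<close>, the power \<open>\<theta>\<close> of the sum of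
  pair weights is bounded by an annealed sum at \<open>b\<close>. There the spins of both replicas are independent with
  mean \<open>tanh (b h) = m\<^sup>*\<close>, up to a factor \<open>exp (b\<^sup>2 \<delta> n)\<close>, and a Chernoff bound makes deviations of
  the overlap from \<open>(m\<^sup>*)\<^sup>2\<close> exponentially unlikely (\<open>early_split_overlap\<close>).
\<close>

section \<open>Spin configurations and elementary inequalities\<close>

lemma configs_Suc: "configs (Suc n) = (#) 1 ` configs n \<union> (#) (-1) ` configs n"
proof (intro set_eqI iffI)
  fix \<sigma> assume "\<sigma> \<in> configs (Suc n)"
  then obtain c \<tau> where "\<sigma> = c # \<tau>" "c \<in> {-1, 1}" "\<tau> \<in> configs n"
    by (cases \<sigma>) (auto simp: configs_def)
  then show "\<sigma> \<in> (#) 1 ` configs n \<union> (#) (-1) ` configs n" by auto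
qed (auto simp: configs_def)

lemma sum_configs_Suc:
  "(\<Sum>\<sigma>\<in>configs (Suc n). f \<sigma>) = (\<Sum>\<sigma>\<in>configs n. f (1 # \<sigma>)) + (\<Sum>\<sigma>\<in>configs n. f (-1 # \<sigma>))"
  unfolding configs_Suc
  by (subst sum.union_disjoint) (auto simp: finite_configs sum.reindex)

lemma configs_0 [simp]: "configs 0 = {[]}"
  by (auto simp: configs_def)

lemma replicate_in_configs: "replicate n 1 \<in> configs n"
  by (auto simp: configs_def)

lemma configs_nonempty: "configs n \<noteq> {}"
  using replicate_in_configs by blast

lemma take_in_configs: "\<sigma> \<in> configs n \<Longrightarrow> i \<le> n \<Longrightarrow> take i \<sigma> \<in> configs i"
  using set_take_subset [of i \<sigma>] by (auto simp: configs_def)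

lemma configs_in_tree: "1 \<le> i \<Longrightarrow> v \<in> configs i \<Longrightarrow> v \<in> tree_vertices"
  by (auto simp: tree_vertices_def)

lemma take_in_tree: "\<sigma> \<in> configs n \<Longrightarrow> 1 \<le> i \<Longrightarrow> i \<le> n \<Longrightarrow> take i \<sigma> \<in> tree_vertices"
  by (blast intro: take_in_configs configs_in_tree)

lemma branching_energy_Cons:
  "branching_energy u (Suc n) (c # \<sigma>) = u [c] + branching_energy (\<lambda>v. u (c # v)) n \<sigma>"
  unfolding branching_energy_def
  by (simp add: sum.atLeast_Suc_atMost sum.shift_bounds_cl_Suc_ivl del: sum.cl_ivl_Suc)

lemma field_Cons: "(\<Sum>i=1..Suc n. (c # \<sigma>) ! (i - 1)) = (c::real) + (\<Sum>i=1..n. \<sigma> ! (i - 1))"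
proof -
  have "(\<Sum>i=1..Suc n. (c # \<sigma>) ! (i - 1)) = c + (\<Sum>i=Suc 1..Suc n. (c # \<sigma>) ! (i - 1))"
    by (subst sum.atLeast_Suc_atMost) auto
  also have "(\<Sum>i=Suc 1..Suc n. (c # \<sigma>) ! (i - 1)) = (\<Sum>i=1..n. (c # \<sigma>) ! (Suc i - 1))"
    by (rule sum.shift_bounds_cl_Suc_ivl)
  also have "\<dots> = (\<Sum>i=1..n. \<sigma> ! (i - 1))"
    by (rule sum.cong) (auto simp: nth_Cons')
  finally show ?thesis .
qed

lemma hamiltonian_Cons:
  "hamiltonian u h (Suc n) (c # \<sigma>) = u [c] + h * c + hamiltonian (\<lambda>v. u (c # v)) h n \<sigma>"
  unfolding hamiltonian_def branching_energy_Cons field_Cons by (simp add: algebra_simps)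

lemma partition_fn_0 [simp]: "partition_fn u \<beta> h 0 = 1"
  by (simp add: partition_fn_def hamiltonian_def branching_energy_def)

lemma partition_fn_Suc:
  "partition_fn u \<beta> h (Suc n) =
     exp (\<beta> * (u [1] + h)) * partition_fn (\<lambda>v. u (1 # v)) \<beta> h n +
     exp (\<beta> * (u [-1] - h)) * partition_fn (\<lambda>v. u (-1 # v)) \<beta> h n"
  unfolding partition_fn_def sum_configs_Suc hamiltonian_Cons
  by (simp add: sum_distrib_left exp_add [symmetric] algebra_simps)

text \<open>
  The weight factorises over the spins, each of which gets mean \<open>tanh y\<close> after normalisation. At \<open>y = \<beta>\<^sub>c h\<close> this is where
  the magnetisation \<open>m\<^sup>*\<close> comes from.
\<close>

lemma sum_exp_field:
  "(\<Sum>\<sigma>\<in>configs n. exp (y * (\<Sum>i=1..n. \<sigma> ! (i - 1)))) = (2 * cosh y) ^ n"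
proof (induction n)
  case (Suc n)
  have "(\<Sum>\<sigma>\<in>configs (Suc n). exp (y * (\<Sum>i=1..Suc n. \<sigma> ! (i - 1))))
      = (exp y + exp (- y)) * (\<Sum>\<sigma>\<in>configs n. exp (y * (\<Sum>i=1..n. \<sigma> ! (i - 1))))"
    unfolding sum_configs_Suc field_Cons
    by (simp only: distrib_left distrib_right exp_add sum_distrib_left sum.distrib mult_1_right mult_minus_right)
  also have "exp y + exp (- y) = 2 * cosh y"
    by (simp add: cosh_def)
  finally show ?case using Suc by simp
qed simp

lemma exp_psi: "exp (real n * psi h t) = exp (real n * t\<^sup>2 / 2) * (2 * cosh (t * h)) ^ n"
proof -
  have "exp (real n * psi h t) = exp (real n * t\<^sup>2 / 2) * exp (psi h t - t\<^sup>2 / 2) ^ n"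
    by (simp add: exp_of_nat_mult [symmetric] exp_add [symmetric] algebra_simps)
  also have "exp (psi h t - t\<^sup>2 / 2) = 2 * cosh (t * h)"
    by (simp add: psi_def exp_add mult.commute cosh_real_pos)
  finally show ?thesis .
qed

text \<open>
  The log-sum-exp function is convex, so it lies above its tangent. Instead
  of differentiating a random free energy, one bounds a Gibbs average by difference quotients.
\<close>

lemma ln_sum_exp_ge_tangent:
  fixes f g :: "'b \<Rightarrow> real"
  assumes "finite A" "A \<noteq> {}"
  shows "ln (\<Sum>x\<in>A. exp (f x + g x)) \<ge>
    ln (\<Sum>x\<in>A. exp (f x)) + (\<Sum>x\<in>A. exp (f x) * g x) / (\<Sum>x\<in>A. exp (f x))"
proof -
  define Z where "Z = (\<Sum>x\<in>A. exp (f x))"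
  define a where "a = (\<Sum>x\<in>A. exp (f x) * g x) / Z"
  have Z: "Z > 0" unfolding Z_def using assms by (intro sum_pos) auto
  have "Z * exp a = (\<Sum>x\<in>A. exp (f x) * (exp a * (1 + g x - a)))"
  proof -
    have "(\<Sum>x\<in>A. exp (f x) * (exp a * (1 + g x - a)))
        = exp a * ((1 - a) * Z + (\<Sum>x\<in>A. exp (f x) * g x))"
      unfolding Z_def sum_distrib_left sum.distrib [symmetric]
      by (rule sum.cong) (auto simp: algebra_simps)
    also have "(\<Sum>x\<in>A. exp (f x) * g x) = a * Z"
      using Z by (simp add: a_def)
    finally show ?thesis by (simp add: algebra_simps)
  qed
  also have "\<dots> \<le> (\<Sum>x\<in>A. exp (f x + g x))"
  proof (rule sum_mono)
    fix x
    have "1 + g x - a \<le> exp (g x - a)" using exp_ge_add_one_self [of "g x - a"] by linarith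
    then have "exp a * (1 + g x - a) \<le> exp a * exp (g x - a)" by simp
    also have "\<dots> = exp (g x)" by (simp add: exp_add [symmetric])
    finally show "exp (f x) * (exp a * (1 + g x - a)) \<le> exp (f x + g x)"
      by (simp add: exp_add)
  qed
  finally have "ln (Z * exp a) \<le> ln (\<Sum>x\<in>A. exp (f x + g x))"
    using Z by (intro ln_mono) auto
  moreover have "ln (Z * exp a) = ln Z + a"
    using Z by (simp add: ln_mult)
  ultimately show ?thesis
    by (simp add: Z_def a_def)
qed

lemma powr_add_le:
  fixes x y \<theta> :: real
  assumes "0 \<le> x" "0 \<le> y" "0 < \<theta>" "\<theta> \<le> 1"
  shows "(x + y) powr \<theta> \<le> x powr \<theta> + y powr \<theta>"
proof (cases "x + y = 0")
  case False
  then have s: "x + y > 0" using assms by linarith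
  have le: "z / (x + y) \<le> (z / (x + y)) powr \<theta>" if "0 \<le> z" "z \<le> x + y" for z
  proof (cases "z = 0")
    case False
    then have "0 < z / (x + y)" "z / (x + y) \<le> 1" using that s by auto
    then show ?thesis using powr_mono' [of \<theta> 1 "z / (x + y)"] assms that by simp
  qed simp
  have "1 = x / (x + y) + y / (x + y)"
    using s by (simp add: add_divide_distrib [symmetric])
  also have "\<dots> \<le> (x / (x + y)) powr \<theta> + (y / (x + y)) powr \<theta>"
    using le [of x] le [of y] assms by (intro add_mono) auto
  also have "\<dots> = (x powr \<theta> + y powr \<theta>) / (x + y) powr \<theta>"
    using s assms by (simp add: powr_divide add_divide_distrib)
  finally show ?thesis
    using s by (simp add: field_simps)
qed (use assms in auto)

text \<open>
  The source of all upper bounds below: a fractional power \<open>\<theta> = \<beta>\<^sub>c / \<beta>\<close> of a sum of Boltzmann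
  factors at \<open>\<beta>\<close> is at most the same sum at the critical parameter \<open>\<theta> \<beta> = \<beta>\<^sub>c\<close>, whose mean is
  explicit.
\<close>

lemma sum_powr_le:
  fixes f :: "'b \<Rightarrow> real"
  assumes "\<And>x. x \<in> A \<Longrightarrow> 0 \<le> f x" "0 < \<theta>" "\<theta> \<le> 1"
  shows "(\<Sum>x\<in>A. f x) powr \<theta> \<le> (\<Sum>x\<in>A. f x powr \<theta>)"
  using assms(1)
proof (induction A rule: infinite_finite_induct)
  case (insert a A)
  have "(f a + (\<Sum>x\<in>A. f x)) powr \<theta> \<le> f a powr \<theta> + (\<Sum>x\<in>A. f x) powr \<theta>"
    by (rule powr_add_le) (use insert assms in \<open>auto intro: sum_nonneg\<close>)
  then show ?case using insert by auto
qed auto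

lemma ln_le_affine: "0 < x \<Longrightarrow> 0 < a \<Longrightarrow> ln x \<le> x / a - 1 + ln (a::real)"
  using ln_le_minus_one [of "x / a"] by (simp add: ln_div)

section \<open>Gaussian exponential moments and annealed bounds\<close>

lemma gaussian_disorder_rv:
  "prob_space M \<Longrightarrow> gaussian_disorder M U \<Longrightarrow> v \<in> tree_vertices \<Longrightarrow> U v \<in> borel_measurable M"
  by (auto simp: gaussian_disorder_def prob_space.indep_vars_def)

lemma std_normal_density_exp_tilt:
  "std_normal_density x * exp (c * x) = exp (c\<^sup>2 / 2) * normal_density c 1 x"
proof -
  have "exp (- x\<^sup>2 / 2) * exp (c * x) = exp (c\<^sup>2 / 2) * exp (- (x - c)\<^sup>2 / 2)"
    unfolding exp_add [symmetric] by (rule arg_cong [of _ _ exp]) (simp add: power2_eq_square field_simps)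
  then show ?thesis
    by (simp add: normal_density_def)
qed

lemma (in prob_space) std_normal_exp_moment:
  assumes X: "distributed M lborel X std_normal_density"
  shows "integrable M (\<lambda>\<omega>. exp (c * X \<omega>))" "expectation (\<lambda>\<omega>. exp (c * X \<omega>)) = exp (c\<^sup>2 / 2)"
proof -
  have "integrable lborel (\<lambda>x. std_normal_density x * exp (c * x))"
    unfolding std_normal_density_exp_tilt by simp
  then show "integrable M (\<lambda>\<omega>. exp (c * X \<omega>))"
    by (subst (asm) distributed_integrable [OF X]) auto
  have "expectation (\<lambda>\<omega>. exp (c * X \<omega>)) = (\<integral>x. std_normal_density x * exp (c * x) \<partial>lborel)"
    by (subst distributed_integral [OF X]) auto
  then show "expectation (\<lambda>\<omega>. exp (c * X \<omega>)) = exp (c\<^sup>2 / 2)"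
    unfolding std_normal_density_exp_tilt by simp
qed

lemma (in prob_space) gaussian_exp_moment:
  assumes U: "gaussian_disorder M U" and F: "finite F" "F \<subseteq> tree_vertices"
  shows "integrable M (\<lambda>\<omega>. exp (\<Sum>v\<in>F. c v * U v \<omega>))"
    and "expectation (\<lambda>\<omega>. exp (\<Sum>v\<in>F. c v * U v \<omega>)) = exp ((\<Sum>v\<in>F. (c v)\<^sup>2) / 2)"
proof -
  have X: "distributed M lborel (U v) std_normal_density" if "v \<in> F" for v
    using U F that by (auto simp: gaussian_disorder_def)
  have "indep_vars (\<lambda>_. borel) U F"
    using U F by (auto simp: gaussian_disorder_def intro: indep_vars_subset)
  then have ind: "indep_vars (\<lambda>_. borel) (\<lambda>v \<omega>. exp (c v * U v \<omega>)) F"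
    by (rule indep_vars_compose2) auto
  have eq: "exp (\<Sum>v\<in>F. c v * U v \<omega>) = (\<Prod>v\<in>F. exp (c v * U v \<omega>))" for \<omega>
    using F by (simp add: exp_sum)
  note exp = std_normal_exp_moment [OF X]
  show "integrable M (\<lambda>\<omega>. exp (\<Sum>v\<in>F. c v * U v \<omega>))"
    unfolding eq by (rule indep_vars_integrable [OF F(1) ind]) (rule exp)
  have "expectation (\<lambda>\<omega>. exp (\<Sum>v\<in>F. c v * U v \<omega>)) = (\<Prod>v\<in>F. exp ((c v)\<^sup>2 / 2))"
    unfolding eq by (subst indep_vars_lebesgue_integral [OF F(1) ind]) (simp_all add: exp)
  then show "expectation (\<lambda>\<omega>. exp (\<Sum>v\<in>F. c v * U v \<omega>)) = exp ((\<Sum>v\<in>F. (c v)\<^sup>2) / 2)"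
    using F by (simp add: exp_sum sum_divide_distrib)
qed

text \<open>
  The vertices whose disorder enters the energy of \<open>\<sigma>\<close>. The leaf \<open>\<sigma>\<close> itself belongs to them;
  the root, which carries no Gaussian variable, does not.
\<close>

definition ancestors :: "real list \<Rightarrow> real list set" where
  "ancestors \<sigma> = (\<lambda>i. take i \<sigma>) ` {1..length \<sigma>}"

lemma inj_take: "inj_on (\<lambda>i. take i \<sigma>) {1..length \<sigma>}"
  by (rule inj_onI) (metis atLeastAtMost_iff length_take min.absorb2)

lemma finite_ancestors: "finite (ancestors \<sigma>)"
  by (simp add: ancestors_def)

lemma ancestors_in_tree: "\<sigma> \<in> configs n \<Longrightarrow> ancestors \<sigma> \<subseteq> tree_vertices"
  unfolding ancestors_def by (auto simp: configs_def intro!: take_in_tree [of _ n])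

lemma branching_energy_eq_sum_ancestors:
  assumes "\<sigma> \<in> configs n" "k \<le> n"
  shows "branching_energy u k \<sigma> = (\<Sum>v\<in>ancestors \<sigma>. of_bool (length v \<le> k) * u v)"
proof -
  have l: "length \<sigma> = n" using assms by (simp add: configs_def)
  have "(\<Sum>v\<in>ancestors \<sigma>. of_bool (length v \<le> k) * u v) = (\<Sum>i\<in>{1..n}. of_bool (i \<le> k) * u (take i \<sigma>))"
    unfolding ancestors_def using l by (subst sum.reindex [OF inj_take]) (auto intro!: sum.cong)
  also have "\<dots> = branching_energy u k \<sigma>"
    unfolding branching_energy_def using assms
    by (intro sum.mono_neutral_cong_right) auto
  finally show ?thesis by simp
qed

lemma card_ancestors: "card (ancestors \<sigma>) = length \<sigma>"
  unfolding ancestors_def by (subst card_image [OF inj_take]) simp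

lemma (in prob_space) branching_energy_exp_moment:
  assumes U: "gaussian_disorder M U" and \<sigma>: "\<sigma> \<in> configs n" and k: "k \<le> n"
  shows "integrable M (\<lambda>\<omega>. exp (a * branching_energy (\<lambda>v. U v \<omega>) n \<sigma> + s * branching_energy (\<lambda>v. U v \<omega>) k \<sigma>))"
    and "expectation (\<lambda>\<omega>. exp (a * branching_energy (\<lambda>v. U v \<omega>) n \<sigma> + s * branching_energy (\<lambda>v. U v \<omega>) k \<sigma>))
         = exp (real n * a\<^sup>2 / 2 + real k * (a * s + s\<^sup>2 / 2))"
proof -
  have l: "length \<sigma> = n" using \<sigma> by (simp add: configs_def)
  let ?c = "\<lambda>v::real list. a + s * of_bool (length v \<le> k)"
  have eq: "a * branching_energy u n \<sigma> + s * branching_energy u k \<sigma> = (\<Sum>v\<in>ancestors \<sigma>. ?c v * u v)" for u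
    unfolding branching_energy_eq_sum_ancestors [OF \<sigma> k] branching_energy_eq_sum_ancestors [OF \<sigma> order.refl]
      sum_distrib_left sum.distrib [symmetric]
    using l by (intro sum.cong) (auto simp: ancestors_def algebra_simps)
  have "(\<Sum>v\<in>ancestors \<sigma>. (?c v)\<^sup>2) = (\<Sum>i\<in>{1..n}. a\<^sup>2 + of_bool (i \<le> k) * (2 * a * s + s\<^sup>2))"
    unfolding ancestors_def using l
    by (subst sum.reindex [OF inj_take]) (auto intro!: sum.cong simp: power2_eq_square algebra_simps)
  also have "\<dots> = real n * a\<^sup>2 + (\<Sum>i\<in>{1..n}. of_bool (i \<le> k)) * (2 * a * s + s\<^sup>2)"
    by (simp add: sum.distrib sum_distrib_right)
  also have "(\<Sum>i\<in>{1..n}. of_bool (i \<le> k)) = (\<Sum>i\<in>{1..k}. 1 :: real)"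
    using k by (intro sum.mono_neutral_cong_right) auto
  finally have sq: "(\<Sum>v\<in>ancestors \<sigma>. (?c v)\<^sup>2) / 2 = real n * a\<^sup>2 / 2 + real k * (a * s + s\<^sup>2 / 2)"
    by (simp add: field_simps)
  note mom = gaussian_exp_moment [OF U finite_ancestors ancestors_in_tree [OF \<sigma>], of ?c]
  show "integrable M (\<lambda>\<omega>. exp (a * branching_energy (\<lambda>v. U v \<omega>) n \<sigma> + s * branching_energy (\<lambda>v. U v \<omega>) k \<sigma>))"
    unfolding eq by (rule mom)
  show "expectation (\<lambda>\<omega>. exp (a * branching_energy (\<lambda>v. U v \<omega>) n \<sigma> + s * branching_energy (\<lambda>v. U v \<omega>) k \<sigma>))
         = exp (real n * a\<^sup>2 / 2 + real k * (a * s + s\<^sup>2 / 2))"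
    unfolding eq using mom(2) sq by simp
qed

text \<open>
  The partition function in which the disorder of the first \<open>k\<close> levels carries an extra weight.
  Its dependence on \<open>s\<close> records how much energy the Gibbs measure collects in those levels.
\<close>

definition perturbed_partition_fn ::
    "(real list \<Rightarrow> real) \<Rightarrow> real \<Rightarrow> real \<Rightarrow> nat \<Rightarrow> nat \<Rightarrow> real \<Rightarrow> real" where
  "perturbed_partition_fn u \<beta> h n k s =
     (\<Sum>\<sigma>\<in>configs n. exp (\<beta> * hamiltonian u h n \<sigma> + s * branching_energy u k \<sigma>))"

lemma perturbed_partition_fn_0: "perturbed_partition_fn u \<beta> h n k 0 = partition_fn u \<beta> h n"
  by (simp add: perturbed_partition_fn_def partition_fn_def)

lemma perturbed_partition_fn_pos: "perturbed_partition_fn u \<beta> h n k s > 0"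
  unfolding perturbed_partition_fn_def by (intro sum_pos finite_configs configs_nonempty) auto

lemma (in prob_space) perturbed_partition_fn_moment:
  assumes U: "gaussian_disorder M U" and k: "k \<le> n"
  shows "integrable M (\<lambda>\<omega>. perturbed_partition_fn (\<lambda>v. U v \<omega>) b h n k s)"
    and "expectation (\<lambda>\<omega>. perturbed_partition_fn (\<lambda>v. U v \<omega>) b h n k s)
           = exp (real n * psi h b + real k * (b * s + s\<^sup>2 / 2))"
proof -
  let ?X = "\<lambda>\<omega> j \<sigma>. branching_energy (\<lambda>v. U v \<omega>) j \<sigma>"
  let ?B = "\<lambda>\<sigma>. \<Sum>i=1..n. \<sigma> ! (i - 1) :: real"
  have eq: "perturbed_partition_fn (\<lambda>v. U v \<omega>) b h n k s =
      (\<Sum>\<sigma>\<in>configs n. exp (b * h * ?B \<sigma>) * exp (b * ?X \<omega> n \<sigma> + s * ?X \<omega> k \<sigma>))" for \<omega>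
    unfolding perturbed_partition_fn_def hamiltonian_def
    by (simp add: exp_add [symmetric] algebra_simps)
  note mom = branching_energy_exp_moment [OF U _ k]
  show "integrable M (\<lambda>\<omega>. perturbed_partition_fn (\<lambda>v. U v \<omega>) b h n k s)"
    unfolding eq by (intro Bochner_Integration.integrable_sum integrable_mult_right mom)
  have "expectation (\<lambda>\<omega>. perturbed_partition_fn (\<lambda>v. U v \<omega>) b h n k s)
      = (\<Sum>\<sigma>\<in>configs n. exp (b * h * ?B \<sigma>) * exp (real n * b\<^sup>2 / 2 + real k * (b * s + s\<^sup>2 / 2)))"
    unfolding eq
    by (subst Bochner_Integration.integral_sum) (auto intro!: integrable_mult_right mom simp: mom(2))
  also have "\<dots> = (2 * cosh (b * h)) ^ n * exp (real n * b\<^sup>2 / 2 + real k * (b * s + s\<^sup>2 / 2))"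
    unfolding sum_distrib_right [symmetric] sum_exp_field ..
  also have "\<dots> = exp (real n * psi h b + real k * (b * s + s\<^sup>2 / 2))"
    unfolding exp_add exp_psi by simp
  finally show "expectation (\<lambda>\<omega>. perturbed_partition_fn (\<lambda>v. U v \<omega>) b h n k s)
           = exp (real n * psi h b + real k * (b * s + s\<^sup>2 / 2))" .
qed

lemma perturbed_partition_fn_powr_le:
  assumes "0 < \<theta>" "\<theta> \<le> 1"
  shows "perturbed_partition_fn u \<beta> h n k s powr \<theta> \<le> perturbed_partition_fn u (\<theta> * \<beta>) h n k (\<theta> * s)"
  unfolding perturbed_partition_fn_def
  by (rule order.trans [OF sum_powr_le]) (use assms in \<open>auto simp: powr_def algebra_simps intro!: sum_mono\<close>)

lemma (in prob_space) integrable_ln_perturbed_partition_fn: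
  assumes U: "gaussian_disorder M U" and k: "k \<le> n"
  shows "integrable M (\<lambda>\<omega>. ln (perturbed_partition_fn (\<lambda>v. U v \<omega>) \<beta> h n k s))"
proof -
  let ?Z = "\<lambda>\<omega>. perturbed_partition_fn (\<lambda>v. U v \<omega>) \<beta> h n k s"
  let ?\<sigma> = "replicate n (1 :: real)"
  let ?E = "\<lambda>a s \<omega>. exp (a * branching_energy (\<lambda>v. U v \<omega>) n ?\<sigma> + s * branching_energy (\<lambda>v. U v \<omega>) k ?\<sigma>)"
  note mom = branching_energy_exp_moment [OF U replicate_in_configs k]
  have Z: "integrable M ?Z" by (rule perturbed_partition_fn_moment [OF U k])
  note [measurable] = borel_measurable_integrable [OF Z]
  show ?thesis
  proof (rule Bochner_Integration.integrable_bound)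
    show "integrable M (\<lambda>\<omega>. ?Z \<omega> + (?E \<beta> s \<omega> + ?E (-\<beta>) (-s) \<omega> + \<bar>\<beta> * h\<bar> * n))"
      by (intro Bochner_Integration.integrable_add Z mom) simp
    show "AE \<omega> in M. norm (ln (?Z \<omega>)) \<le> norm (?Z \<omega> + (?E \<beta> s \<omega> + ?E (-\<beta>) (-s) \<omega> + \<bar>\<beta> * h\<bar> * n))"
    proof (rule AE_I2)
      fix \<omega>
      define x where "x = \<beta> * branching_energy (\<lambda>v. U v \<omega>) n ?\<sigma> + s * branching_energy (\<lambda>v. U v \<omega>) k ?\<sigma>"
      have Zp: "0 < ?Z \<omega>" by (rule perturbed_partition_fn_pos)
      have f: "(\<Sum>i=1..n. ?\<sigma> ! (i - 1)) = real n"
        by (subst sum.cong [where h = "\<lambda>_. 1", OF refl]) auto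
      have "exp (x + \<beta> * h * n) \<le> ?Z \<omega>"
        unfolding perturbed_partition_fn_def
        by (rule order.trans [OF _ member_le_sum [OF replicate_in_configs]])
           (use f in \<open>auto simp: finite_configs hamiltonian_def x_def algebra_simps\<close>)
      then have "x + \<beta> * h * n \<le> ln (?Z \<omega>)"
        using Zp by (simp add: ln_ge_iff)
      moreover have "- exp (- x) \<le> x" using exp_ge_add_one_self [of "- x"] by linarith
      moreover have "- (\<bar>\<beta> * h\<bar> * n) \<le> \<beta> * h * n"
        by (metis abs_ge_minus_self abs_mult abs_of_nat minus_le_iff)
      ultimately have lo: "- (exp (- x) + \<bar>\<beta> * h\<bar> * n) \<le> ln (?Z \<omega>)" by linarith
      have hi: "ln (?Z \<omega>) \<le> ?Z \<omega>" using ln_le_minus_one [OF Zp] by linarith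
      have "?E \<beta> s \<omega> = exp x" "?E (-\<beta>) (-s) \<omega> = exp (- x)" by (simp_all add: x_def)
      moreover have "0 \<le> \<bar>\<beta> * h\<bar> * n" "0 < exp x" "0 < exp (- x)" by auto
      ultimately show "norm (ln (?Z \<omega>)) \<le> norm (?Z \<omega> + (?E \<beta> s \<omega> + ?E (-\<beta>) (-s) \<omega> + \<bar>\<beta> * h\<bar> * n))"
        using lo hi Zp unfolding real_norm_def by linarith
    qed
  qed measurable
qed

text \<open>
  Jensen's inequality for the logarithm, applied to the fractional moment of order \<open>\<theta>\<close>. With
  \<open>\<theta> = \<beta>\<^sub>c / \<beta>\<close> the bound is sharp to first order in \<open>s\<close> for both signs of \<open>s\<close>, although \<open>\<theta>\<close> does
  not depend on \<open>s\<close>.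
\<close>

lemma (in prob_space) expectation_ln_perturbed_partition_fn_le:
  assumes U: "gaussian_disorder M U" and k: "k \<le> n" and \<theta>: "0 < \<theta>" "\<theta> \<le> 1"
  shows "expectation (\<lambda>\<omega>. ln (perturbed_partition_fn (\<lambda>v. U v \<omega>) \<beta> h n k s))
    \<le> real n * psi h (\<theta> * \<beta>) / \<theta> + real k * (\<theta> * \<beta> * s + \<theta> * s\<^sup>2 / 2)"
proof -
  let ?Z = "\<lambda>\<omega>. perturbed_partition_fn (\<lambda>v. U v \<omega>) \<beta> h n k s"
  let ?Z' = "\<lambda>\<omega>. perturbed_partition_fn (\<lambda>v. U v \<omega>) (\<theta> * \<beta>) h n k (\<theta> * s)"
  define l where "l = real n * psi h (\<theta> * \<beta>) + real k * (\<theta> * \<beta> * (\<theta> * s) + (\<theta> * s)\<^sup>2 / 2)"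
  note Z' = perturbed_partition_fn_moment [OF U k, of "\<theta> * \<beta>" h "\<theta> * s", folded l_def]
  have le: "\<theta> * ln (?Z \<omega>) \<le> ?Z' \<omega> / exp l - 1 + l" for \<omega>
  proof -
    have p: "0 < ?Z \<omega>" by (rule perturbed_partition_fn_pos)
    then have "\<theta> * ln (?Z \<omega>) = ln (?Z \<omega> powr \<theta>)" by (simp add: ln_powr)
    also have "\<dots> \<le> ?Z \<omega> powr \<theta> / exp l - 1 + ln (exp l)"
      using p by (intro ln_le_affine) auto
    also have "?Z \<omega> powr \<theta> / exp l \<le> ?Z' \<omega> / exp l"
      by (intro divide_right_mono perturbed_partition_fn_powr_le \<theta>) auto
    finally show ?thesis by simp
  qed
  have "\<theta> * expectation (\<lambda>\<omega>. ln (?Z \<omega>)) = expectation (\<lambda>\<omega>. \<theta> * ln (?Z \<omega>))" by simp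
  also have "\<dots> \<le> expectation (\<lambda>\<omega>. ?Z' \<omega> / exp l - 1 + l)"
    by (rule integral_mono)
       (intro integrable_mult_right integrable_ln_perturbed_partition_fn [OF U k] Z' le integrable_divide
         Bochner_Integration.integrable_add Bochner_Integration.integrable_diff integrable_const)+
  also have "\<dots> = l"
    using Z' by (simp add: prob_space)
  finally have "expectation (\<lambda>\<omega>. ln (?Z \<omega>)) \<le> l / \<theta>"
    using \<theta> by (simp add: field_simps)
  also have "l / \<theta> = real n * psi h (\<theta> * \<beta>) / \<theta> + real k * (\<theta> * \<beta> * s + \<theta> * s\<^sup>2 / 2)"
    using \<theta> by (simp add: l_def field_simps power2_eq_square)
  finally show ?thesis .
qed

section \<open>Independence of subtrees and Gaussian integration by parts\<close>

text \<open>
  Self-similarity of the tree: the disorder above a child of the root has the same law as the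
  whole disorder. All inductions on the depth rest on this.
\<close>

lemma (in prob_space) gaussian_disorder_subtree:
  assumes U: "gaussian_disorder M U" and c: "c \<in> {-1, 1}"
  shows "gaussian_disorder M (\<lambda>v. U (c # v))"
proof -
  have sub: "c # v \<in> tree_vertices" if "v \<in> tree_vertices" for v
    using that c by (auto simp: tree_vertices_def configs_def)
  \<comment> \<open>Grouping the family into the one-element blocks \<open>{c # v}\<close> performs the change of index.\<close>
  have "indep_vars (\<lambda>v. PiM {c # v} (\<lambda>_. borel)) (\<lambda>v \<omega>. restrict (\<lambda>i. U i \<omega>) {c # v}) tree_vertices"
    using U sub by (intro indep_vars_restrict [where K = "\<lambda>v. {c # v}" and I = tree_vertices])
      (auto simp: gaussian_disorder_def disjoint_family_on_def)
  then have "indep_vars (\<lambda>_. borel) (\<lambda>v \<omega>. (restrict (\<lambda>i. U i \<omega>) {c # v}) (c # v)) tree_vertices"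
    by (rule indep_vars_compose2) (auto intro: measurable_component_singleton)
  then show ?thesis
    using U sub by (auto simp: gaussian_disorder_def)
qed

lemma (in prob_space) indep_var_disjoint_disorder:
  assumes U: "gaussian_disorder M U" and AB: "A \<inter> B = {}" "A \<subseteq> tree_vertices" "B \<subseteq> tree_vertices"
    and f: "f \<in> borel_measurable (PiM A (\<lambda>_. borel))" "g \<in> borel_measurable (PiM B (\<lambda>_. borel))"
  shows "indep_var borel (\<lambda>\<omega>. f (restrict (\<lambda>v. U v \<omega>) A)) borel (\<lambda>\<omega>. g (restrict (\<lambda>v. U v \<omega>) B))"
proof -
  have "indep_var (PiM A (\<lambda>_. borel)) (\<lambda>\<omega>. restrict (\<lambda>v. U v \<omega>) A)
      (PiM B (\<lambda>_. borel)) (\<lambda>\<omega>. restrict (\<lambda>v. U v \<omega>) B)"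
    using U AB by (intro indep_var_restrict [of _ _ tree_vertices]) (auto simp: gaussian_disorder_def)
  from indep_var_compose [OF this f] show ?thesis by (simp add: comp_def)
qed

lemma borel_measurable_hamiltonian:
  assumes "\<And>v. v \<in> tree_vertices \<Longrightarrow> (\<lambda>x. u x v) \<in> borel_measurable N" "\<sigma> \<in> configs n"
  shows "(\<lambda>x. hamiltonian (u x) h n \<sigma>) \<in> borel_measurable N"
  unfolding hamiltonian_def branching_energy_def
  by (intro borel_measurable_add borel_measurable_sum borel_measurable_const assms)
     (use assms(2) in \<open>auto intro!: take_in_tree\<close>)

lemma borel_measurable_partition_fn:
  assumes "\<And>v. v \<in> tree_vertices \<Longrightarrow> (\<lambda>x. u x v) \<in> borel_measurable N"
  shows "(\<lambda>x. partition_fn (u x) \<beta> h n) \<in> borel_measurable N"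
  unfolding partition_fn_def
  by (intro borel_measurable_sum measurable_compose [OF _ borel_measurable_exp]
        borel_measurable_times borel_measurable_const borel_measurable_hamiltonian assms)

lemma hamiltonian_cong:
  assumes "\<And>v. v \<in> tree_vertices \<Longrightarrow> u v = u' v" "\<sigma> \<in> configs n"
  shows "hamiltonian u h n \<sigma> = hamiltonian u' h n \<sigma>"
  unfolding hamiltonian_def branching_energy_def
  using assms(2) by (auto intro!: sum.cong assms(1) take_in_tree [of _ n])

lemma partition_fn_cong:
  assumes "\<And>v. v \<in> tree_vertices \<Longrightarrow> u v = u' v"
  shows "partition_fn u \<beta> h n = partition_fn u' \<beta> h n"
  unfolding partition_fn_def using hamiltonian_cong [OF assms] by (auto intro!: sum.cong)

text \<open>
  The share of the partition function that passes through the child \<open>c\<close> of the root; \<open>n\<close> counts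
  the levels above that child.
\<close>

definition branch_weight :: "(real list \<Rightarrow> real) \<Rightarrow> real \<Rightarrow> real \<Rightarrow> nat \<Rightarrow> real \<Rightarrow> real" where
  "branch_weight u \<beta> h n c = exp (\<beta> * (u [c] + h * c)) * partition_fn (\<lambda>v. u (c # v)) \<beta> h n"

lemma partition_fn_Suc_branches:
  "partition_fn u \<beta> h (Suc n) = branch_weight u \<beta> h n 1 + branch_weight u \<beta> h n (-1)"
  by (simp add: partition_fn_Suc branch_weight_def)

lemma singleton_in_tree: "c \<in> {-1, 1} \<Longrightarrow> [c] \<in> tree_vertices"
  by (auto simp: tree_vertices_def configs_def)

lemma Cons_in_tree: "c \<in> {-1, 1} \<Longrightarrow> v \<in> tree_vertices \<Longrightarrow> c # v \<in> tree_vertices"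
  by (auto simp: tree_vertices_def configs_def)

lemma (in prob_space) indep_branch_weights:
  assumes U: "gaussian_disorder M U"
  shows "indep_var borel (\<lambda>\<omega>. branch_weight (\<lambda>v. U v \<omega>) \<beta> h n 1) borel (\<lambda>\<omega>. branch_weight (\<lambda>v. U v \<omega>) \<beta> h n (-1))"
proof -
  let ?A = "\<lambda>c :: real. {v \<in> tree_vertices. hd v = c}"
  have m: "(\<lambda>x. branch_weight x \<beta> h n c) \<in> borel_measurable (PiM (?A c) (\<lambda>_. borel))"
    if c: "c \<in> {-1, 1}" for c
    unfolding branch_weight_def using singleton_in_tree [OF c] Cons_in_tree [OF c]
    by (intro borel_measurable_times measurable_compose [OF _ borel_measurable_exp] borel_measurable_add
        borel_measurable_const borel_measurable_partition_fn measurable_component_singleton) auto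
  have eq: "branch_weight (restrict u (?A c)) \<beta> h n c = branch_weight u \<beta> h n c" if c: "c \<in> {-1, 1}" for c u
    unfolding branch_weight_def using singleton_in_tree [OF c] Cons_in_tree [OF c]
    by (auto intro!: partition_fn_cong)
  have "indep_var borel (\<lambda>\<omega>. branch_weight (restrict (\<lambda>v. U v \<omega>) (?A 1)) \<beta> h n 1)
      borel (\<lambda>\<omega>. branch_weight (restrict (\<lambda>v. U v \<omega>) (?A (-1))) \<beta> h n (-1))"
    by (rule indep_var_disjoint_disorder [OF U]) (auto intro!: m)
  then show ?thesis by (simp add: eq)
qed

lemma (in prob_space) indep_root_subtree:
  assumes U: "gaussian_disorder M U" and c: "c \<in> {-1, 1}"
    and f: "f \<in> borel_measurable borel" "g \<in> borel_measurable borel"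
  shows "indep_var borel (\<lambda>\<omega>. f (U [c] \<omega>)) borel (\<lambda>\<omega>. g (partition_fn (\<lambda>v. U (c # v) \<omega>) \<beta> h n))"
proof -
  let ?B = "(#) c ` tree_vertices"
  have B: "?B \<subseteq> tree_vertices" using Cons_in_tree [OF c] by auto
  have "indep_var borel (\<lambda>\<omega>. f ((restrict (\<lambda>v. U v \<omega>) {[c]}) [c]))
      borel (\<lambda>\<omega>. g (partition_fn (\<lambda>v. (restrict (\<lambda>v. U v \<omega>) ?B) (c # v)) \<beta> h n))"
  proof (rule indep_var_disjoint_disorder [OF U])
    show "{[c]} \<inter> ?B = {}" by (auto simp: tree_vertices_def configs_def)
    show "(\<lambda>x. f (x [c])) \<in> borel_measurable (PiM {[c]} (\<lambda>_. borel))"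
      by (intro measurable_compose [OF _ f(1)] measurable_component_singleton) auto
    show "(\<lambda>x. g (partition_fn (\<lambda>v. x (c # v)) \<beta> h n)) \<in> borel_measurable (PiM ?B (\<lambda>_. borel))"
      by (intro measurable_compose [OF _ f(2)] borel_measurable_partition_fn measurable_component_singleton) auto
  qed (use B singleton_in_tree [OF c] in auto)
  also have "(\<lambda>\<omega>. g (partition_fn (\<lambda>v. (restrict (\<lambda>v. U v \<omega>) ?B) (c # v)) \<beta> h n))
     = (\<lambda>\<omega>. g (partition_fn (\<lambda>v. U (c # v) \<omega>) \<beta> h n))"
    by (intro ext arg_cong [of _ _ g] partition_fn_cong) auto
  finally show ?thesis by simp
qed

lemma std_normal_density_tendsto_0:
  "(std_normal_density \<longlongrightarrow> 0) at_top" "(std_normal_density \<longlongrightarrow> 0) at_bot"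
  unfolding std_normal_density_def by real_asymp+

text \<open>
  Gaussian integration by parts for a logistic function \<open>g\<close>, which solves \<open>g' = \<beta> (g - g\<^sup>2)\<close>. As
  a function of one disorder variable, with all others kept, the Gibbs mass of a cylinder has exactly
  this form.
\<close>

lemma std_normal_logistic_by_parts:
  fixes w \<beta> :: real
  assumes w: "0 \<le> w"
  defines "g \<equiv> \<lambda>x. exp (\<beta> * x) / (exp (\<beta> * x) + w)"
  shows "(\<integral>x. std_normal_density x * (x * g x) \<partial>lborel) = (\<integral>x. std_normal_density x * (\<beta> * (g x - (g x)\<^sup>2)) \<partial>lborel)"
proof -
  let ?n = std_normal_density
  have pos: "exp (\<beta> * x) + w > 0" for x using w by (simp add: add_pos_nonneg)
  have g01: "0 \<le> g x" "g x \<le> 1" for x using w pos [of x] by (auto simp: g_def)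
  have [measurable]: "g \<in> borel_measurable borel" unfolding g_def by measurable
  have i1: "integrable lborel (\<lambda>x. ?n x * (x * g x))"
  proof (rule Bochner_Integration.integrable_bound)
    show "integrable lborel (\<lambda>x. ?n x * \<bar>x\<bar>)"
      using integrable_std_normal_moment_abs [of 1] by simp
    show "AE x in lborel. norm (?n x * (x * g x)) \<le> norm (?n x * \<bar>x\<bar>)"
      using g01 by (intro AE_I2) (auto simp: abs_mult intro!: mult_left_mono mult_left_le)
  qed measurable
  have i2: "integrable lborel (\<lambda>x. ?n x * (\<beta> * (g x - (g x)\<^sup>2)))"
  proof (rule Bochner_Integration.integrable_bound)
    show "integrable lborel (\<lambda>x. ?n x * \<bar>\<beta>\<bar>)" by simp
    have "0 \<le> g x - (g x)\<^sup>2" "g x - (g x)\<^sup>2 \<le> 1" for x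
      using g01 [of x] by (auto simp: power2_eq_square mult_left_le add_increasing2 intro: order.trans [of _ "g x"])
    then show "AE x in lborel. norm (?n x * (\<beta> * (g x - (g x)\<^sup>2))) \<le> norm (?n x * \<bar>\<beta>\<bar>)"
      by (intro AE_I2) (auto simp: abs_mult intro!: mult_left_mono mult_left_le)
  qed measurable
  let ?f = "\<lambda>x. ?n x * (x * g x) - ?n x * (\<beta> * (g x - (g x)\<^sup>2))"
  \<comment> \<open>Since the density \<open>n\<close> satisfies \<open>n' = - x n\<close>, the difference of the two integrands is the
  derivative of \<open>- n g\<close>.\<close>
  let ?F = "\<lambda>x. - (?n x * g x)"
  have d: "(?F has_real_derivative ?f x) (at x)" for x
  proof -
    have dn: "(?n has_real_derivative - (x * ?n x)) (at x)"
    proof -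
      have "((\<lambda>x. exp (- x\<^sup>2 / 2)) has_real_derivative - (x * exp (- x\<^sup>2 / 2))) (at x)"
        by (auto intro!: derivative_eq_intros)
      from DERIV_cmult [OF this, of "1 / sqrt (2 * pi)"] show ?thesis
        unfolding std_normal_density_def by (simp add: mult_ac)
    qed
    have dg: "(g has_real_derivative \<beta> * (g x - (g x)\<^sup>2)) (at x)"
    proof -
      have eq: "(\<beta> * a * d - a * (\<beta> * a)) / (d * d) = \<beta> * (a / d - (a / d)\<^sup>2)" if "d \<noteq> 0" for a d :: real
        using that by (simp add: field_simps power2_eq_square)
      have d1: "((\<lambda>x. exp (\<beta> * x)) has_real_derivative \<beta> * exp (\<beta> * x)) (at x)"
        by (auto intro!: derivative_eq_intros)
      have d2: "((\<lambda>x. exp (\<beta> * x) + w) has_real_derivative \<beta> * exp (\<beta> * x)) (at x)"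
        by (auto intro!: derivative_eq_intros)
      have ne: "exp (\<beta> * x) + w \<noteq> 0" using pos [of x] by linarith
      show ?thesis
        unfolding g_def by (rule DERIV_cong [OF DERIV_divide [OF d1 d2 ne] eq [OF ne]])
    qed
    show ?thesis
      by (rule derivative_eq_intros dn dg refl)+ (simp add: algebra_simps)
  qed
  have lim: "(?F \<longlongrightarrow> 0) at_top" "(?F \<longlongrightarrow> 0) at_bot"
    using g01 by (auto intro!: Lim_null_comparison [OF always_eventually std_normal_density_tendsto_0(1)]
      Lim_null_comparison [OF always_eventually std_normal_density_tendsto_0(2)] simp: abs_mult mult_left_le)
  have "(LBINT x=-\<infinity>..\<infinity>. ?f x) = 0 - 0"
  proof (rule interval_integral_FTC_integrable [where F = ?F])
    show "set_integrable lborel (einterval (-\<infinity>) \<infinity>) ?f"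
      using i1 i2 by (simp add: set_integrable_def)
    show "isCont ?f x" for x
      unfolding std_normal_density_def g_def using pos [of x]
      by (intro continuous_intros) auto
  qed (use d lim in \<open>auto simp: has_real_derivative_iff_has_vector_derivative ereal_tendsto_simps\<close>)
  then have "(\<integral>x. ?f x \<partial>lborel) = 0"
    by (simp add: interval_lebesgue_integral_def set_lebesgue_integral_def)
  then show ?thesis
    using i1 i2 by simp
qed

lemma (in prob_space) gaussian_logistic_by_parts:
  fixes \<beta> :: real
  assumes X: "distributed M lborel X std_normal_density" and ind: "indep_var borel X borel W"
    and W: "\<And>\<omega>. 0 \<le> W \<omega>"
  defines "g \<equiv> \<lambda>\<omega>. exp (\<beta> * X \<omega>) / (exp (\<beta> * X \<omega>) + W \<omega>)"
  shows "expectation (\<lambda>\<omega>. X \<omega> * g \<omega>) = \<beta> * (expectation g - expectation (\<lambda>\<omega>. (g \<omega>)\<^sup>2))"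
proof -
  let ?g = "\<lambda>x w. exp (\<beta> * x) / (exp (\<beta> * x) + \<bar>w\<bar>) :: real"
  have [measurable]: "X \<in> borel_measurable M" "W \<in> borel_measurable M"
    using indep_var_rv1 [OF ind] indep_var_rv2 [OF ind] by auto
  have pos: "exp (\<beta> * x) + \<bar>w\<bar> > 0" for x w :: real by (simp add: add_pos_nonneg)
  have g01: "0 \<le> ?g x w" "?g x w \<le> 1" for x w using pos [of x w] by auto
  have g: "g = (\<lambda>\<omega>. ?g (X \<omega>) (W \<omega>))" by (simp add: g_def W fun_eq_iff)
  have gg: "0 \<le> ?g x w - (?g x w)\<^sup>2" "?g x w - (?g x w)\<^sup>2 \<le> 1" for x w
  proof -
    have "(?g x w)\<^sup>2 \<le> ?g x w * 1"
      unfolding power2_eq_square by (intro mult_left_mono g01)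
    then show "0 \<le> ?g x w - (?g x w)\<^sup>2" by simp
    show "?g x w - (?g x w)\<^sup>2 \<le> 1" using g01(2) [of x w] zero_le_power2 [of "?g x w"] by linarith
  qed
  have Xi: "integrable M X"
    using integrable_std_normal_moment [of 1] by (intro distributed_integrable_var [OF X]) auto
  interpret PX: prob_space "distr M borel X" by (rule prob_space_distr) simp
  interpret PW: prob_space "distr M borel W" by (rule prob_space_distr) simp
  interpret P: pair_prob_space "distr M borel X" "distr M borel W" ..
  have J: "distr M borel X \<Otimes>\<^sub>M distr M borel W = distr M (borel \<Otimes>\<^sub>M borel) (\<lambda>\<omega>. (X \<omega>, W \<omega>))"
    using ind by (simp add: indep_var_distribution_eq)
  have Fub: "expectation (\<lambda>\<omega>. f (X \<omega>) (W \<omega>)) = (\<integral>w. (\<integral>x. f x w \<partial>distr M borel X) \<partial>distr M borel W)"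
    if [measurable]: "case_prod f \<in> borel_measurable (borel \<Otimes>\<^sub>M borel)"
      and i: "integrable M (\<lambda>\<omega>. f (X \<omega>) (W \<omega>))" for f :: "real \<Rightarrow> real \<Rightarrow> real"
  proof -
    have "integrable (distr M borel X \<Otimes>\<^sub>M distr M borel W) (case_prod f)"
      unfolding J using i by (subst integrable_distr_eq) auto
    then have "(\<integral>w. (\<integral>x. f x w \<partial>distr M borel X) \<partial>distr M borel W)
        = integral\<^sup>L (distr M borel X \<Otimes>\<^sub>M distr M borel W) (case_prod f)"
      by (rule P.integral_snd)
    also have "\<dots> = expectation (\<lambda>\<omega>. f (X \<omega>) (W \<omega>))"
      unfolding J by (subst integral_distr) auto
    finally show ?thesis by simp
  qed
  have i1: "integrable M (\<lambda>\<omega>. X \<omega> * ?g (X \<omega>) (W \<omega>))"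
  proof (rule Bochner_Integration.integrable_bound [OF Xi])
    show "AE \<omega> in M. norm (X \<omega> * ?g (X \<omega>) (W \<omega>)) \<le> norm (X \<omega>)"
      unfolding real_norm_def abs_mult abs_of_nonneg [OF g01(1)]
      by (intro AE_I2 mult_left_le g01(2) abs_ge_zero)
  qed measurable
  have i2: "integrable M (\<lambda>\<omega>. ?g (X \<omega>) (W \<omega>))"
    by (rule integrable_const_bound [where B = 1]) (use g01 in auto)
  have i3: "integrable M (\<lambda>\<omega>. (?g (X \<omega>) (W \<omega>))\<^sup>2)"
    by (rule integrable_const_bound [where B = 1]) (use g01 in \<open>auto intro!: power_le_one simp del: abs_divide\<close>)
  have inner: "(\<integral>x. x * ?g x w \<partial>distr M borel X) = (\<integral>x. \<beta> * (?g x w - (?g x w)\<^sup>2) \<partial>distr M borel X)" for w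
  proof -
    have law: "(\<integral>x. f x \<partial>distr M borel X) = (\<integral>x. std_normal_density x * f x \<partial>lborel)"
      if "f \<in> borel_measurable borel" for f :: "real \<Rightarrow> real"
      using that by (simp add: integral_distr distributed_integral [OF X])
    show ?thesis
      using std_normal_logistic_by_parts [of "\<bar>w\<bar>" \<beta>] by (subst (1 2) law) auto
  qed
  have "expectation (\<lambda>\<omega>. X \<omega> * ?g (X \<omega>) (W \<omega>))
      = expectation (\<lambda>\<omega>. \<beta> * (?g (X \<omega>) (W \<omega>) - (?g (X \<omega>) (W \<omega>))\<^sup>2))"
    using i1 i2 i3 inner
    by (subst (1 2) Fub) auto
  also have "\<dots> = \<beta> * (expectation (\<lambda>\<omega>. ?g (X \<omega>) (W \<omega>)) - expectation (\<lambda>\<omega>. (?g (X \<omega>) (W \<omega>))\<^sup>2))"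
    using i2 i3 by simp
  finally show ?thesis unfolding g .
qed

section \<open>The partition function above the critical temperature\<close>

lemma beta_c_pos: "beta_c h > 0"
  and beta_c_eq: "psi h (beta_c h) = beta_c h * (beta_c h + h * tanh (h * beta_c h))"
proof -
  have "beta_c h > 0 \<and> beta_c h * deriv (psi h) (beta_c h) - psi h (beta_c h) = 0"
    unfolding beta_c_def by (rule theI' [OF beta_c_unique])
  then show "beta_c h > 0" "psi h (beta_c h) = beta_c h * (beta_c h + h * tanh (h * beta_c h))"
    by (auto simp: deriv_psi)
qed

text \<open>
  The map \<open>t \<mapsto> t \<psi>'(t) - \<psi>(t)\<close> is negative at \<open>0\<close> and \<open>\<beta>\<^sub>c\<close> is its only positive zero.
\<close>

lemma below_beta_c:
  assumes "0 < t" "t < beta_c h"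
  shows "t * (t + h * tanh (h * t)) < psi h t"
proof (rule ccontr)
  define g where "g t = t * (t + h * tanh (h * t)) - psi h t" for t
  assume "\<not> ?thesis"
  then have "0 \<le> g t" by (simp add: g_def)
  moreover have "g 0 \<le> 0" by (simp add: g_def psi_def)
  moreover have "continuous_on {0..t} g"
    unfolding g_def [abs_def] psi_def by (intro continuous_intros) (auto simp: cosh_real_pos)
  ultimately obtain s where s: "0 \<le> s" "s \<le> t" "g s = 0"
    using IVT' [of g 0 0 t] assms by auto
  have "s \<noteq> 0" using s by (auto simp: g_def psi_def)
  then have "0 < s \<and> s * deriv (psi h) s - psi h s = 0"
    using s by (simp add: g_def deriv_psi)
  moreover have "0 < beta_c h \<and> beta_c h * deriv (psi h) (beta_c h) - psi h (beta_c h) = 0"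
    using beta_c_pos [of h] beta_c_eq [of h] by (simp add: deriv_psi)
  ultimately have "s = beta_c h"
    using beta_c_unique [of h] by blast
  then show False using s assms by simp
qed

text \<open>
  At \<open>p = 1\<close> the derivative of \<open>p \<mapsto> \<psi>(p t) - p \<psi>(t)\<close> is \<open>t \<psi>'(t) - \<psi>(t)\<close>, negative below
  \<open>\<beta>\<^sub>c\<close>. Such an exponent makes the recursion for the \<open>p\<close>-th moments of the normalised partition
  function contractive. Exponents close
  to \<open>1\<close> are essential: the second moment already diverges at some \<open>t\<close> below \<open>\<beta>\<^sub>c\<close>.
\<close>

lemma ex_subadditive_exponent:
  assumes "0 < t" "t < beta_c h"
  shows "\<exists>p. 1 < p \<and> p \<le> 2 \<and> psi h (p * t) < p * psi h t"
proof -
  define f where "f p = psi h (p * t) - p * psi h t" for p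
  have "(f has_real_derivative (t + h * tanh (h * t)) * t - psi h t) (at 1)"
    unfolding f_def [abs_def]
    by (rule derivative_eq_intros DERIV_chain' [where g = "psi h", OF _ DERIV_psi] | simp)+
  moreover have "(t + h * tanh (h * t)) * t - psi h t < 0"
    using below_beta_c [OF assms] by (simp add: mult.commute)
  ultimately obtain d where d: "d > 0" "\<And>x. 0 < x \<Longrightarrow> x < d \<Longrightarrow> f (1 + x) < f 1"
    using DERIV_neg_dec_right by blast
  then have "f (1 + min (d / 2) 1) < f 1" by simp
  then show ?thesis
    using d(1) by (intro exI [of _ "1 + min (d / 2) 1"]) (auto simp: f_def)
qed

text \<open>
  For independent \<open>x\<close> and \<open>y\<close> only the first two terms on the right involve moments of order
  \<open>p\<close>; the others are controlled by the means.
\<close>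

lemma powr_add_le_superlinear:
  fixes x y p :: real
  assumes "0 \<le> x" "0 \<le> y" "1 < p" "p \<le> 2"
  shows "(x + y) powr p \<le> x powr p + y powr p + x + y + 2 * (x * y)"
proof -
  have split: "z powr p = z * z powr (p - 1)" if "0 \<le> z" for z :: real
    using that powr_add [of z 1 "p - 1"] by (cases "z = 0") auto
  have le: "z powr (p - 1) \<le> 1 + z" if "0 \<le> z" for z :: real
  proof -
    have "z powr (p - 1) \<le> (1 + z) powr (p - 1)" using that assms by (intro powr_mono2) auto
    also have "\<dots> \<le> (1 + z) powr 1" using that assms by (intro powr_mono) auto
    finally show ?thesis using that by simp
  qed
  have "(x + y) powr p \<le> (x + y) * (x powr (p - 1) + y powr (p - 1))"
    unfolding split [OF add_nonneg_nonneg [OF assms(1,2)]] using assms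
    by (intro mult_left_mono powr_add_le) auto
  also have "\<dots> = x powr p + y powr p + x * y powr (p - 1) + y * x powr (p - 1)"
    using assms by (simp add: split algebra_simps)
  also have "\<dots> \<le> x powr p + y powr p + x * (1 + y) + y * (1 + x)"
    using assms by (intro add_mono mult_left_mono le order.refl) auto
  finally show ?thesis by (simp add: algebra_simps)
qed

lemma (in prob_space) partition_fn_moment:
  assumes "gaussian_disorder M U"
  shows "integrable M (\<lambda>\<omega>. partition_fn (\<lambda>v. U v \<omega>) t h n)"
    and "expectation (\<lambda>\<omega>. partition_fn (\<lambda>v. U v \<omega>) t h n) = exp (real n * psi h t)"
  using perturbed_partition_fn_moment [OF assms, of 0 n t h 0] by (simp_all add: perturbed_partition_fn_0)

lemma (in prob_space) measurable_partition_fn [measurable]: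
  assumes "gaussian_disorder M U"
  shows "(\<lambda>\<omega>. partition_fn (\<lambda>v. U v \<omega>) t h n) \<in> borel_measurable M"
  using partition_fn_moment(1) [OF assms] by (rule borel_measurable_integrable)

lemma branch_weight_pos: "0 < branch_weight u \<beta> h n c"
  by (simp add: branch_weight_def partition_fn_pos)

lemma (in prob_space) branch_weight_powr_moment:
  assumes U: "gaussian_disorder M U" and c: "c \<in> {-1, 1}"
    and i: "integrable M (\<lambda>\<omega>. partition_fn (\<lambda>v. U (c # v) \<omega>) t h n powr p)"
  shows "integrable M (\<lambda>\<omega>. branch_weight (\<lambda>v. U v \<omega>) t h n c powr p)"
    and "expectation (\<lambda>\<omega>. branch_weight (\<lambda>v. U v \<omega>) t h n c powr p) =
      exp (p * t * h * c + (p * t)\<^sup>2 / 2) * expectation (\<lambda>\<omega>. partition_fn (\<lambda>v. U (c # v) \<omega>) t h n powr p)"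
proof -
  let ?e = "\<lambda>\<omega>. exp (p * t * U [c] \<omega>)"
  let ?Z = "\<lambda>\<omega>. partition_fn (\<lambda>v. U (c # v) \<omega>) t h n powr p"
  have eq: "branch_weight (\<lambda>v. U v \<omega>) t h n c powr p = exp (p * t * h * c) * (?e \<omega> * ?Z \<omega>)" for \<omega>
  proof -
    have "exp (t * (U [c] \<omega> + h * c)) powr p = exp (p * t * h * c) * ?e \<omega>"
      by (simp add: powr_def exp_add [symmetric] algebra_simps)
    then show ?thesis
      using partition_fn_pos by (simp add: branch_weight_def powr_mult less_imp_le)
  qed
  have ind: "indep_var borel ?e borel ?Z"
    by (rule indep_root_subtree [OF U c, of "\<lambda>x. exp (p * t * x)" "\<lambda>x. x powr p"]) measurable
  have e: "integrable M ?e" "expectation ?e = exp ((p * t)\<^sup>2 / 2)"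
    using U singleton_in_tree [OF c] by (auto intro!: std_normal_exp_moment simp: gaussian_disorder_def)
  show "integrable M (\<lambda>\<omega>. branch_weight (\<lambda>v. U v \<omega>) t h n c powr p)"
    unfolding eq by (intro integrable_mult_right indep_var_integrable ind e i)
  show "expectation (\<lambda>\<omega>. branch_weight (\<lambda>v. U v \<omega>) t h n c powr p) =
      exp (p * t * h * c + (p * t)\<^sup>2 / 2) * expectation ?Z"
    unfolding eq by (simp add: indep_var_lebesgue_integral [OF ind e(1) i] e exp_add)
qed

text \<open>
  Write \<open>W\<^sub>n = Z\<^sub>n / E Z\<^sub>n\<close>. Splitting the tree at the root gives \<open>W\<^sub>n\<^sub>+\<^sub>1 = x + y\<close> with \<open>x, y\<close>
  independent and \<open>E x + E y = 1\<close>, whence \<open>E W\<^sub>n\<^sub>+\<^sub>1\<^sup>p \<le> \<rho> E W\<^sub>n\<^sup>p + 3\<close> with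
  \<open>\<rho> = exp (\<psi>(p t) - p \<psi>(t)) < 1\<close>. The constant \<open>1 + 3 / (1 - \<rho>)\<close> is invariant under this
  recursion and bounds the initial value.
\<close>

lemma (in prob_space) partition_fn_powr_moment_bound:
  fixes t p h :: real
  assumes p: "1 < p" "p \<le> 2" "psi h (p * t) < p * psi h t"
  defines "\<rho> \<equiv> exp (psi h (p * t) - p * psi h t)"
  shows "gaussian_disorder M U \<Longrightarrow>
    integrable M (\<lambda>\<omega>. partition_fn (\<lambda>v. U v \<omega>) t h n powr p) \<and>
    expectation (\<lambda>\<omega>. partition_fn (\<lambda>v. U v \<omega>) t h n powr p)
      \<le> (1 + 3 / (1 - \<rho>)) * exp (real n * psi h t) powr p"
proof (induction n arbitrary: U)
  case 0
  have "\<rho> < 1" using p by (simp add: \<rho>_def)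
  then show ?case by (simp add: prob_space)
next
  case (Suc n)
  note U = Suc.prems
  define C where "C = 1 + 3 / (1 - \<rho>)"
  define a where "a = exp (real (Suc n) * psi h t)"
  have a: "a > 0" by (simp add: a_def)
  have \<rho>: "0 < \<rho>" "\<rho> < 1" using p by (auto simp: \<rho>_def)
  have C: "0 < C" "\<rho> * C + 3 \<le> C"
  proof -
    have "3 / (1 - \<rho>) > 0" using \<rho> by simp
    then show "0 < C" unfolding C_def by linarith
    have "(1 - \<rho>) * C = (1 - \<rho>) + 3" using \<rho> by (simp add: C_def divide_simps)
    then show "\<rho> * C + 3 \<le> C" using \<rho> by (simp add: algebra_simps)
  qed
  define x where "x c \<omega> = branch_weight (\<lambda>v. U v \<omega>) t h n c / a" for c \<omega>
  have x0: "0 < x c \<omega>" for c \<omega>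
    using branch_weight_pos a by (simp add: x_def)
  have Z: "partition_fn (\<lambda>v. U v \<omega>) t h (Suc n) = a * (x 1 \<omega> + x (-1) \<omega>)" for \<omega>
    using a unfolding partition_fn_Suc_branches by (simp add: x_def field_simps)
  have ind: "indep_var borel (x 1) borel (x (-1))"
    using indep_var_compose [OF indep_branch_weights [OF U], of "\<lambda>y. y / a" borel "\<lambda>y. y / a" borel]
    by (simp add: x_def [abs_def] comp_def)
  have [measurable]: "x 1 \<in> borel_measurable M" "x (-1) \<in> borel_measurable M"
    using indep_var_rv1 [OF ind] indep_var_rv2 [OF ind] by auto
  have i12: "integrable M (\<lambda>\<omega>. a * (x 1 \<omega> + x (-1) \<omega>))"
    using partition_fn_moment(1) [OF U, of t h "Suc n"] unfolding Z .
  then have i12': "integrable M (\<lambda>\<omega>. x 1 \<omega> + x (-1) \<omega>)" using a by simp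
  have i1: "integrable M (x 1)"
    by (intro Bochner_Integration.integrable_bound [OF i12'] AE_I2)
       (auto simp: abs_of_pos x0 add_pos_pos less_imp_le)
  have i2: "integrable M (x (-1))"
    by (intro Bochner_Integration.integrable_bound [OF i12'] AE_I2)
       (auto simp: abs_of_pos x0 add_pos_pos less_imp_le)
  have "a * (expectation (x 1) + expectation (x (-1))) = a"
    using partition_fn_moment(2) [OF U, of t h "Suc n"] i1 i2 unfolding Z by (simp add: a_def)
  then have sum1: "expectation (x 1) + expectation (x (-1)) = 1" using a by simp
  have nonneg: "0 \<le> expectation (x c)" for c
    using x0 by (intro Bochner_Integration.integral_nonneg) (auto intro: less_imp_le)
  have xy: "integrable M (\<lambda>\<omega>. x 1 \<omega> * x (-1) \<omega>)" "expectation (\<lambda>\<omega>. x 1 \<omega> * x (-1) \<omega>) \<le> 1"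
  proof -
    show "integrable M (\<lambda>\<omega>. x 1 \<omega> * x (-1) \<omega>)" by (intro indep_var_integrable ind i1 i2)
    have "expectation (x 1) * expectation (x (-1)) \<le> 1 * 1"
      using nonneg [of 1] nonneg [of "-1"] sum1 by (intro mult_mono) linarith+
    then show "expectation (\<lambda>\<omega>. x 1 \<omega> * x (-1) \<omega>) \<le> 1"
      using indep_var_lebesgue_integral [OF ind i1 i2] by simp
  qed
  have xp: "integrable M (\<lambda>\<omega>. x c \<omega> powr p) \<and>
      expectation (\<lambda>\<omega>. x c \<omega> powr p) \<le> exp (p * t * h * c + (p * t)\<^sup>2 / 2) * exp (- p * psi h t) * C"
    if c: "c \<in> {-1, 1}" for c
  proof -
    note IH = Suc.IH [OF gaussian_disorder_subtree [OF U c]]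
    note m = branch_weight_powr_moment [OF U c IH [THEN conjunct1]]
    have eq: "x c \<omega> powr p = branch_weight (\<lambda>v. U v \<omega>) t h n c powr p / a powr p" for \<omega>
      using branch_weight_pos a by (simp add: x_def powr_divide less_imp_le)
    have "expectation (\<lambda>\<omega>. x c \<omega> powr p) \<le>
        exp (p * t * h * c + (p * t)\<^sup>2 / 2) * (C * exp (real n * psi h t) powr p) / a powr p"
      unfolding eq using m(2) IH a by (auto intro!: divide_right_mono simp: C_def)
    also have "exp (real n * psi h t) powr p = exp (- p * psi h t) * a powr p"
      unfolding a_def by (simp add: powr_def exp_add [symmetric] algebra_simps)
    finally show ?thesis using m(1) a unfolding eq by (simp add: mult_ac)
  qed
  note xp1 = xp [of 1, simplified] and xp2 = xp [of "-1", simplified]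
  have sum\<rho>: "exp (p * t * h + (p * t)\<^sup>2 / 2) + exp ((p * t)\<^sup>2 / 2 - p * t * h) = exp (psi h (p * t))"
  proof -
    have "exp (A + B) + exp (B - A) = exp B * (2 * cosh A)" for A B :: real
      by (simp add: cosh_def distrib_left exp_add [symmetric] add.commute)
    then show ?thesis using exp_psi [of 1 h "p * t"] by simp
  qed
  let ?R = "\<lambda>\<omega>. x 1 \<omega> powr p + x (-1) \<omega> powr p + x 1 \<omega> + x (-1) \<omega> + 2 * (x 1 \<omega> * x (-1) \<omega>)"
  have le: "(x 1 \<omega> + x (-1) \<omega>) powr p \<le> ?R \<omega>" for \<omega>
    by (rule powr_add_le_superlinear [OF less_imp_le [OF x0] less_imp_le [OF x0] p(1,2)])
  have iR: "integrable M ?R"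
    using xp1 xp2 i1 i2 xy by (intro Bochner_Integration.integrable_add integrable_mult_right) auto
  have iW: "integrable M (\<lambda>\<omega>. (x 1 \<omega> + x (-1) \<omega>) powr p)"
  proof (rule Bochner_Integration.integrable_bound [OF iR])
    show "AE \<omega> in M. norm ((x 1 \<omega> + x (-1) \<omega>) powr p) \<le> norm (?R \<omega>)"
      using order.trans [OF le abs_ge_self] by (intro AE_I2) simp
  qed measurable
  have "expectation (\<lambda>\<omega>. (x 1 \<omega> + x (-1) \<omega>) powr p) \<le> expectation ?R"
    by (intro integral_mono iW iR le)
  also have "expectation ?R = expectation (\<lambda>\<omega>. x 1 \<omega> powr p) + expectation (\<lambda>\<omega>. x (-1) \<omega> powr p)
      + (expectation (x 1) + expectation (x (-1))) + 2 * expectation (\<lambda>\<omega>. x 1 \<omega> * x (-1) \<omega>)"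
    using xp1 xp2 i1 i2 xy by simp
  also have "\<dots> \<le> (exp (p * t * h + (p * t)\<^sup>2 / 2) + exp ((p * t)\<^sup>2 / 2 - p * t * h)) * exp (- p * psi h t) * C + 3"
    using xp1 xp2 xy sum1 by (simp add: algebra_simps)
  also have "\<dots> = \<rho> * C + 3"
    unfolding sum\<rho> by (simp add: \<rho>_def exp_diff exp_minus divide_inverse)
  finally have *: "expectation (\<lambda>\<omega>. (x 1 \<omega> + x (-1) \<omega>) powr p) \<le> C" using C by linarith
  have powr: "partition_fn (\<lambda>v. U v \<omega>) t h (Suc n) powr p = a powr p * (x 1 \<omega> + x (-1) \<omega>) powr p" for \<omega>
    unfolding Z using a x0 by (simp add: powr_mult add_pos_pos less_imp_le)
  show ?case
    unfolding powr C_def [symmetric] a_def [symmetric] using iW * a by (auto simp: mult.commute)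
qed

text \<open>
  A Paley-Zygmund argument with exponent \<open>p\<close>: mean one and a bounded \<open>p\<close>-th moment prevent \<open>W\<^sub>n\<close>
  from being small with probability close to one, uniformly in \<open>n\<close>.
\<close>

lemma (in prob_space) partition_fn_not_small:
  assumes t: "0 < t" "t < beta_c h"
  shows "\<exists>c>0. \<forall>n U. gaussian_disorder M U \<longrightarrow>
    prob {\<omega> \<in> space M. partition_fn (\<lambda>v. U v \<omega>) t h n < exp (real n * psi h t) / 2} \<le> 1 - c"
proof -
  obtain p where p: "1 < p" "p \<le> 2" "psi h (p * t) < p * psi h t"
    using ex_subadditive_exponent [OF t] by blast
  define C where "C = 1 + 3 / (1 - exp (psi h (p * t) - p * psi h t))"
  have "exp (psi h (p * t) - p * psi h t) < 1" using p by simp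
  then have C: "1 \<le> C" by (simp add: C_def)
  \<comment> \<open>\<open>W \<le> 1/2 + K 1{W \<ge> 1/2} + W\<^sup>p K\<^sup>1\<^sup>-\<^sup>p\<close>; this \<open>K\<close> brings the mean of the last term down to
  \<open>1/4\<close>.\<close>
  define K where "K = (4 * C) powr (1 / (p - 1))"
  have K: "0 < K" using C by (simp add: K_def)
  have Kp: "K powr (1 - p) = 1 / (4 * C)"
  proof -
    have "1 / (p - 1) * (1 - p) = - 1" using p by (simp add: field_simps)
    then show ?thesis
      unfolding K_def powr_powr using C by (simp add: powr_minus_divide)
  qed
  have "prob {\<omega> \<in> space M. partition_fn (\<lambda>v. U v \<omega>) t h n < exp (real n * psi h t) / 2} \<le> 1 - 1 / (4 * K)"
    if U: "gaussian_disorder M U" for U n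
  proof -
    let ?Z = "\<lambda>\<omega>. partition_fn (\<lambda>v. U v \<omega>) t h n"
    define a where "a = exp (real n * psi h t)"
    have a: "0 < a" by (simp add: a_def)
    note [measurable] = measurable_partition_fn [OF U]
    define G where "G = {\<omega> \<in> space M. \<not> ?Z \<omega> < a / 2}"
    have G [measurable]: "G \<in> events" unfolding G_def by measurable
    have iG: "integrable M (indicat_real G)"
      by (rule integrable_real_indicator) (auto simp: emeasure_eq_measure)
    note m = partition_fn_powr_moment_bound [OF p U, of n, folded C_def a_def]
    define W where "W \<omega> = ?Z \<omega> / a" for \<omega>
    have W0: "0 < W \<omega>" for \<omega> using partition_fn_pos a by (simp add: W_def)
    have iW: "integrable M W" "expectation W = 1"
      using partition_fn_moment [OF U, of t h n] a by (auto simp: W_def [abs_def] a_def)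
    have Wp: "W \<omega> powr p = ?Z \<omega> powr p / a powr p" for \<omega>
      using partition_fn_pos a by (simp add: W_def powr_divide less_imp_le)
    have iWp: "integrable M (\<lambda>\<omega>. W \<omega> powr p)" "expectation (\<lambda>\<omega>. W \<omega> powr p) \<le> C"
      unfolding Wp using m a by (auto simp: divide_simps)
    have le: "W \<omega> \<le> 1 / 2 + K * indicator G \<omega> + W \<omega> powr p * K powr (1 - p)" if "\<omega> \<in> space M" for \<omega>
    proof (cases "W \<omega> \<le> K")
      case True
      have "W \<omega> \<le> 1 / 2 + K * indicator G \<omega>"
      proof (cases "?Z \<omega> < a / 2")
        case True
        then have "W \<omega> \<le> 1 / 2" using a by (simp add: W_def field_simps)
        then show ?thesis using K by (simp add: indicator_def)
      next
        case False
        then show ?thesis using \<open>W \<omega> \<le> K\<close> that by (simp add: G_def)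
      qed
      then show ?thesis by (simp add: add_increasing2)
    next
      case False
      have "W \<omega> = W \<omega> powr p * W \<omega> powr (1 - p)"
        using W0 [of \<omega>] by (simp add: powr_add [symmetric])
      also have "\<dots> \<le> W \<omega> powr p * K powr (1 - p)"
        using False K p by (intro mult_left_mono powr_mono2') auto
      moreover have "0 \<le> K * indicator G \<omega>" using K by (simp add: indicator_def)
      ultimately show ?thesis by linarith
    qed
    have "1 = expectation W" using iW by simp
    also have "\<dots> \<le> expectation (\<lambda>\<omega>. 1 / 2 + K * indicator G \<omega> + W \<omega> powr p * K powr (1 - p))"
      by (intro integral_mono iW le Bochner_Integration.integrable_add integrable_mult_right integrable_mult_left iWp)
         (simp_all add: iG)
    also have "\<dots> = 1 / 2 + K * prob G + expectation (\<lambda>\<omega>. W \<omega> powr p) * K powr (1 - p)"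
      using iWp by (simp add: prob_space iG)
    also have "\<dots> \<le> 1 / 2 + K * prob G + C * (1 / (4 * C))"
      unfolding Kp using iWp C by (intro add_left_mono mult_right_mono) auto
    finally have "1 / 4 \<le> K * prob G" using C by simp
    then have "1 / (4 * K) \<le> prob G" using K by (simp add: field_simps)
    moreover have "prob G = 1 - prob {\<omega> \<in> space M. ?Z \<omega> < a / 2}"
      unfolding G_def by (rule prob_neg) measurable
    ultimately show ?thesis unfolding a_def by linarith
  qed
  then show ?thesis using K by (intro exI [of _ "1 / (4 * K)"]) auto
qed

text \<open>
  If a branch weight is tiny, then the Gaussian at the child is very negative or the partition
  function of the subtree is tiny. The threshold is split as \<open>x + y\<close> between the two causes.
\<close>

lemma (in prob_space) branch_weight_small_prob:
  assumes U: "gaussian_disorder M U" and c: "c \<in> {-1, 1}" and t: "0 < t"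
  shows "prob {\<omega> \<in> space M. branch_weight (\<lambda>v. U v \<omega>) t h n c < exp (x + y)}
    \<le> exp (1 / 2 + (x / t + \<bar>h\<bar>)) + prob {\<omega> \<in> space M. partition_fn (\<lambda>v. U (c # v) \<omega>) t h n < exp y}"
proof -
  let ?Z = "\<lambda>\<omega>. partition_fn (\<lambda>v. U (c # v) \<omega>) t h n"
  note [measurable] = measurable_partition_fn [OF gaussian_disorder_subtree [OF U c]]
    gaussian_disorder_rv [OF prob_space_axioms U singleton_in_tree [OF c]]
  let ?A = "{\<omega> \<in> space M. exp (- x / t - \<bar>h\<bar>) \<le> exp (- 1 * U [c] \<omega>)}"
  have X: "distributed M lborel (U [c]) std_normal_density"
    using U singleton_in_tree [OF c] by (auto simp: gaussian_disorder_def)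
  have "prob ?A \<le> expectation (\<lambda>\<omega>. exp (- 1 * U [c] \<omega>)) / exp (- x / t - \<bar>h\<bar>)"
    by (rule integral_Markov_inequality_measure [where A = "{}"])
       (use std_normal_exp_moment [OF X, of "-1"] in auto)
  also have "\<dots> = exp (1 / 2 + (x / t + \<bar>h\<bar>))"
    unfolding std_normal_exp_moment(2) [OF X] by (simp add: exp_diff [symmetric])
  finally have A: "prob ?A \<le> exp (1 / 2 + (x / t + \<bar>h\<bar>))" .
  have hc: "- \<bar>h\<bar> \<le> h * c" using c by auto
  have "{\<omega> \<in> space M. branch_weight (\<lambda>v. U v \<omega>) t h n c < exp (x + y)} \<subseteq> ?A \<union> {\<omega> \<in> space M. ?Z \<omega> < exp y}"
  proof
    fix \<omega> assume \<omega>: "\<omega> \<in> {\<omega> \<in> space M. branch_weight (\<lambda>v. U v \<omega>) t h n c < exp (x + y)}"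
    have "\<omega> \<in> ?A" if "exp y \<le> ?Z \<omega>"
    proof (rule ccontr)
      assume "\<omega> \<notin> ?A"
      then have "- U [c] \<omega> < - x / t - \<bar>h\<bar>" using \<omega> by auto
      then have "x / t < U [c] \<omega> + h * c" using hc by (simp add: minus_divide_left [symmetric])
      then have "x \<le> t * (U [c] \<omega> + h * c)" using t by (simp add: field_simps)
      then have "exp x * exp y \<le> branch_weight (\<lambda>v. U v \<omega>) t h n c"
        unfolding branch_weight_def using that by (intro mult_mono) auto
      then show False using \<omega> by (simp add: exp_add)
    qed
    then show "\<omega> \<in> ?A \<union> {\<omega> \<in> space M. ?Z \<omega> < exp y}" using \<omega> by force
  qed
  then have "prob {\<omega> \<in> space M. branch_weight (\<lambda>v. U v \<omega>) t h n c < exp (x + y)}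
      \<le> prob (?A \<union> {\<omega> \<in> space M. ?Z \<omega> < exp y})"
    by (rule finite_measure_mono) measurable
  also have "\<dots> \<le> prob ?A + prob {\<omega> \<in> space M. ?Z \<omega> < exp y}"
    by (rule measure_Un_le) measurable
  finally show ?thesis using A by linarith
qed

text \<open>
  Let \<open>L\<close> bound the probability of an exponentially small \<open>W\<^sub>n\<close>, for every rate and all large \<open>n\<close>. If
  \<open>W\<^sub>n\<^sub>+\<^sub>1\<close> is small then both independent branches are small, so \<open>L\<close> improves to its square, up to
  the error \<open>\<eta>\<close> from the Gaussian at the child.
\<close>

lemma (in prob_space) lower_tail_bound_improves:
  fixes t h :: real
  assumes t: "0 < t"
  defines "S \<equiv> {L. \<forall>\<epsilon>>0. \<exists>N. \<forall>n\<ge>N. \<forall>U. gaussian_disorder M U \<longrightarrow>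
    prob {\<omega> \<in> space M. partition_fn (\<lambda>v. U v \<omega>) t h n < exp (real n * (psi h t - \<epsilon>))} \<le> L}"
  assumes L: "L \<in> S" and \<eta>: "0 < \<eta>"
  shows "(\<eta> + L)\<^sup>2 \<in> S"
  unfolding S_def
proof (intro CollectI allI impI)
  fix \<epsilon> :: real assume \<epsilon>: "\<epsilon> > 0"
  \<comment> \<open>Half of the rate is spent on the Gaussian at the child, the other half on its subtree.\<close>
  define x where "x n = psi h t - real (Suc n) * (\<epsilon> / 2)" for n
  have "(\<lambda>n. exp (1 / 2 + (x n / t + \<bar>h\<bar>))) \<longlonglongrightarrow> 0"
    unfolding x_def using \<epsilon> t by real_asymp
  then have "\<forall>\<^sub>F n in sequentially. exp (1 / 2 + (x n / t + \<bar>h\<bar>)) < \<eta>"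
    using \<eta> by (rule order_tendstoD)
  then obtain N1 where N1: "\<And>n. n \<ge> N1 \<Longrightarrow> exp (1 / 2 + (x n / t + \<bar>h\<bar>)) < \<eta>"
    by (auto simp: eventually_sequentially)
  have "\<epsilon> / 2 > 0" using \<epsilon> by simp
  then obtain N2 where N2: "\<And>n U. n \<ge> N2 \<Longrightarrow> gaussian_disorder M U \<Longrightarrow>
    prob {\<omega> \<in> space M. partition_fn (\<lambda>v. U v \<omega>) t h n < exp (real n * (psi h t - \<epsilon> / 2))} \<le> L"
    using L unfolding S_def by blast
  show "\<exists>N. \<forall>n\<ge>N. \<forall>U. gaussian_disorder M U \<longrightarrow>
    prob {\<omega> \<in> space M. partition_fn (\<lambda>v. U v \<omega>) t h n < exp (real n * (psi h t - \<epsilon>))} \<le> (\<eta> + L)\<^sup>2"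
  proof (intro exI [of _ "Suc (max N1 N2)"] allI impI)
    fix n' U assume n': "n' \<ge> Suc (max N1 N2)" and U: "gaussian_disorder M U"
    then obtain n where n: "n' = Suc n" "n \<ge> N1" "n \<ge> N2" by (cases n') auto
    define e where "e = exp (real n' * (psi h t - \<epsilon>))"
    let ?w = "\<lambda>c \<omega>. branch_weight (\<lambda>v. U v \<omega>) t h n c"
    note ind = indep_branch_weights [OF U, of t h n]
    note [measurable] = indep_var_rv1 [OF ind] indep_var_rv2 [OF ind] measurable_partition_fn [OF U]
    have small: "prob {\<omega> \<in> space M. ?w c \<omega> < e} \<le> \<eta> + L" if c: "c \<in> {-1, 1}" for c
    proof -
      let ?Z = "\<lambda>\<omega>. partition_fn (\<lambda>v. U (c # v) \<omega>) t h n"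
      note [measurable] = measurable_partition_fn [OF gaussian_disorder_subtree [OF U c]]
      define y where "y = real n * psi h t - real (Suc n) * (\<epsilon> / 2)"
      have e: "e = exp (x n + y)"
        unfolding e_def x_def y_def n(1) by (simp add: algebra_simps)
      have "y \<le> real n * (psi h t - \<epsilon> / 2)" using \<epsilon> by (simp add: y_def algebra_simps)
      then have "exp y \<le> exp (real n * (psi h t - \<epsilon> / 2))" by simp
      then have "prob {\<omega> \<in> space M. ?Z \<omega> < exp y} \<le> prob {\<omega> \<in> space M. ?Z \<omega> < exp (real n * (psi h t - \<epsilon> / 2))}"
        by (intro finite_measure_mono) (auto intro: order.strict_trans2)
      then show ?thesis
        using branch_weight_small_prob [OF U c t, of h n "x n" y] N1 [OF n(2)]
          N2 [OF n(3) gaussian_disorder_subtree [OF U c]] unfolding e by linarith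
    qed
    have "{\<omega> \<in> space M. partition_fn (\<lambda>v. U v \<omega>) t h n' < e} \<subseteq> {\<omega> \<in> space M. ?w 1 \<omega> < e \<and> ?w (-1) \<omega> < e}"
    proof -
      have "partition_fn (\<lambda>v. U v \<omega>) t h n' < e \<Longrightarrow> ?w 1 \<omega> < e \<and> ?w (-1) \<omega> < e" for \<omega>
        using branch_weight_pos [of "\<lambda>v. U v \<omega>" t h n 1] branch_weight_pos [of "\<lambda>v. U v \<omega>" t h n "-1"]
        unfolding n(1) partition_fn_Suc_branches by linarith
      then show ?thesis by auto
    qed
    then have "prob {\<omega> \<in> space M. partition_fn (\<lambda>v. U v \<omega>) t h n' < e}
        \<le> prob {\<omega> \<in> space M. ?w 1 \<omega> < e \<and> ?w (-1) \<omega> < e}"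
      by (rule finite_measure_mono) measurable
    also have "\<dots> = prob {\<omega> \<in> space M. ?w 1 \<omega> < e} * prob {\<omega> \<in> space M. ?w (-1) \<omega> < e}"
      using prob_indep_random_variable [OF ind, of "{..<e}" "{..<e}"] by simp
    also have "\<dots> \<le> (\<eta> + L) * (\<eta> + L)"
      by (intro mult_mono small measure_nonneg order.trans [OF measure_nonneg small]) auto
    finally show "prob {\<omega> \<in> space M. partition_fn (\<lambda>v. U v \<omega>) t h n' < exp (real n' * (psi h t - \<epsilon>))} \<le> (\<eta> + L)\<^sup>2"
      by (simp add: e_def power2_eq_square)
  qed
qed

text \<open>
  The infimum \<open>I\<close> of the admissible bounds satisfies \<open>I \<le> I\<^sup>2\<close>. Since the previous estimates give
  \<open>I < 1\<close>, it vanishes.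
\<close>

lemma (in prob_space) partition_fn_lower_tail:
  assumes t: "0 < t" "t < beta_c h" and \<epsilon>: "\<epsilon> > 0" and \<delta>: "\<delta> > 0"
  shows "\<exists>N. \<forall>n\<ge>N. \<forall>U. gaussian_disorder M U \<longrightarrow>
    prob {\<omega> \<in> space M. partition_fn (\<lambda>v. U v \<omega>) t h n < exp (real n * (psi h t - \<epsilon>))} \<le> \<delta>"
proof (cases "\<exists>U. gaussian_disorder M U")
  case True
  then obtain U0 where U0: "gaussian_disorder M U0" ..
  define S where "S \<equiv> {L. \<forall>\<epsilon>>0. \<exists>N. \<forall>n\<ge>N. \<forall>U. gaussian_disorder M U \<longrightarrow>
    prob {\<omega> \<in> space M. partition_fn (\<lambda>v. U v \<omega>) t h n < exp (real n * (psi h t - \<epsilon>))} \<le> L}"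
  note step = lower_tail_bound_improves [OF t(1), of _ h, folded S_def]
  have nonneg: "0 \<le> L" if "L \<in> S" for L
  proof -
    have "\<exists>N. \<forall>n\<ge>N. \<forall>U. gaussian_disorder M U \<longrightarrow>
        prob {\<omega> \<in> space M. partition_fn (\<lambda>v. U v \<omega>) t h n < exp (real n * (psi h t - 1))} \<le> L"
      using that zero_less_one unfolding S_def by blast
    then obtain N where
      "prob {\<omega> \<in> space M. partition_fn (\<lambda>v. U0 v \<omega>) t h N < exp (real N * (psi h t - 1))} \<le> L"
      using U0 by blast
    then show ?thesis using measure_nonneg order.trans by blast
  qed
  obtain c where c: "c > 0" "\<And>n U. gaussian_disorder M U \<Longrightarrow>
    prob {\<omega> \<in> space M. partition_fn (\<lambda>v. U v \<omega>) t h n < exp (real n * psi h t) / 2} \<le> 1 - c"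
    using partition_fn_not_small [OF t] by blast
  have c_S: "1 - c \<in> S"
    unfolding S_def
  proof (intro CollectI allI impI)
    fix \<epsilon> :: real assume \<epsilon>: "\<epsilon> > 0"
    show "\<exists>N. \<forall>n\<ge>N. \<forall>U. gaussian_disorder M U \<longrightarrow>
      prob {\<omega> \<in> space M. partition_fn (\<lambda>v. U v \<omega>) t h n < exp (real n * (psi h t - \<epsilon>))} \<le> 1 - c"
    proof (intro exI [of _ "nat \<lceil>ln 2 / \<epsilon>\<rceil>"] allI impI)
      fix n U assume "nat \<lceil>ln 2 / \<epsilon>\<rceil> \<le> n" and U: "gaussian_disorder M U"
      then have "ln 2 / \<epsilon> \<le> real n" by linarith
      then have "ln 2 \<le> real n * \<epsilon>" using \<epsilon> by (simp add: field_simps)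
      then have "2 \<le> exp (real n * \<epsilon>)" by (metis exp_le_cancel_iff exp_ln zero_less_numeral)
      then have "exp (real n * (psi h t - \<epsilon>)) * 2 \<le> exp (real n * (psi h t - \<epsilon>)) * exp (real n * \<epsilon>)"
        by (intro mult_left_mono) auto
      also have "\<dots> = exp (real n * psi h t)" by (simp add: exp_add [symmetric] algebra_simps)
      finally have le: "exp (real n * (psi h t - \<epsilon>)) \<le> exp (real n * psi h t) / 2" by simp
      note [measurable] = measurable_partition_fn [OF U]
      have "prob {\<omega> \<in> space M. partition_fn (\<lambda>v. U v \<omega>) t h n < exp (real n * (psi h t - \<epsilon>))}
          \<le> prob {\<omega> \<in> space M. partition_fn (\<lambda>v. U v \<omega>) t h n < exp (real n * psi h t) / 2}"
        using le by (intro finite_measure_mono) auto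
      then show "prob {\<omega> \<in> space M. partition_fn (\<lambda>v. U v \<omega>) t h n < exp (real n * (psi h t - \<epsilon>))} \<le> 1 - c"
        using c(2) [OF U, of n] by linarith
    qed
  qed
  define I where "I = Inf S"
  have bdd: "bdd_below S" by (rule bdd_belowI [where m = 0]) (rule nonneg)
  have I0: "0 \<le> I" unfolding I_def using nonneg c_S by (intro cInf_greatest) auto
  have I1: "I < 1"
    using cInf_lower [OF c_S bdd] c(1) by (simp add: I_def)
  have "I \<le> I\<^sup>2"
  proof (rule field_le_epsilon)
    fix e :: real assume e: "e > 0"
    define \<eta> where "\<eta> = min 1 (e / 8)"
    have \<eta>: "0 < \<eta>" "\<eta> \<le> 1" "8 * \<eta> \<le> e" using e by (auto simp: \<eta>_def)
    obtain L where L: "L \<in> S" "L < I + \<eta>"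
      using cInf_lessD [of S "I + \<eta>"] c_S \<eta> by (auto simp: I_def)
    have "I \<le> (\<eta> + L)\<^sup>2"
      unfolding I_def by (rule cInf_lower [OF step [OF L(1) \<eta>(1)] bdd])
    also have "\<dots> \<le> (I + 2 * \<eta>)\<^sup>2"
      using L nonneg [OF L(1)] \<eta> by (intro power_mono) auto
    also have "\<dots> = I\<^sup>2 + 4 * (I * \<eta>) + 4 * (\<eta> * \<eta>)" by (simp add: power2_eq_square algebra_simps)
    also have "\<dots> \<le> I\<^sup>2 + 4 * \<eta> + 4 * \<eta>"
      using I0 I1 \<eta> by (intro add_mono mult_left_mono order.refl) (auto simp: mult_left_le_one_le mult_left_le)
    finally show "I \<le> I\<^sup>2 + e" using \<eta> by linarith
  qed
  then have "I = 0"
    using I0 I1 mult_strict_left_mono [OF I1, of I] by (cases "I = 0") (auto simp: power2_eq_square)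
  then obtain L where L: "L \<in> S" "L < \<delta>"
    using cInf_lessD [of S \<delta>] c_S \<delta> by (auto simp: I_def)
  obtain N where N: "\<And>n U. n \<ge> N \<Longrightarrow> gaussian_disorder M U \<Longrightarrow>
    prob {\<omega> \<in> space M. partition_fn (\<lambda>v. U v \<omega>) t h n < exp (real n * (psi h t - \<epsilon>))} \<le> L"
    using L(1) \<epsilon> unfolding S_def by blast
  show ?thesis
    using order.trans [OF N less_imp_le [OF L(2)]] by blast
qed auto

section \<open>The free energy\<close>

lemma (in prob_space) integrable_ln_partition_fn:
  assumes "gaussian_disorder M U"
  shows "integrable M (\<lambda>\<omega>. ln (partition_fn (\<lambda>v. U v \<omega>) \<beta> h n))"
  using integrable_ln_perturbed_partition_fn [OF assms, of 0 n \<beta> h 0] by (simp add: perturbed_partition_fn_0)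

text \<open>
  Outside an event of small probability \<open>ln Z\<^sub>n\<close> is at least \<open>n (\<psi>(t) - \<epsilon>)\<close>. On that event the
  contribution of the single configuration \<open>(1, \<dots>, 1)\<close> bounds \<open>ln Z\<^sub>n\<close> from below by \<open>t\<close> times a
  centred Gaussian of variance \<open>n\<close>, which costs only order \<open>\<surd>n\<close>.
\<close>

lemma (in prob_space) free_energy_high_temperature:
  assumes U: "gaussian_disorder M U" and h: "0 \<le> h" and t: "0 < t" "t < beta_c h" and \<epsilon>: "0 < \<epsilon>"
  shows "\<forall>\<^sub>F n in sequentially.
    real n * (psi h t - \<epsilon>) \<le> expectation (\<lambda>\<omega>. ln (partition_fn (\<lambda>v. U v \<omega>) t h n))"
proof -
  define \<delta> where "\<delta> = \<epsilon> / 3 / (\<bar>psi h t - \<epsilon> / 3\<bar> + 1)"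
  have \<delta>: "0 < \<delta>" "\<bar>psi h t - \<epsilon> / 3\<bar> * \<delta> \<le> \<epsilon> / 3"
    using \<epsilon> by (auto simp: \<delta>_def field_simps add_pos_nonneg add_nonneg_pos intro!: divide_pos_pos)
  have "\<epsilon> / 3 > 0" using \<epsilon> by simp
  then obtain N where N: "\<And>n. n \<ge> N \<Longrightarrow>
    prob {\<omega> \<in> space M. partition_fn (\<lambda>v. U v \<omega>) t h n < exp (real n * (psi h t - \<epsilon> / 3))} \<le> \<delta>"
    using partition_fn_lower_tail [OF t _ \<delta>(1)] U by blast
  have "(\<lambda>n. t * (2 * exp (1 / 2)) / sqrt (real n)) \<longlonglongrightarrow> 0"
    by real_asymp
  then have "\<forall>\<^sub>F n in sequentially. t * (2 * exp (1 / 2)) / sqrt (real n) < \<epsilon> / 3"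
    using \<epsilon> by (intro order_tendstoD) auto
  then show ?thesis
    using eventually_ge_at_top [of N] eventually_gt_at_top [of 0]
  proof eventually_elim
    case (elim n)
    let ?Z = "\<lambda>\<omega>. partition_fn (\<lambda>v. U v \<omega>) t h n"
    let ?\<sigma> = "replicate n (1 :: real)"
    let ?X = "\<lambda>\<omega>. branching_energy (\<lambda>v. U v \<omega>) n ?\<sigma>"
    \<comment> \<open>\<open>\<bar>X\<bar> \<le> (exp (l X) + exp (- l X)) / l\<close>; for \<open>X\<close> of variance \<open>n\<close> this scale gives
    \<open>E \<bar>X\<bar> = O(\<surd>n)\<close>.\<close>
    define l where "l = 1 / sqrt (real n)"
    have l: "0 < l" "real n * l\<^sup>2 = 1" using elim by (auto simp: l_def power_divide)
    define R where "R \<omega> = t / l * (exp (l * ?X \<omega>) + exp (- l * ?X \<omega>))" for \<omega>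
    have R: "integrable M R" "expectation R = t / l * (2 * exp (1 / 2))"
    proof -
      have mi: "integrable M (\<lambda>\<omega>. exp (a * ?X \<omega>))" "expectation (\<lambda>\<omega>. exp (a * ?X \<omega>)) = exp (real n * a\<^sup>2 / 2)" for a
        using branching_energy_exp_moment [OF U replicate_in_configs le0, of a n 0] by simp_all
      show "integrable M R" "expectation R = t / l * (2 * exp (1 / 2))"
        unfolding R_def [abs_def]
        by (intro integrable_mult_right Bochner_Integration.integrable_add mi)
           (simp only: integral_mult_right_zero Bochner_Integration.integral_add [OF mi(1) mi(1)] mi(2) power2_minus l(2) mult_2)
    qed
    note [measurable] = measurable_partition_fn [OF U]
    define B where "B = {\<omega> \<in> space M. ?Z \<omega> < exp (real n * (psi h t - \<epsilon> / 3))}"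
    have B [measurable]: "B \<in> events" unfolding B_def by measurable
    have iB: "integrable M (indicat_real B)"
      by (rule integrable_real_indicator) (auto simp: emeasure_eq_measure)
    have pB: "prob B \<le> \<delta>" unfolding B_def by (rule N) (use elim in simp)
    have le: "real n * (psi h t - \<epsilon> / 3) * (1 - indicator B \<omega>) - R \<omega> \<le> ln (?Z \<omega>)" if "\<omega> \<in> space M" for \<omega>
    proof -
      have R0: "0 \<le> R \<omega>" unfolding R_def using t l by simp
      show ?thesis
      proof (cases "\<omega> \<in> B")
        case True
        have "(\<Sum>i=1..n. ?\<sigma> ! (i - 1)) = real n"
          by (subst sum.cong [where h = "\<lambda>_. 1", OF refl]) auto
        then have "exp (t * ?X \<omega>) \<le> exp (t * hamiltonian (\<lambda>v. U v \<omega>) h n ?\<sigma>)"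
          using t h by (simp add: hamiltonian_def)
        also have "\<dots> \<le> ?Z \<omega>"
          unfolding partition_fn_def by (rule member_le_sum) (auto simp: replicate_in_configs finite_configs)
        finally have 1: "t * ?X \<omega> \<le> ln (?Z \<omega>)"
          using partition_fn_pos by (simp add: ln_ge_iff)
        have "- l * ?X \<omega> \<le> exp (- l * ?X \<omega>)" using exp_ge_add_one_self [of "- l * ?X \<omega>"] by linarith
        then have "- (l * ?X \<omega>) \<le> exp (l * ?X \<omega>) + exp (- l * ?X \<omega>)"
          using exp_gt_zero [of "l * ?X \<omega>"] by linarith
        then have "t / l * - (l * ?X \<omega>) \<le> R \<omega>"
          unfolding R_def using t l by (intro mult_left_mono) auto
        then have "- (t * ?X \<omega>) \<le> R \<omega>" using l by simp
        then show ?thesis using 1 True by simp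
      next
        case False
        then have "exp (real n * (psi h t - \<epsilon> / 3)) \<le> ?Z \<omega>" using that by (simp add: B_def)
        then have "real n * (psi h t - \<epsilon> / 3) \<le> ln (?Z \<omega>)"
          using partition_fn_pos by (simp add: ln_ge_iff)
        then show ?thesis using R0 False by simp
      qed
    qed
    have "real n * (psi h t - \<epsilon> / 3) * (1 - prob B) - t / l * (2 * exp (1 / 2)) =
        expectation (\<lambda>\<omega>. real n * (psi h t - \<epsilon> / 3) * (1 - indicator B \<omega>) - R \<omega>)"
      using R iB by (simp add: prob_space)
    also have "\<dots> \<le> expectation (\<lambda>\<omega>. ln (?Z \<omega>))"
      using R iB by (intro integral_mono le integrable_ln_partition_fn [OF U]) auto
    finally have 1: "real n * (psi h t - \<epsilon> / 3) * (1 - prob B) - t / l * (2 * exp (1 / 2)) \<le> expectation (\<lambda>\<omega>. ln (?Z \<omega>))" .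
    have "(psi h t - \<epsilon> / 3) * prob B \<le> \<bar>psi h t - \<epsilon> / 3\<bar> * \<delta>"
      using pB by (intro mult_mono) auto
    then have "(psi h t - \<epsilon> / 3) * prob B \<le> \<epsilon> / 3" using \<delta>(2) by (rule order.trans)
    moreover have "q * (1 - r) = q - q * r" for q r :: real by (simp add: right_diff_distrib)
    ultimately have "psi h t - 2 * \<epsilon> / 3 \<le> (psi h t - \<epsilon> / 3) * (1 - prob B)" by simp
    then have 2: "real n * (psi h t - 2 * \<epsilon> / 3) \<le> real n * (psi h t - \<epsilon> / 3) * (1 - prob B)"
      unfolding mult.assoc by (rule mult_left_mono) simp
    have 3: "t / l * (2 * exp (1 / 2)) \<le> real n * (\<epsilon> / 3)"
    proof -
      have "t / l * (2 * exp (1 / 2)) = real n * (t * (2 * exp (1 / 2)) / sqrt (real n))"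
        using elim by (simp add: l_def real_div_sqrt field_simps flip: power2_eq_square)
      also have "\<dots> \<le> real n * (\<epsilon> / 3)" using elim by (intro mult_left_mono) auto
      finally show ?thesis .
    qed
    have "real n * (psi h t - \<epsilon>) = real n * (psi h t - 2 * \<epsilon> / 3) - real n * (\<epsilon> / 3)"
      by (simp add: algebra_simps)
    also have "\<dots> \<le> real n * (psi h t - \<epsilon> / 3) * (1 - prob B) - t / l * (2 * exp (1 / 2))"
      by (rule diff_mono [OF 2 3])
    finally show ?case using 1 by (rule order.trans)
  qed
qed

lemma ln_partition_fn_convex:
  assumes "t\<^sub>1 < t\<^sub>2" "t\<^sub>2 < \<beta>"
  shows "(\<beta> - t\<^sub>2) * (ln (partition_fn u t\<^sub>2 h n) - ln (partition_fn u t\<^sub>1 h n))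
    \<le> (t\<^sub>2 - t\<^sub>1) * (ln (partition_fn u \<beta> h n) - ln (partition_fn u t\<^sub>2 h n))"
proof -
  let ?H = "hamiltonian u h n"
  define m where "m = (\<Sum>\<sigma>\<in>configs n. exp (t\<^sub>2 * ?H \<sigma>) * ?H \<sigma>) / partition_fn u t\<^sub>2 h n"
  have tangent: "ln (partition_fn u t h n) \<ge> ln (partition_fn u t\<^sub>2 h n) + (t - t\<^sub>2) * m" for t
  proof -
    have 1: "t\<^sub>2 * x + (t - t\<^sub>2) * x = t * x" for x by (simp add: algebra_simps)
    have 2: "(\<Sum>\<sigma>\<in>configs n. exp (t\<^sub>2 * ?H \<sigma>) * ((t - t\<^sub>2) * ?H \<sigma>))
        = (t - t\<^sub>2) * (\<Sum>\<sigma>\<in>configs n. exp (t\<^sub>2 * ?H \<sigma>) * ?H \<sigma>)"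
      by (simp add: sum_distrib_left mult_ac)
    show ?thesis
      using ln_sum_exp_ge_tangent [OF finite_configs [of n] configs_nonempty,
        where f = "\<lambda>\<sigma>. t\<^sub>2 * ?H \<sigma>" and g = "\<lambda>\<sigma>. (t - t\<^sub>2) * ?H \<sigma>"]
      unfolding 1 2 partition_fn_def m_def by simp
  qed
  have "(\<beta> - t\<^sub>2) * (ln (partition_fn u t\<^sub>2 h n) - ln (partition_fn u t\<^sub>1 h n)) \<le> (\<beta> - t\<^sub>2) * ((t\<^sub>2 - t\<^sub>1) * m)"
    using tangent [of t\<^sub>1] assms by (intro mult_left_mono) (auto simp: algebra_simps)
  also have "\<dots> = (t\<^sub>2 - t\<^sub>1) * ((\<beta> - t\<^sub>2) * m)" by simp
  also have "\<dots> \<le> (t\<^sub>2 - t\<^sub>1) * (ln (partition_fn u \<beta> h n) - ln (partition_fn u t\<^sub>2 h n))"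
    using tangent [of \<beta>] assms by (intro mult_left_mono) auto
  finally show ?thesis .
qed

text \<open>
  The free energy density below the critical temperature is linear in \<open>\<beta>\<close>: it continues \<open>\<psi>\<close> along
  its tangent at \<open>\<beta>\<^sub>c\<close>, which by the definition of \<open>\<beta>\<^sub>c\<close> passes through the origin.
\<close>

definition frozen_free_energy :: "real \<Rightarrow> real \<Rightarrow> real" where
  "frozen_free_energy \<beta> h = \<beta> / beta_c h * psi h (beta_c h)"

lemma frozen_free_energy_eq: "frozen_free_energy \<beta> h = \<beta> * (beta_c h + h * tanh (h * beta_c h))"
  using beta_c_pos [of h] by (simp add: frozen_free_energy_def beta_c_eq)

text \<open>
  The free energy is convex in \<open>\<beta>\<close> and equals \<open>\<psi>\<close> in the limit below \<open>\<beta>\<^sub>c\<close>. Extrapolating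
  linearly from two points just below \<open>\<beta>\<^sub>c\<close> bounds it from below by the tangent of \<open>\<psi>\<close> at
  \<open>\<beta>\<^sub>c\<close>.
\<close>

lemma (in prob_space) free_energy_low_temperature:
  assumes U: "gaussian_disorder M U" and h: "0 \<le> h" and \<beta>: "beta_c h < \<beta>" and \<epsilon>: "0 < \<epsilon>"
  shows "\<forall>\<^sub>F n in sequentially.
    real n * (frozen_free_energy \<beta> h - \<epsilon>) \<le> expectation (\<lambda>\<omega>. ln (partition_fn (\<lambda>v. U v \<omega>) \<beta> h n))"
proof -
  define b where "b = beta_c h"
  define \<psi>' where "\<psi>' t = t + h * tanh (h * t)" for t
  have b: "0 < b" "b < \<beta>" using beta_c_pos \<beta> by (auto simp: b_def)
  define \<eta> where "\<eta> = \<epsilon> / 4 / (\<beta> - b + 1)"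
  have \<eta>: "0 < \<eta>" "(\<beta> - b) * \<eta> \<le> \<epsilon> / 4" using \<epsilon> b by (auto simp: \<eta>_def field_simps)
  have "isCont (psi h) b" by (rule DERIV_isCont [OF DERIV_psi])
  then have "\<forall>\<^sub>F t in at b. psi h b - \<epsilon> / 4 < psi h t"
    using \<epsilon> unfolding isCont_def by (intro order_tendstoD) auto
  then have 1: "\<forall>\<^sub>F t in at_left b. psi h b - \<epsilon> / 4 < psi h t"
    by (rule filter_leD [OF at_le, rotated]) simp
  have "isCont \<psi>' b" unfolding \<psi>'_def by (intro continuous_intros) (simp add: cosh_real_nonzero)
  then have "\<forall>\<^sub>F t in at b. \<psi>' b - \<eta> < \<psi>' t"
    using \<eta> unfolding isCont_def by (intro order_tendstoD) auto
  then have 2: "\<forall>\<^sub>F t in at_left b. \<psi>' b - \<eta> < \<psi>' t"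
    by (rule filter_leD [OF at_le, rotated]) simp
  have 3: "\<forall>\<^sub>F t in at_left b. 0 < t"
    using b eventually_at_left_real [of 0 b] by (auto elim: eventually_mono)
  have "\<forall>\<^sub>F t in at_left b. psi h b - \<epsilon> / 4 < psi h t \<and> \<psi>' b - \<eta> < \<psi>' t \<and> 0 < t"
    using 1 2 3 by eventually_elim auto
  then obtain c where c: "c < b" "\<And>t. c < t \<Longrightarrow> t < b \<Longrightarrow> psi h b - \<epsilon> / 4 < psi h t \<and> \<psi>' b - \<eta> < \<psi>' t \<and> 0 < t"
    unfolding eventually_at_left_field by blast
  \<comment> \<open>At any point between \<open>c\<close> and \<open>\<beta>\<^sub>c\<close> both \<open>\<psi>\<close> and its derivative nearly attain their
  values at \<open>\<beta>\<^sub>c\<close>.\<close>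
  obtain t1 t2 where t: "c < t1" "t1 < t2" "t2 < b"
    using c(1) by (meson dense)
  have t0: "0 < t1" using c(2) [of t1] t by auto
  obtain \<xi> where \<xi>: "t1 < \<xi>" "\<xi> < t2" "psi h t2 - psi h t1 = (t2 - t1) * \<psi>' \<xi>"
    using MVT2 [OF t(2), of "psi h" \<psi>'] DERIV_psi unfolding \<psi>'_def by blast
  have \<psi>'\<xi>: "\<psi>' b - \<eta> < \<psi>' \<xi>" using c(2) [of \<xi>] t \<xi> by auto
  have \<psi>'0: "0 \<le> \<psi>' \<xi>" using t0 \<xi> h by (simp add: \<psi>'_def tanh_real_nonneg_iff)
  define R where "R = (\<beta> - t2) / (t2 - t1)"
  have R: "0 < R" "R * (t2 - t1) = \<beta> - t2" using t b by (auto simp: R_def)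
  define \<epsilon>' where "\<epsilon>' = \<epsilon> / 4 / (1 + R)"
  have \<epsilon>': "0 < \<epsilon>'" "(1 + R) * \<epsilon>' = \<epsilon> / 4" 
  proof -
    have "1 + R \<noteq> 0" using R by linarith
    then show "(1 + R) * \<epsilon>' = \<epsilon> / 4"
      unfolding \<epsilon>'_def by (metis nonzero_mult_div_cancel_left times_divide_eq_right)
    show "0 < \<epsilon>'" using \<epsilon> R by (simp add: \<epsilon>'_def)
  qed
  have main: "frozen_free_energy \<beta> h - \<epsilon> \<le> psi h t2 - \<epsilon>' + R * (psi h t2 - \<epsilon>' - psi h t1)"
  proof -
    have "frozen_free_energy \<beta> h = psi h b + (\<beta> - b) * \<psi>' b"
      unfolding frozen_free_energy_eq by (simp add: b_def beta_c_eq \<psi>'_def algebra_simps)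
    also have "(\<beta> - b) * \<psi>' b \<le> (\<beta> - b) * (\<psi>' \<xi> + \<eta>)"
      using \<psi>'\<xi> b by (intro mult_left_mono) auto
    also have "\<dots> \<le> (\<beta> - t2) * \<psi>' \<xi> + \<epsilon> / 4"
      using mult_right_mono [of "\<beta> - b" "\<beta> - t2" "\<psi>' \<xi>"] \<psi>'0 t \<eta> by (simp add: distrib_left)
    also have "(\<beta> - t2) * \<psi>' \<xi> = R * (psi h t2 - psi h t1)"
      unfolding \<xi>(3) R(2) [symmetric] by simp
    finally have "frozen_free_energy \<beta> h \<le> psi h b + (R * (psi h t2 - psi h t1) + \<epsilon> / 4)" by simp
    moreover have "psi h b \<le> psi h t2 + \<epsilon> / 4" using c(2) [of t2] t by auto
    moreover have "R * (psi h t2 - \<epsilon>' - psi h t1) - \<epsilon>' = R * (psi h t2 - psi h t1) - \<epsilon> / 4"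
      using \<epsilon>'(2) by (simp add: algebra_simps)
    ultimately show ?thesis using \<epsilon> by linarith
  qed
  let ?L = "\<lambda>t n. expectation (\<lambda>\<omega>. ln (partition_fn (\<lambda>v. U v \<omega>) t h n))"
  have "\<forall>\<^sub>F n in sequentially. real n * (psi h t2 - \<epsilon>') \<le> ?L t2 n"
    by (rule free_energy_high_temperature [OF U h _ _ \<epsilon>'(1)]) (use t t0 in \<open>auto simp: b_def\<close>)
  then show ?thesis
  proof eventually_elim
    case (elim n)
    note i = integrable_ln_partition_fn [OF U]
    have upper: "?L t1 n \<le> real n * psi h t1"
      using expectation_ln_perturbed_partition_fn_le [OF U, of 0 n 1 t1 h 0] by (simp add: perturbed_partition_fn_0)
    have "expectation (\<lambda>\<omega>. (\<beta> - t2) * (ln (partition_fn (\<lambda>v. U v \<omega>) t2 h n) - ln (partition_fn (\<lambda>v. U v \<omega>) t1 h n)))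
      \<le> expectation (\<lambda>\<omega>. (t2 - t1) * (ln (partition_fn (\<lambda>v. U v \<omega>) \<beta> h n) - ln (partition_fn (\<lambda>v. U v \<omega>) t2 h n)))"
      using t b by (intro integral_mono ln_partition_fn_convex) (auto intro!: i)
    then have "(\<beta> - t2) * (?L t2 n - ?L t1 n) \<le> (t2 - t1) * (?L \<beta> n - ?L t2 n)"
      using i by simp
    then have conv: "R * (?L t2 n - ?L t1 n) \<le> ?L \<beta> n - ?L t2 n"
      using t by (simp add: R_def field_simps)
    have "real n * (frozen_free_energy \<beta> h - \<epsilon>) \<le> real n * (psi h t2 - \<epsilon>' + R * (psi h t2 - \<epsilon>' - psi h t1))"
      by (intro mult_left_mono main) auto
    also have "\<dots> = real n * (psi h t2 - \<epsilon>') + R * (real n * (psi h t2 - \<epsilon>') - real n * psi h t1)"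
      by (simp add: algebra_simps)
    also have "\<dots> \<le> ?L t2 n + R * (?L t2 n - ?L t1 n)"
      using elim upper R by (intro add_mono mult_left_mono) auto
    also have "\<dots> \<le> ?L \<beta> n" using conv by simp
    finally show ?case .
  qed
qed

section \<open>Genealogical overlap of two replicas\<close>

definition cylinder :: "nat \<Rightarrow> real list \<Rightarrow> real list set" where
  "cylinder n v = {\<sigma> \<in> configs n. take (length v) \<sigma> = v}"

definition gibbs_weight :: "(real list \<Rightarrow> real) \<Rightarrow> real \<Rightarrow> real \<Rightarrow> nat \<Rightarrow> real list \<Rightarrow> real" where
  "gibbs_weight u \<beta> h n \<sigma> = exp (\<beta> * hamiltonian u h n \<sigma>) / partition_fn u \<beta> h n"

definition cylinder_mass :: "(real list \<Rightarrow> real) \<Rightarrow> real \<Rightarrow> real \<Rightarrow> nat \<Rightarrow> real list \<Rightarrow> real" where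
  "cylinder_mass u \<beta> h n v = (\<Sum>\<sigma>\<in>cylinder n v. gibbs_weight u \<beta> h n \<sigma>)"

text \<open>
  The Gibbs probability that two replicas agree on their first \<open>i\<close> spins, that is, that their
  genealogical overlap is at least \<open>i / n\<close>.
\<close>

definition coincidence :: "(real list \<Rightarrow> real) \<Rightarrow> real \<Rightarrow> real \<Rightarrow> nat \<Rightarrow> nat \<Rightarrow> real" where
  "coincidence u \<beta> h n i = (\<Sum>v\<in>configs i. (cylinder_mass u \<beta> h n v)\<^sup>2)"

lemma gibbs_weight_nonneg: "0 \<le> gibbs_weight u \<beta> h n \<sigma>"
  using partition_fn_pos [of u \<beta> h n] by (simp add: gibbs_weight_def)

lemma sum_gibbs_weight: "(\<Sum>\<sigma>\<in>configs n. gibbs_weight u \<beta> h n \<sigma>) = 1"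
  using partition_fn_pos [of u \<beta> h n]
  by (simp add: gibbs_weight_def sum_divide_distrib [symmetric] partition_fn_def)

lemma finite_cylinder: "finite (cylinder n v)"
  by (simp add: cylinder_def finite_configs)

lemma sum_configs_by_prefix:
  assumes "i \<le> n"
  shows "(\<Sum>\<sigma>\<in>configs n. f \<sigma>) = (\<Sum>v\<in>configs i. \<Sum>\<sigma>\<in>cylinder n v. f \<sigma>)"
proof -
  have "(\<Sum>\<sigma>\<in>configs n. f \<sigma>) = (\<Sum>v\<in>configs i. sum f {\<sigma> \<in> configs n. take i \<sigma> = v})"
    using assms by (intro sum.group [symmetric] finite_configs) (auto intro: take_in_configs)
  also have "\<dots> = (\<Sum>v\<in>configs i. \<Sum>\<sigma>\<in>cylinder n v. f \<sigma>)"
    by (intro sum.cong) (auto simp: cylinder_def configs_def)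
  finally show ?thesis .
qed

lemma sum_cylinder_mass: "i \<le> n \<Longrightarrow> (\<Sum>v\<in>configs i. cylinder_mass u \<beta> h n v) = 1"
  using sum_configs_by_prefix [of i n "gibbs_weight u \<beta> h n"] by (simp add: cylinder_mass_def sum_gibbs_weight)

lemma cylinder_mass_bounds: "0 \<le> cylinder_mass u \<beta> h n v" "cylinder_mass u \<beta> h n v \<le> 1"
proof -
  show "0 \<le> cylinder_mass u \<beta> h n v"
    unfolding cylinder_mass_def by (intro sum_nonneg gibbs_weight_nonneg)
  have "cylinder_mass u \<beta> h n v \<le> (\<Sum>\<sigma>\<in>configs n. gibbs_weight u \<beta> h n \<sigma>)"
    unfolding cylinder_mass_def
    by (intro sum_mono2) (auto simp: cylinder_def finite_configs gibbs_weight_nonneg)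
  then show "cylinder_mass u \<beta> h n v \<le> 1" by (simp add: sum_gibbs_weight)
qed

lemma coincidence_eq_pair_sum:
  assumes "i \<le> n"
  shows "coincidence u \<beta> h n i = (\<Sum>\<sigma>\<in>configs n. \<Sum>\<sigma>'\<in>configs n.
    gibbs_weight u \<beta> h n \<sigma> * gibbs_weight u \<beta> h n \<sigma>' * of_bool (take i \<sigma> = take i \<sigma>'))"
proof -
  let ?g = "gibbs_weight u \<beta> h n"
  have "(\<Sum>\<sigma>\<in>configs n. \<Sum>\<sigma>'\<in>configs n. ?g \<sigma> * ?g \<sigma>' * of_bool (take i \<sigma> = take i \<sigma>'))
      = (\<Sum>v\<in>configs i. \<Sum>\<sigma>\<in>cylinder n v. \<Sum>\<sigma>'\<in>configs n. ?g \<sigma> * ?g \<sigma>' * of_bool (take i \<sigma> = take i \<sigma>'))"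
    by (rule sum_configs_by_prefix [OF assms])
  also have "\<dots> = (\<Sum>v\<in>configs i. \<Sum>\<sigma>\<in>cylinder n v. \<Sum>\<sigma>'\<in>cylinder n v. ?g \<sigma> * ?g \<sigma>')"
  proof (rule sum.cong [OF refl], rule sum.cong [OF refl])
    fix v \<sigma> assume v: "v \<in> configs i" "\<sigma> \<in> cylinder n v"
    have l: "length v = i" using v by (simp add: configs_def)
    then have "take i \<sigma> = v" using v by (simp add: cylinder_def)
    then show "(\<Sum>\<sigma>'\<in>configs n. ?g \<sigma> * ?g \<sigma>' * of_bool (take i \<sigma> = take i \<sigma>')) = (\<Sum>\<sigma>'\<in>cylinder n v. ?g \<sigma> * ?g \<sigma>')"
      using l by (intro sum.mono_neutral_cong_right) (auto simp: finite_configs cylinder_def)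
  qed
  also have "\<dots> = coincidence u \<beta> h n i"
    unfolding coincidence_def cylinder_mass_def power2_eq_square by (simp add: sum_product)
  finally show ?thesis by simp
qed

lemma coincidence_antimono:
  assumes "i \<le> j" "j \<le> n"
  shows "coincidence u \<beta> h n j \<le> coincidence u \<beta> h n i"
proof -
  have prefix: "take i \<sigma> = take i \<sigma>'" if "take j \<sigma> = take j \<sigma>'" for \<sigma> \<sigma>' :: "real list"
    using arg_cong [OF that, of "take i"] assms by (simp add: min_def)
  have "of_bool (take j \<sigma> = take j \<sigma>') \<le> (of_bool (take i \<sigma> = take i \<sigma>') :: real)" for \<sigma> \<sigma>' :: "real list"
    using prefix [of \<sigma> \<sigma>'] by (cases "take j \<sigma> = take j \<sigma>'") simp_all
  then show ?thesis
    unfolding coincidence_eq_pair_sum [OF assms(2)] coincidence_eq_pair_sum [OF order.trans [OF assms]]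
    by (intro sum_mono mult_left_mono mult_nonneg_nonneg gibbs_weight_nonneg)
qed

text \<open>
  Isolates the dependence of the energies on the single disorder variable at \<open>v\<close>.
\<close>

lemma hamiltonian_resample:
  assumes \<sigma>: "\<sigma> \<in> configs n" and v: "1 \<le> length v" "length v \<le> n"
  shows "hamiltonian u h n \<sigma> = hamiltonian (u(v := 0)) h n \<sigma> + of_bool (\<sigma> \<in> cylinder n v) * u v"
proof -
  have l: "length \<sigma> = n" using \<sigma> by (simp add: configs_def)
  have "branching_energy u n \<sigma> = (\<Sum>i=1..n. (u(v := 0)) (take i \<sigma>) + (if i = length v then of_bool (take i \<sigma> = v) * u v else 0))"
    unfolding branching_energy_def using l by (intro sum.cong) auto
  also have "\<dots> = branching_energy (u(v := 0)) n \<sigma> + of_bool (take (length v) \<sigma> = v) * u v"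
    unfolding sum.distrib branching_energy_def using v by simp
  finally show ?thesis
    using \<sigma> by (simp add: hamiltonian_def cylinder_def)
qed

text \<open>
  The odds against the cylinder of \<open>v\<close> when the disorder at \<open>v\<close> is set to \<open>0\<close>. This quantity is
  independent of the variable at \<open>v\<close>, and it determines the mass of the cylinder together with it.
\<close>

definition outer_odds :: "(real list \<Rightarrow> real) \<Rightarrow> real \<Rightarrow> real \<Rightarrow> nat \<Rightarrow> real list \<Rightarrow> real" where
  "outer_odds u \<beta> h n v =
     (\<Sum>\<sigma>\<in>configs n - cylinder n v. exp (\<beta> * hamiltonian (u(v := 0)) h n \<sigma>)) /
     (\<Sum>\<sigma>\<in>cylinder n v. exp (\<beta> * hamiltonian (u(v := 0)) h n \<sigma>))"

lemma outer_odds_nonneg: "0 \<le> outer_odds u \<beta> h n v"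
  unfolding outer_odds_def by (intro divide_nonneg_nonneg sum_nonneg) auto

lemma cylinder_nonempty:
  assumes "v \<in> configs i" "i \<le> n"
  shows "cylinder n v \<noteq> {}"
proof -
  have "v @ replicate (n - i) 1 \<in> cylinder n v"
    using assms by (auto simp: cylinder_def configs_def)
  then show ?thesis by blast
qed

lemma cylinder_mass_logistic:
  assumes v: "v \<in> configs i" "1 \<le> i" "i \<le> n"
  shows "cylinder_mass u \<beta> h n v = exp (\<beta> * u v) / (exp (\<beta> * u v) + outer_odds u \<beta> h n v)"
proof -
  have l: "length v = i" using v by (simp add: configs_def)
  let ?e = "\<lambda>\<sigma>. exp (\<beta> * hamiltonian (u(v := 0)) h n \<sigma>)"
  define a where "a = (\<Sum>\<sigma>\<in>cylinder n v. ?e \<sigma>)"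
  define c where "c = (\<Sum>\<sigma>\<in>configs n - cylinder n v. ?e \<sigma>)"
  have a: "a > 0"
    unfolding a_def by (intro sum_pos finite_cylinder cylinder_nonempty [OF v(1,3)]) auto
  have c: "c \<ge> 0" unfolding c_def by (intro sum_nonneg) auto
  have sub: "cylinder n v \<subseteq> configs n" by (auto simp: cylinder_def)
  have in_cyl: "(\<Sum>\<sigma>\<in>cylinder n v. exp (\<beta> * hamiltonian u h n \<sigma>)) = exp (\<beta> * u v) * a"
    unfolding a_def sum_distrib_left
  proof (intro sum.cong refl)
    fix \<sigma> assume "\<sigma> \<in> cylinder n v"
    then show "exp (\<beta> * hamiltonian u h n \<sigma>) = exp (\<beta> * u v) * ?e \<sigma>"
      using sub v l by (subst hamiltonian_resample [of _ _ v]) (auto simp: distrib_left exp_add)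
  qed
  have out_cyl: "(\<Sum>\<sigma>\<in>configs n - cylinder n v. exp (\<beta> * hamiltonian u h n \<sigma>)) = c"
    unfolding c_def
  proof (intro sum.cong refl)
    fix \<sigma> assume "\<sigma> \<in> configs n - cylinder n v"
    then show "exp (\<beta> * hamiltonian u h n \<sigma>) = ?e \<sigma>"
      using v l by (subst hamiltonian_resample [of _ _ v]) auto
  qed
  have Z: "partition_fn u \<beta> h n = exp (\<beta> * u v) * a + c"
    unfolding partition_fn_def sum.subset_diff [OF sub finite_configs] in_cyl out_cyl by simp
  have "cylinder_mass u \<beta> h n v = exp (\<beta> * u v) * a / (exp (\<beta> * u v) * a + c)"
    unfolding cylinder_mass_def gibbs_weight_def sum_divide_distrib [symmetric] in_cyl Z ..
  also have "\<dots> = exp (\<beta> * u v) / (exp (\<beta> * u v) + c / a)"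
    using a by (simp add: field_simps)
  finally show ?thesis by (simp add: outer_odds_def a_def c_def)
qed

lemma (in prob_space) measurable_cylinder_mass:
  assumes "gaussian_disorder M U"
  shows "(\<lambda>\<omega>. cylinder_mass (\<lambda>v. U v \<omega>) \<beta> h n v) \<in> borel_measurable M"
  unfolding cylinder_mass_def gibbs_weight_def cylinder_def
  by (intro borel_measurable_sum borel_measurable_divide measurable_partition_fn assms
      measurable_compose [OF _ borel_measurable_exp] borel_measurable_times borel_measurable_const
      hamiltonian_measurable [OF prob_space_axioms assms]) auto

lemma (in prob_space) integrable_cylinder_mass:
  assumes "gaussian_disorder M U"
  shows "integrable M (\<lambda>\<omega>. cylinder_mass (\<lambda>v. U v \<omega>) \<beta> h n v)"
    and "integrable M (\<lambda>\<omega>. (cylinder_mass (\<lambda>v. U v \<omega>) \<beta> h n v)\<^sup>2)"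
  using measurable_cylinder_mass [OF assms]
  by (auto intro!: integrable_const_bound [where B = 1] AE_I2 power_le_one simp: cylinder_mass_bounds)

lemma (in prob_space) cylinder_mass_by_parts:
  assumes U: "gaussian_disorder M U" and v: "v \<in> configs i" "1 \<le> i" "i \<le> n"
  shows "integrable M (\<lambda>\<omega>. U v \<omega> * cylinder_mass (\<lambda>v. U v \<omega>) \<beta> h n v)"
    and "expectation (\<lambda>\<omega>. U v \<omega> * cylinder_mass (\<lambda>v. U v \<omega>) \<beta> h n v) =
      \<beta> * (expectation (\<lambda>\<omega>. cylinder_mass (\<lambda>v. U v \<omega>) \<beta> h n v)
        - expectation (\<lambda>\<omega>. (cylinder_mass (\<lambda>v. U v \<omega>) \<beta> h n v)\<^sup>2))"
proof -
  have vt: "v \<in> tree_vertices" using v by (intro configs_in_tree)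
  have X: "distributed M lborel (U v) std_normal_density"
    using U vt by (auto simp: gaussian_disorder_def)
  have Xi: "integrable M (U v)"
    using integrable_std_normal_moment [of 1] by (intro distributed_integrable_var [OF X]) auto
  note [measurable] = borel_measurable_integrable [OF Xi] measurable_cylinder_mass [OF U]
  show "integrable M (\<lambda>\<omega>. U v \<omega> * cylinder_mass (\<lambda>v. U v \<omega>) \<beta> h n v)"
  proof (rule Bochner_Integration.integrable_bound [OF Xi])
    show "AE \<omega> in M. norm (U v \<omega> * cylinder_mass (\<lambda>v. U v \<omega>) \<beta> h n v) \<le> norm (U v \<omega>)"
      unfolding real_norm_def abs_mult abs_of_nonneg [OF cylinder_mass_bounds(1)]
      by (intro AE_I2 mult_left_le cylinder_mass_bounds abs_ge_zero)
  qed measurable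
  let ?B = "tree_vertices - {v}"
  have m: "(\<lambda>x. outer_odds x \<beta> h n v) \<in> borel_measurable (PiM ?B (\<lambda>_. borel))"
  proof -
    have "(\<lambda>x. (x(v := 0)) w) \<in> borel_measurable (PiM ?B (\<lambda>_. borel :: real measure))" if "w \<in> tree_vertices" for w
      using that by (cases "w = v") (auto intro: measurable_component_singleton)
    then show ?thesis
      unfolding outer_odds_def cylinder_def
      by (intro borel_measurable_sum borel_measurable_divide
          measurable_compose [OF _ borel_measurable_exp] borel_measurable_times borel_measurable_const
          borel_measurable_hamiltonian) auto
  qed
  have eq: "outer_odds (restrict u ?B) \<beta> h n v = outer_odds u \<beta> h n v" for u
    unfolding outer_odds_def cylinder_def
    by (intro arg_cong2 [where f = "(/)"] sum.cong refl arg_cong [where f = exp] arg_cong2 [where f = "(*)"] hamiltonian_cong) auto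
  have "indep_var borel (\<lambda>\<omega>. (restrict (\<lambda>v. U v \<omega>) {v}) v) borel (\<lambda>\<omega>. outer_odds (restrict (\<lambda>v. U v \<omega>) ?B) \<beta> h n v)"
    using vt by (intro indep_var_disjoint_disorder [OF U] m measurable_component_singleton) auto
  then have ind: "indep_var borel (U v) borel (\<lambda>\<omega>. outer_odds (\<lambda>v. U v \<omega>) \<beta> h n v)"
    by (simp add: eq)
  show "expectation (\<lambda>\<omega>. U v \<omega> * cylinder_mass (\<lambda>v. U v \<omega>) \<beta> h n v) =
      \<beta> * (expectation (\<lambda>\<omega>. cylinder_mass (\<lambda>v. U v \<omega>) \<beta> h n v)
        - expectation (\<lambda>\<omega>. (cylinder_mass (\<lambda>v. U v \<omega>) \<beta> h n v)\<^sup>2))"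
    unfolding cylinder_mass_logistic [OF v]
    by (rule gaussian_logistic_by_parts [OF X ind outer_odds_nonneg])
qed

lemma gibbs_mean_branching_energy:
  assumes "k \<le> n"
  shows "(\<Sum>\<sigma>\<in>configs n. gibbs_weight u \<beta> h n \<sigma> * branching_energy u k \<sigma>)
    = (\<Sum>i=1..k. \<Sum>v\<in>configs i. u v * cylinder_mass u \<beta> h n v)"
proof -
  have "(\<Sum>\<sigma>\<in>configs n. gibbs_weight u \<beta> h n \<sigma> * branching_energy u k \<sigma>)
      = (\<Sum>i=1..k. \<Sum>\<sigma>\<in>configs n. gibbs_weight u \<beta> h n \<sigma> * u (take i \<sigma>))"
    unfolding branching_energy_def sum_distrib_left by (rule sum.swap)
  also have "\<dots> = (\<Sum>i=1..k. \<Sum>v\<in>configs i. u v * cylinder_mass u \<beta> h n v)"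
  proof (rule sum.cong [OF refl])
    fix i assume "i \<in> {1..k}"
    then have "i \<le> n" using assms by simp
    then have "(\<Sum>\<sigma>\<in>configs n. gibbs_weight u \<beta> h n \<sigma> * u (take i \<sigma>))
        = (\<Sum>v\<in>configs i. \<Sum>\<sigma>\<in>cylinder n v. gibbs_weight u \<beta> h n \<sigma> * u (take i \<sigma>))"
      by (rule sum_configs_by_prefix)
    also have "\<dots> = (\<Sum>v\<in>configs i. u v * cylinder_mass u \<beta> h n v)"
      unfolding cylinder_mass_def sum_distrib_left
      by (intro sum.cong refl) (auto simp: cylinder_def configs_def)
    finally show "(\<Sum>\<sigma>\<in>configs n. gibbs_weight u \<beta> h n \<sigma> * u (take i \<sigma>)) = (\<Sum>v\<in>configs i. u v * cylinder_mass u \<beta> h n v)" .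
  qed
  finally show ?thesis .
qed

lemma (in prob_space) integrable_coincidence:
  assumes "gaussian_disorder M U"
  shows "integrable M (\<lambda>\<omega>. coincidence (\<lambda>v. U v \<omega>) \<beta> h n i)"
  unfolding coincidence_def by (intro Bochner_Integration.integrable_sum integrable_cylinder_mass assms)

text \<open>
  Integration by parts at every vertex of level \<open>i\<close> contributes
  \<open>\<beta> \<Sum>\<^sub>v E (G(v) - G(v)\<^sup>2)\<close>, where the masses \<open>G(v)\<close> sum to one: the mean energy collected in the
  first \<open>k\<close> levels reveals the coincidence probabilities of two replicas.
\<close>

lemma (in prob_space) expectation_gibbs_mean_branching_energy:
  fixes \<beta> h :: real
  assumes U: "gaussian_disorder M U" and k: "k \<le> n"
  defines "X \<equiv> \<lambda>\<omega>. \<Sum>\<sigma>\<in>configs n. gibbs_weight (\<lambda>v. U v \<omega>) \<beta> h n \<sigma> * branching_energy (\<lambda>v. U v \<omega>) k \<sigma>"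
  shows "integrable M X"
    and "expectation X = \<beta> * (\<Sum>i=1..k. 1 - expectation (\<lambda>\<omega>. coincidence (\<lambda>v. U v \<omega>) \<beta> h n i))"
proof -
  have X: "X = (\<lambda>\<omega>. \<Sum>i=1..k. \<Sum>v\<in>configs i. U v \<omega> * cylinder_mass (\<lambda>v. U v \<omega>) \<beta> h n v)"
    unfolding X_def gibbs_mean_branching_energy [OF k] ..
  have bp: "integrable M (\<lambda>\<omega>. U v \<omega> * cylinder_mass (\<lambda>v. U v \<omega>) \<beta> h n v)"
    "expectation (\<lambda>\<omega>. U v \<omega> * cylinder_mass (\<lambda>v. U v \<omega>) \<beta> h n v) =
      \<beta> * (expectation (\<lambda>\<omega>. cylinder_mass (\<lambda>v. U v \<omega>) \<beta> h n v)
        - expectation (\<lambda>\<omega>. (cylinder_mass (\<lambda>v. U v \<omega>) \<beta> h n v)\<^sup>2))"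
    if "i \<in> {1..k}" "v \<in> configs i" for i v
    using cylinder_mass_by_parts [OF U that(2)] that(1) k by auto
  have int: "integrable M (\<lambda>\<omega>. \<Sum>v\<in>configs i. U v \<omega> * cylinder_mass (\<lambda>v. U v \<omega>) \<beta> h n v)"
    if "i \<in> {1..k}" for i
    by (rule Bochner_Integration.integrable_sum) (rule bp [OF that])
  show "integrable M X"
    unfolding X by (rule Bochner_Integration.integrable_sum) (rule int)
  have "expectation X = (\<Sum>i=1..k. expectation (\<lambda>\<omega>. \<Sum>v\<in>configs i. U v \<omega> * cylinder_mass (\<lambda>v. U v \<omega>) \<beta> h n v))"
    unfolding X by (rule Bochner_Integration.integral_sum) (rule int)
  also have "\<dots> = (\<Sum>i=1..k. \<beta> * (1 - expectation (\<lambda>\<omega>. coincidence (\<lambda>v. U v \<omega>) \<beta> h n i)))"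
  proof (rule sum.cong [OF refl])
    fix i assume i: "i \<in> {1..k}"
    note ci = integrable_cylinder_mass [OF U]
    have "expectation (\<lambda>\<omega>. \<Sum>v\<in>configs i. U v \<omega> * cylinder_mass (\<lambda>v. U v \<omega>) \<beta> h n v)
        = (\<Sum>v\<in>configs i. \<beta> * (expectation (\<lambda>\<omega>. cylinder_mass (\<lambda>v. U v \<omega>) \<beta> h n v)
        - expectation (\<lambda>\<omega>. (cylinder_mass (\<lambda>v. U v \<omega>) \<beta> h n v)\<^sup>2)))"
      by (subst Bochner_Integration.integral_sum) (use bp [OF i] in auto)
    also have "\<dots> = \<beta> * ((\<Sum>v\<in>configs i. expectation (\<lambda>\<omega>. cylinder_mass (\<lambda>v. U v \<omega>) \<beta> h n v))
        - (\<Sum>v\<in>configs i. expectation (\<lambda>\<omega>. (cylinder_mass (\<lambda>v. U v \<omega>) \<beta> h n v)\<^sup>2)))"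
      by (simp add: sum_distrib_left sum_subtractf right_diff_distrib)
    also have "(\<Sum>v\<in>configs i. expectation (\<lambda>\<omega>. cylinder_mass (\<lambda>v. U v \<omega>) \<beta> h n v))
        = expectation (\<lambda>\<omega>. \<Sum>v\<in>configs i. cylinder_mass (\<lambda>v. U v \<omega>) \<beta> h n v)"
      by (rule Bochner_Integration.integral_sum [symmetric]) (rule ci)
    also have "\<dots> = 1"
      using i k by (simp add: sum_cylinder_mass prob_space)
    also have "(\<Sum>v\<in>configs i. expectation (\<lambda>\<omega>. (cylinder_mass (\<lambda>v. U v \<omega>) \<beta> h n v)\<^sup>2))
        = expectation (\<lambda>\<omega>. coincidence (\<lambda>v. U v \<omega>) \<beta> h n i)"
      unfolding coincidence_def by (rule Bochner_Integration.integral_sum [symmetric]) (rule ci)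
    finally show "expectation (\<lambda>\<omega>. \<Sum>v\<in>configs i. U v \<omega> * cylinder_mass (\<lambda>v. U v \<omega>) \<beta> h n v)
        = \<beta> * (1 - expectation (\<lambda>\<omega>. coincidence (\<lambda>v. U v \<omega>) \<beta> h n i))" .
  qed
  finally show "expectation X = \<beta> * (\<Sum>i=1..k. 1 - expectation (\<lambda>\<omega>. coincidence (\<lambda>v. U v \<omega>) \<beta> h n i))"
    by (simp add: sum_distrib_left)
qed

text \<open>
  Convexity bounds \<open>s\<close> times the mean energy of the first \<open>k\<close> levels by the increase of the
  free energy under the perturbation \<open>s\<close>. The perturbed free energy is bounded above by the fractional
  moment of order \<open>\<beta>\<^sub>c / \<beta>\<close>, for either sign of \<open>s\<close>. The bracket on the right is the defect of
  the unperturbed free energy, which is \<open>o(n)\<close>.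
\<close>

lemma (in prob_space) coincidence_perturbation_bound:
  assumes U: "gaussian_disorder M U" and k: "k \<le> n" and \<beta>: "beta_c h < \<beta>"
  shows "s * (\<beta> * (\<Sum>i=1..k. 1 - expectation (\<lambda>\<omega>. coincidence (\<lambda>v. U v \<omega>) \<beta> h n i)))
    \<le> (real n * frozen_free_energy \<beta> h - expectation (\<lambda>\<omega>. ln (partition_fn (\<lambda>v. U v \<omega>) \<beta> h n)))
      + real k * (beta_c h * s + s\<^sup>2 / 2)"
proof -
  let ?Z = "\<lambda>\<omega>. partition_fn (\<lambda>v. U v \<omega>) \<beta> h n"
  let ?Z' = "\<lambda>\<omega>. perturbed_partition_fn (\<lambda>v. U v \<omega>) \<beta> h n k s"
  let ?X = "\<lambda>\<omega>. \<Sum>\<sigma>\<in>configs n. gibbs_weight (\<lambda>v. U v \<omega>) \<beta> h n \<sigma> * branching_energy (\<lambda>v. U v \<omega>) k \<sigma>"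
  define \<theta> where "\<theta> = beta_c h / \<beta>"
  have \<theta>: "0 < \<theta>" "\<theta> \<le> 1" "\<theta> * \<beta> = beta_c h"
    using beta_c_pos [of h] \<beta> by (auto simp: \<theta>_def)
  note X = expectation_gibbs_mean_branching_energy [OF U k, of \<beta> h]
  note i = integrable_ln_partition_fn [OF U, of \<beta> h n] integrable_ln_perturbed_partition_fn [OF U k, of \<beta> h s]
  have tangent: "ln (?Z \<omega>) + s * ?X \<omega> \<le> ln (?Z' \<omega>)" for \<omega>
  proof -
    let ?H = "hamiltonian (\<lambda>v. U v \<omega>) h n" and ?B = "branching_energy (\<lambda>v. U v \<omega>) k"
    have "s * ?X \<omega> = (\<Sum>\<sigma>\<in>configs n. exp (\<beta> * ?H \<sigma>) * (s * ?B \<sigma>)) / ?Z \<omega>"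
      by (simp add: gibbs_weight_def sum_distrib_left sum_divide_distrib mult_ac)
    then show ?thesis
      using ln_sum_exp_ge_tangent [OF finite_configs [of n] configs_nonempty,
          where f = "\<lambda>\<sigma>. \<beta> * ?H \<sigma>" and g = "\<lambda>\<sigma>. s * ?B \<sigma>"]
      by (simp add: partition_fn_def perturbed_partition_fn_def)
  qed
  have "expectation (\<lambda>\<omega>. ln (?Z \<omega>)) + s * expectation ?X = expectation (\<lambda>\<omega>. ln (?Z \<omega>) + s * ?X \<omega>)"
    using X(1) i by simp
  also have "\<dots> \<le> expectation (\<lambda>\<omega>. ln (?Z' \<omega>))"
    using X(1) i by (intro integral_mono tangent) auto
  also have "\<dots> \<le> real n * psi h (\<theta> * \<beta>) / \<theta> + real k * (\<theta> * \<beta> * s + \<theta> * s\<^sup>2 / 2)"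
    by (rule expectation_ln_perturbed_partition_fn_le [OF U k \<theta>(1,2)])
  also have "real n * psi h (\<theta> * \<beta>) / \<theta> = real n * frozen_free_energy \<beta> h"
    unfolding \<theta>(3) by (simp add: \<theta>_def frozen_free_energy_def)
  also have "real k * (\<theta> * \<beta> * s + \<theta> * s\<^sup>2 / 2) \<le> real k * (beta_c h * s + s\<^sup>2 / 2)"
    unfolding \<theta>(3) using \<theta>(2) by (intro mult_left_mono add_left_mono divide_right_mono) (auto simp: mult_left_le_one_le \<theta>(1) less_imp_le)
  finally show ?thesis unfolding X(2) by linarith
qed

text \<open>
  Both signs of a small perturbation show that the first \<open>k\<close> levels collect the energy
  \<open>\<beta>\<^sub>c k + o(n)\<close>, uniformly in \<open>k\<close>. Hence the coincidence probabilities have average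
  \<open>1 - \<beta>\<^sub>c / \<beta>\<close> on every macroscopic block of levels, and being monotone in the level they are close
  to this value at every level between \<open>a n\<close> and \<open>(1 - a) n\<close>: in the limit the genealogical overlap is
  \<open>0\<close> or \<open>1\<close>.
\<close>

lemma (in prob_space) coincidence_limit:
  assumes U: "gaussian_disorder M U" and h: "0 \<le> h" and \<beta>: "beta_c h < \<beta>" and a: "0 < a" and \<eta>: "0 < \<eta>"
  shows "\<forall>\<^sub>F n in sequentially. \<forall>k\<le>n.
    (a * real n \<le> real k \<longrightarrow>
      expectation (\<lambda>\<omega>. coincidence (\<lambda>v. U v \<omega>) \<beta> h n k) \<le> 1 - beta_c h / \<beta> + \<eta>) \<and>
    (real k \<le> (1 - a) * real n \<longrightarrow>
      1 - beta_c h / \<beta> - \<eta> \<le> expectation (\<lambda>\<omega>. coincidence (\<lambda>v. U v \<omega>) \<beta> h n k))"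
proof -
  define b where "b = beta_c h"
  have b: "0 < b" "b < \<beta>" using beta_c_pos \<beta> by (auto simp: b_def)
  \<comment> \<open>With this size of the perturbation and a free energy defect of at most \<open>n s\<^sup>2\<close>, all errors below
  add up to at most \<open>\<eta>\<close>.\<close>
  define s where "s = \<eta> * \<beta> * a / 4"
  have s: "0 < s" using a \<eta> b by (simp add: s_def)
  have "\<forall>\<^sub>F n in sequentially. real n * (frozen_free_energy \<beta> h - s\<^sup>2)
      \<le> expectation (\<lambda>\<omega>. ln (partition_fn (\<lambda>v. U v \<omega>) \<beta> h n))"
    by (rule free_energy_low_temperature [OF U h \<beta>]) (use s in simp)
  then show ?thesis
    using eventually_gt_at_top [of 0]
  proof eventually_elim
    case (elim n)
    define P where "P i = expectation (\<lambda>\<omega>. coincidence (\<lambda>v. U v \<omega>) \<beta> h n i)" for i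
    define Q where "Q k = \<beta> * (\<Sum>i=1..k. 1 - P i)" for k
    have anti: "P j \<le> P i" if "i \<le> j" "j \<le> n" for i j
      unfolding P_def by (intro integral_mono integrable_coincidence U coincidence_antimono that)
    define D where "D = real n * frozen_free_energy \<beta> h - expectation (\<lambda>\<omega>. ln (partition_fn (\<lambda>v. U v \<omega>) \<beta> h n))"
    have D: "D \<le> real n * s\<^sup>2" using elim(1) by (simp add: D_def algebra_simps)
    have Q: "Q k \<le> real k * b + 2 * real n * s" "real k * b - 2 * real n * s \<le> Q k" if k: "k \<le> n" for k
    proof -
      have bound: "r * Q k \<le> real n * s\<^sup>2 + real k * (b * r + r\<^sup>2 / 2)" for r
        using coincidence_perturbation_bound [OF U k \<beta>, of r] D
        unfolding P_def [symmetric] D_def [symmetric] Q_def [symmetric] b_def by linarith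
      have ks: "real k * (s\<^sup>2 / 2) \<le> real n * s\<^sup>2"
        using k by (intro mult_mono) auto
      have "s * Q k \<le> s * (real k * b + 2 * real n * s)"
        using bound [of s] ks by (simp add: algebra_simps power2_eq_square)
      then show "Q k \<le> real k * b + 2 * real n * s" using s by simp
      have "s * (real k * b - 2 * real n * s) \<le> s * Q k"
        using bound [of "- s"] ks by (simp add: algebra_simps power2_eq_square)
      then show "real k * b - 2 * real n * s \<le> Q k" using s by simp
    qed
    show ?case
      unfolding P_def [symmetric] b_def [symmetric]
    proof (intro allI impI conjI)
      fix k assume k: "k \<le> n" "a * real n \<le> real k"
      have n: "0 < real n" using elim by simp
      have "a * real n > 0" using a n by simp
      then have k0: "0 < real k" using k by linarith
      have "(\<Sum>i=1..k. 1 - P i) \<le> (\<Sum>i=1..k. 1 - P k)"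
        using k by (intro sum_mono diff_left_mono anti) auto
      then have "Q k \<le> \<beta> * (real k * (1 - P k))"
        unfolding Q_def using b by (intro mult_left_mono) auto
      then have "real k * b - 2 * real n * s \<le> real k * (\<beta> * (1 - P k))"
        using Q(2) [OF k(1)] by (simp add: mult_ac)
      moreover have "2 * real n * s \<le> real k * (\<beta> * \<eta>)"
      proof -
        have "2 * real n * s = (a * real n) * (\<beta> * \<eta> / 2)" by (simp add: s_def)
        also have "\<dots> \<le> real k * (\<beta> * \<eta>)" using k b \<eta> a by (intro mult_mono) auto
        finally show ?thesis .
      qed
      ultimately have "real k * b \<le> real k * (\<beta> * (1 - P k) + \<beta> * \<eta>)" by (simp add: distrib_left)
      then have "b \<le> \<beta> * (1 - P k) + \<beta> * \<eta>" using k0 by simp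
      then have "b / \<beta> \<le> 1 - P k + \<eta>" using b by (simp add: field_simps)
      then show "P k \<le> 1 - b / \<beta> + \<eta>" by linarith
    next
      fix k assume k: "k \<le> n" "real k \<le> (1 - a) * real n"
      have n: "0 < real n" using elim by simp
      define m where "m = real n - real k"
      have m: "a * real n \<le> m" using k by (simp add: m_def algebra_simps)
      have "a * real n > 0" using a n by simp
      then have m0: "0 < m" using m by linarith
      have "(\<Sum>i=1..n. 1 - P i) = (\<Sum>i=1..k. 1 - P i) + (\<Sum>i\<in>{k<..n}. 1 - P i)"
        using k by (subst sum.union_disjoint [symmetric]) (auto intro!: sum.cong)
      moreover have "(\<Sum>i\<in>{k<..n}. 1 - P k) \<le> (\<Sum>i\<in>{k<..n}. 1 - P i)"
        by (intro sum_mono diff_left_mono anti) auto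
      ultimately have "m * (1 - P k) \<le> (\<Sum>i=1..n. 1 - P i) - (\<Sum>i=1..k. 1 - P i)"
        using k by (simp add: m_def of_nat_diff)
      then have "\<beta> * (m * (1 - P k)) \<le> Q n - Q k"
        unfolding Q_def right_diff_distrib [symmetric] using b by (intro mult_left_mono) auto
      then have "m * (\<beta> * (1 - P k)) \<le> m * b + 4 * real n * s"
        using Q(1) [of n] Q(2) [OF k(1)] by (simp add: m_def algebra_simps)
      moreover have "4 * real n * s \<le> m * (\<beta> * \<eta>)"
      proof -
        have "4 * real n * s = (a * real n) * (\<beta> * \<eta>)" by (simp add: s_def)
        also have "\<dots> \<le> m * (\<beta> * \<eta>)" using m b \<eta> by (intro mult_right_mono) auto
        finally show ?thesis .
      qed
      ultimately have "m * (\<beta> * (1 - P k)) \<le> m * (b + \<beta> * \<eta>)" by (simp add: distrib_left)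
      then have "\<beta> * (1 - P k) \<le> b + \<beta> * \<eta>" using m0 by simp
      then have "1 - P k \<le> b / \<beta> + \<eta>" using b by (simp add: field_simps)
      then show "1 - b / \<beta> - \<eta> \<le> P k" by linarith
    qed
  qed
qed

section \<open>Hypercube overlap of replicas that separate early\<close>

text \<open>
  Let \<open>V = ln Z\<^sub>n - n f\<close> for the limit density \<open>f\<close>. Its positive part has mean at most \<open>1/\<theta>\<close> by
  the fractional moment bound, and its mean is at least \<open>- o(n)\<close>; so its negative part has mean
  \<open>o(n)\<close>, and Markov's inequality applies.
\<close>

lemma (in prob_space) partition_fn_lower_prob:
  assumes U: "gaussian_disorder M U" and h: "0 \<le> h" and \<beta>: "beta_c h < \<beta>" and \<eta>: "0 < \<eta>"
  shows "(\<lambda>n. prob {\<omega> \<in> space M. partition_fn (\<lambda>v. U v \<omega>) \<beta> h n < exp (real n * (frozen_free_energy \<beta> h - \<eta>))}) \<longlonglongrightarrow> 0"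
proof -
  define f where "f = frozen_free_energy \<beta> h"
  define \<theta> where "\<theta> = beta_c h / \<beta>"
  have \<theta>: "0 < \<theta>" "\<theta> \<le> 1" "\<theta> * \<beta> = beta_c h" "\<theta> * f = psi h (beta_c h)"
    using beta_c_pos [of h] \<beta> by (auto simp: \<theta>_def f_def frozen_free_energy_def)
  let ?p = "\<lambda>n. prob {\<omega> \<in> space M. partition_fn (\<lambda>v. U v \<omega>) \<beta> h n < exp (real n * (f - \<eta>))}"
  have bound: "real n * \<eta> * ?p n \<le> 1 / \<theta> + real n * f - expectation (\<lambda>\<omega>. ln (partition_fn (\<lambda>v. U v \<omega>) \<beta> h n))" for n
  proof -
    let ?Z = "\<lambda>\<omega>. partition_fn (\<lambda>v. U v \<omega>) \<beta> h n"
    let ?Y = "\<lambda>\<omega>. partition_fn (\<lambda>v. U v \<omega>) (beta_c h) h n"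
    define l where "l = exp (real n * psi h (beta_c h))"
    have l: "0 < l" by (simp add: l_def)
    note Y = partition_fn_moment [OF U, of "beta_c h" h n, folded l_def]
    note [measurable] = measurable_partition_fn [OF U]
    define B where "B = {\<omega> \<in> space M. ?Z \<omega> < exp (real n * (f - \<eta>))}"
    have B [measurable]: "B \<in> events" unfolding B_def by measurable
    have iB: "integrable M (indicat_real B)"
      by (rule integrable_real_indicator) (auto simp: emeasure_eq_measure)
    have le: "real n * \<eta> * indicator B \<omega> \<le> ?Y \<omega> / l / \<theta> + real n * f - ln (?Z \<omega>)" for \<omega>
    proof -
      define V where "V = ln (?Z \<omega>) - real n * f"
      have Zp: "0 < ?Z \<omega>" by (rule partition_fn_pos)
      have "\<theta> * V \<le> exp (\<theta> * V)" using exp_ge_add_one_self [of "\<theta> * V"] by linarith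
      also have "exp (\<theta> * V) = ?Z \<omega> powr \<theta> / l"
        unfolding V_def l_def \<theta>(4) [symmetric] using Zp
        by (simp add: powr_def right_diff_distrib exp_diff mult_ac)
      also have "?Z \<omega> powr \<theta> / l \<le> ?Y \<omega> / l"
        using perturbed_partition_fn_powr_le [OF \<theta>(1,2), of "\<lambda>v. U v \<omega>" \<beta> h n 0 0] l
        unfolding \<theta>(3) by (intro divide_right_mono) (simp_all add: perturbed_partition_fn_0)
      finally have 1: "V \<le> ?Y \<omega> / l / \<theta>" using \<theta>(1) by (subst pos_le_divide_eq) (simp_all only: mult.commute)
      show ?thesis
      proof (cases "\<omega> \<in> B")
        case True
        then have "ln (?Z \<omega>) < ln (exp (real n * (f - \<eta>)))"
          using Zp by (subst ln_less_cancel_iff) (auto simp: B_def)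
        then have "V \<le> - (real n * \<eta>)" by (simp add: V_def algebra_simps)
        moreover have "0 \<le> ?Y \<omega> / l / \<theta>" using l \<theta> partition_fn_pos [of "\<lambda>v. U v \<omega>" "beta_c h" h n] by simp
        ultimately show ?thesis using True by (simp add: V_def)
      next
        case False
        then show ?thesis using 1 by (simp add: V_def)
      qed
    qed
    have "real n * \<eta> * prob B = expectation (\<lambda>\<omega>. real n * \<eta> * indicator B \<omega>)" by simp
    also have "\<dots> \<le> expectation (\<lambda>\<omega>. ?Y \<omega> / l / \<theta> + real n * f - ln (?Z \<omega>))"
      using Y(1) iB integrable_ln_partition_fn [OF U, of \<beta> h n]
      by (intro integral_mono le integrable_mult_right Bochner_Integration.integrable_diff
          Bochner_Integration.integrable_add integrable_divide integrable_const)
    also have "\<dots> = 1 / \<theta> + real n * f - expectation (\<lambda>\<omega>. ln (?Z \<omega>))"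
      using Y l integrable_ln_partition_fn [OF U, of \<beta> h n] by (simp add: prob_space)
    finally show ?thesis by (simp add: B_def)
  qed
  have "\<forall>\<^sub>F n in sequentially. norm (?p n) < e" if e: "0 < e" for e
  proof -
    define \<epsilon>' where "\<epsilon>' = \<eta> * e / 2"
    have \<epsilon>': "0 < \<epsilon>'" using e \<eta> by (simp add: \<epsilon>'_def)
    have "(\<lambda>n. 1 / \<theta> / real n) \<longlonglongrightarrow> 0" by real_asymp
    then have "\<forall>\<^sub>F n in sequentially. 1 / \<theta> / real n < \<eta> * e / 2"
      using e \<eta> by (intro order_tendstoD) auto
    then show ?thesis
      using free_energy_low_temperature [OF U h \<beta> \<epsilon>'] eventually_gt_at_top [of 0]
    proof eventually_elim
      case (elim n)
      then have n: "0 < real n" by simp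
      have "1 / \<theta> < real n * (\<eta> * e / 2)" using elim(1) unfolding pos_divide_less_eq [OF n] by (simp only: mult.commute)
      then have "real n * \<eta> * ?p n < real n * (\<eta> * e / 2) + real n * \<epsilon>'"
        using bound [of n] elim(2) by (simp add: f_def algebra_simps)
      also have "\<dots> = real n * \<eta> * e" by (simp add: \<epsilon>'_def)
      finally show ?case using n \<eta> by (simp add: mult_less_cancel_left_pos)
    qed
  qed
  then show ?thesis unfolding f_def by (simp add: tendsto_iff)
qed

text \<open>
  Two paths that separate before level \<open>k\<close> have joint energy variance at most \<open>2 n + 2 k\<close>. For small
  \<open>k / n\<close> the annealed weight of the pair is that of two independent paths, up to a small exponential
  factor.
\<close>

lemma (in prob_space) pair_exp_moment:
  assumes U: "gaussian_disorder M U" and \<sigma>: "\<sigma> \<in> configs n" "\<sigma>' \<in> configs n" and split: "take k \<sigma> \<noteq> take k \<sigma>'"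
  shows "integrable M (\<lambda>\<omega>. exp (b * (hamiltonian (\<lambda>v. U v \<omega>) h n \<sigma> + hamiltonian (\<lambda>v. U v \<omega>) h n \<sigma>')))"
    and "expectation (\<lambda>\<omega>. exp (b * (hamiltonian (\<lambda>v. U v \<omega>) h n \<sigma> + hamiltonian (\<lambda>v. U v \<omega>) h n \<sigma>')))
      \<le> exp (b * h * ((\<Sum>i=1..n. \<sigma> ! (i - 1)) + (\<Sum>i=1..n. \<sigma>' ! (i - 1)))) * exp (b\<^sup>2 * (real n + real k))"
proof -
  have l: "length \<sigma> = n" "length \<sigma>' = n" using \<sigma> by (auto simp: configs_def)
  define F where "F = ancestors \<sigma> \<union> ancestors \<sigma>'"
  define I where "I = ancestors \<sigma> \<inter> ancestors \<sigma>'"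
  have F: "finite F" "F \<subseteq> tree_vertices"
    using \<sigma> by (auto simp: F_def finite_ancestors dest: ancestors_in_tree)
  let ?c = "\<lambda>v. b * (of_bool (v \<in> ancestors \<sigma>) + of_bool (v \<in> ancestors \<sigma>'))"
  let ?B = "\<lambda>\<sigma>. \<Sum>i=1..n. \<sigma> ! (i - 1) :: real"
  have energy: "branching_energy u n \<tau> = (\<Sum>v\<in>F. of_bool (v \<in> ancestors \<tau>) * u v)"
    if "\<tau> \<in> configs n" "ancestors \<tau> \<subseteq> F" for \<tau> u
  proof -
    have "length v \<le> n" if "v \<in> ancestors \<tau>" for v
      using that \<open>\<tau> \<in> configs n\<close> by (auto simp: ancestors_def configs_def)
    then have "branching_energy u n \<tau> = (\<Sum>v\<in>ancestors \<tau>. u v)"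
      unfolding branching_energy_eq_sum_ancestors [OF that(1) order.refl] by (intro sum.cong) auto
    also have "\<dots> = (\<Sum>v\<in>F. of_bool (v \<in> ancestors \<tau>) * u v)"
      using that(2) F by (intro sum.mono_neutral_cong_left) auto
    finally show ?thesis .
  qed
  have eq: "exp (b * (hamiltonian u h n \<sigma> + hamiltonian u h n \<sigma>'))
      = exp (b * h * (?B \<sigma> + ?B \<sigma>')) * exp (\<Sum>v\<in>F. ?c v * u v)" for u
  proof -
    have "(\<Sum>v\<in>F. ?c v * u v) = b * (branching_energy u n \<sigma> + branching_energy u n \<sigma>')"
      unfolding energy [OF \<sigma>(1), of u, unfolded F_def, OF Un_upper1, folded F_def]
        energy [OF \<sigma>(2), of u, unfolded F_def, OF Un_upper2, folded F_def]
      by (simp add: sum.distrib [symmetric] sum_distrib_left algebra_simps)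
    then show ?thesis
      by (simp add: exp_add [symmetric] hamiltonian_def algebra_simps)
  qed
  note mom = gaussian_exp_moment [OF U F, of ?c]
  show "integrable M (\<lambda>\<omega>. exp (b * (hamiltonian (\<lambda>v. U v \<omega>) h n \<sigma> + hamiltonian (\<lambda>v. U v \<omega>) h n \<sigma>')))"
    unfolding eq by (intro integrable_mult_right mom)
  have "I \<subseteq> (\<lambda>i. take i \<sigma>) ` {1..k}"
  proof
    fix v assume "v \<in> I"
    then obtain i j where ij: "v = take i \<sigma>" "v = take j \<sigma>'" "i \<in> {1..n}" "j \<in> {1..n}"
      unfolding I_def ancestors_def l by blast
    have "length (take i \<sigma>) = length (take j \<sigma>')" using ij by simp
    then have "i = j" using ij l by simp
    have "i \<le> k"
    proof (rule ccontr)
      assume "\<not> i \<le> k"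
      then have "take k (take i \<sigma>) = take k \<sigma>" "take k (take j \<sigma>') = take k \<sigma>'"
        using \<open>i = j\<close> by (simp_all add: min_def)
      then show False using split ij(1,2) by metis
    qed
    then show "v \<in> (\<lambda>i. take i \<sigma>) ` {1..k}" using ij by auto
  qed
  then have "card I \<le> k"
    using surj_card_le [of "{1..k}" I "\<lambda>i. take i \<sigma>"] by simp
  then have I: "real (card I) \<le> real k" by simp
  have "(\<Sum>v\<in>F. (?c v)\<^sup>2) = b\<^sup>2 * (\<Sum>v\<in>F. of_bool (v \<in> ancestors \<sigma>) + of_bool (v \<in> ancestors \<sigma>') + 2 * of_bool (v \<in> I))"
    unfolding sum_distrib_left by (intro sum.cong refl) (auto simp: I_def power2_eq_square)
  also have "\<dots> = b\<^sup>2 * (real n + real n + 2 * real (card I))"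
  proof -
    have count: "(\<Sum>v\<in>F. of_bool (v \<in> S)) = real (card S)" if "S \<subseteq> F" for S
      using that F by (simp add: of_bool_def sum.If_cases Int_absorb1 Collect_mem_eq)
    have "ancestors \<sigma> \<subseteq> F" "ancestors \<sigma>' \<subseteq> F" "I \<subseteq> F" by (auto simp: F_def I_def)
    then show ?thesis
      using l by (simp only: sum.distrib sum_distrib_left [symmetric] count card_ancestors)
  qed
  finally have sq: "(\<Sum>v\<in>F. (?c v)\<^sup>2) / 2 = b\<^sup>2 * (real n + real (card I))" by (simp add: algebra_simps)
  have "expectation (\<lambda>\<omega>. exp (b * (hamiltonian (\<lambda>v. U v \<omega>) h n \<sigma> + hamiltonian (\<lambda>v. U v \<omega>) h n \<sigma>')))
      = exp (b * h * (?B \<sigma> + ?B \<sigma>')) * exp (b\<^sup>2 * (real n + real (card I)))"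
    unfolding eq using mom(2) sq by simp
  also have "\<dots> \<le> exp (b * h * (?B \<sigma> + ?B \<sigma>')) * exp (b\<^sup>2 * (real n + real k))"
    using I by (intro mult_left_mono) (auto intro!: mult_left_mono)
  finally show "expectation (\<lambda>\<omega>. exp (b * (hamiltonian (\<lambda>v. U v \<omega>) h n \<sigma> + hamiltonian (\<lambda>v. U v \<omega>) h n \<sigma>')))
      \<le> exp (b * h * (?B \<sigma> + ?B \<sigma>')) * exp (b\<^sup>2 * (real n + real k))" .
qed

lemma dot_Cons:
  "(\<Sum>i=1..Suc n. (c # \<sigma>) ! (i - 1) * (c' # \<sigma>') ! (i - 1)) = (c::real) * c' + (\<Sum>i=1..n. \<sigma> ! (i - 1) * \<sigma>' ! (i - 1))"
proof -
  have "(\<Sum>i=1..Suc n. (c # \<sigma>) ! (i - 1) * (c' # \<sigma>') ! (i - 1))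
      = c * c' + (\<Sum>i=Suc 1..Suc n. (c # \<sigma>) ! (i - 1) * (c' # \<sigma>') ! (i - 1))"
    by (subst sum.atLeast_Suc_atMost) auto
  also have "(\<Sum>i=Suc 1..Suc n. (c # \<sigma>) ! (i - 1) * (c' # \<sigma>') ! (i - 1))
      = (\<Sum>i=1..n. (c # \<sigma>) ! (Suc i - 1) * (c' # \<sigma>') ! (Suc i - 1))"
    by (rule sum.shift_bounds_cl_Suc_ivl)
  also have "\<dots> = (\<Sum>i=1..n. \<sigma> ! (i - 1) * \<sigma>' ! (i - 1))"
    by (rule sum.cong) (auto simp: nth_Cons')
  finally show ?thesis .
qed

lemma sum_exp_field_dot:
  "(\<Sum>\<sigma>\<in>configs n. \<Sum>\<sigma>'\<in>configs n. exp (y * ((\<Sum>i=1..n. \<sigma> ! (i - 1)) + (\<Sum>i=1..n. \<sigma>' ! (i - 1)))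
      + \<kappa> * (\<Sum>i=1..n. \<sigma> ! (i - 1) * \<sigma>' ! (i - 1))))
    = (exp \<kappa> * (exp (2 * y) + exp (- 2 * y)) + 2 * exp (- \<kappa>)) ^ n"
proof (induction n)
  case (Suc n)
  let ?E = "\<lambda>\<sigma> \<sigma>'. exp (y * ((\<Sum>i=1..n. \<sigma> ! (i - 1)) + (\<Sum>i=1..n. \<sigma>' ! (i - 1)))
      + \<kappa> * (\<Sum>i=1..n. \<sigma> ! (i - 1) * \<sigma>' ! (i - 1)))"
  have 1: "exp (y * ((c + s) + (c' + s')) + \<kappa> * (c * c' + d))
      = exp (y * (c + c') + \<kappa> * (c * c')) * exp (y * (s + s') + \<kappa> * d)" for c c' s s' d
    by (simp add: exp_add [symmetric] algebra_simps)
  have 2: "exp (y * (1 + 1) + \<kappa> * (1 * 1)) = exp \<kappa> * exp (2 * y)"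
    "exp (y * (1 + - 1) + \<kappa> * (1 * - 1)) = exp (- \<kappa>)"
    "exp (y * (- 1 + 1) + \<kappa> * (- 1 * 1)) = exp (- \<kappa>)"
    "exp (y * (- 1 + - 1) + \<kappa> * (- 1 * - 1)) = exp \<kappa> * exp (- 2 * y)"
    by (simp_all add: exp_add [symmetric] algebra_simps)
  show ?case
    unfolding sum_configs_Suc field_Cons dot_Cons 1 sum.distrib sum_distrib_left [symmetric] Suc.IH 2
    by (simp only: power_Suc distrib_left distrib_right mult_2)
qed simp

text \<open>
  Under two independent copies of the product measure with density proportional to
  \<open>exp (y \<Sum> \<sigma>\<^sub>i)\<close>, the products \<open>\<sigma>\<^sub>i \<sigma>\<^sub>i'\<close> are independent with mean \<open>(tanh y)\<^sup>2\<close>. The Chernoff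
  bound follows because the derivative at \<open>0\<close> of the centred and shifted moment generating function has
  a definite sign on either side of the mean.
\<close>

lemma overlap_chernoff:
  assumes \<epsilon>: "0 < \<epsilon>"
  shows "\<exists>\<rho>. 0 < \<rho> \<and> \<rho> < 1 \<and> (\<forall>n.
    (\<Sum>\<sigma>\<in>configs n. \<Sum>\<sigma>'\<in>configs n. exp (y * ((\<Sum>i=1..n. \<sigma> ! (i - 1)) + (\<Sum>i=1..n. \<sigma>' ! (i - 1))))
        * of_bool (\<epsilon> \<le> \<bar>overlap n \<sigma> \<sigma>' - (tanh y)\<^sup>2\<bar>))
      \<le> 2 * ((2 * cosh y)\<^sup>2 * \<rho>) ^ n)"
proof -
  define A where "A = exp (2 * y) + exp (- 2 * y)"
  define \<mu> where "\<mu> = (tanh y)\<^sup>2"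
  define C where "C = (2 * cosh y)\<^sup>2"
  have A: "A = exp y * exp y + exp (- y) * exp (- y)" "exp y * exp (- y) = 1"
    by (simp_all add: A_def exp_add [symmetric])
  have C: "0 < C" "C = A + 2"
  proof -
    show "0 < C" using cosh_real_pos [of y] by (simp add: C_def)
    have "C = (exp y + exp (- y))\<^sup>2" by (simp add: C_def cosh_def)
    also have "\<dots> = A + 2 * (exp y * exp (- y))" by (simp add: A(1) power2_eq_square algebra_simps)
    finally show "C = A + 2" unfolding A(2) by simp
  qed
  have \<mu>: "\<mu> * C = A - 2"
  proof -
    have "\<mu> * C = (2 * sinh y)\<^sup>2"
      using cosh_real_pos [of y] by (simp add: \<mu>_def C_def tanh_def power_divide power_mult_distrib)
    also have "\<dots> = (exp y - exp (- y))\<^sup>2" by (simp add: sinh_field_def diff_divide_distrib)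
    also have "\<dots> = A - 2 * (exp y * exp (- y))" by (simp add: A(1) power2_eq_square algebra_simps)
    finally show ?thesis unfolding A(2) by simp
  qed
  define K where "K \<kappa> = exp \<kappa> * A + 2 * exp (- \<kappa>)" for \<kappa>
  have K0: "0 < K \<kappa>" for \<kappa>
    by (auto simp: K_def A_def intro!: add_pos_pos mult_pos_pos)
  have d: "((\<lambda>\<kappa>. K \<kappa> * exp (- \<kappa> * z)) has_real_derivative C * (\<mu> - z)) (at 0)" for z
  proof -
    have "((\<lambda>\<kappa>. K \<kappa> * exp (- \<kappa> * z)) has_real_derivative (A - 2) - z * (A + 2)) (at 0)"
      unfolding K_def by (auto intro!: derivative_eq_intros simp: algebra_simps)
    moreover have "(A - 2) - z * (A + 2) = C * (\<mu> - z)"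
      unfolding \<mu> [symmetric] C(2) [symmetric] by (simp add: algebra_simps)
    ultimately show ?thesis by simp
  qed
  have "C * (\<mu> - (\<mu> + \<epsilon>)) < 0" using C \<epsilon> by simp
  from DERIV_neg_dec_right [OF d this] obtain d1 where
    d1: "d1 > 0" "\<And>h. 0 < h \<Longrightarrow> h < d1 \<Longrightarrow> K (0 + h) * exp (- (0 + h) * (\<mu> + \<epsilon>)) < K 0 * exp (- 0 * (\<mu> + \<epsilon>))" by blast
  have "0 < C * (\<mu> - (\<mu> - \<epsilon>))" using C \<epsilon> by simp
  from DERIV_pos_inc_left [OF d this] obtain d2 where
    d2: "d2 > 0" "\<And>h. 0 < h \<Longrightarrow> h < d2 \<Longrightarrow> K (0 - h) * exp (- (0 - h) * (\<mu> - \<epsilon>)) < K 0 * exp (- 0 * (\<mu> - \<epsilon>))" by blast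
  define a where "a = min d1 d2 / 2"
  have a: "0 < a" "a < d1" "a < d2" using d1(1) d2(1) by (auto simp: a_def)
  have KC: "K 0 = C" by (simp add: K_def C)
  define r1 where "r1 = K a * exp (- a * (\<mu> + \<epsilon>))"
  define r2 where "r2 = K (- a) * exp (a * (\<mu> - \<epsilon>))"
  have r1: "0 < r1" "r1 < C" using d1(2) [OF a(1,2)] K0 [of a] by (auto simp: r1_def KC)
  have r2: "0 < r2" "r2 < C" using d2(2) [OF a(1,3)] K0 [of "- a"] by (auto simp: r2_def KC)
  define \<rho> where "\<rho> = max r1 r2 / C"
  have \<rho>: "0 < \<rho>" "\<rho> < 1" "C * \<rho> = max r1 r2" using r1 r2 C by (auto simp: \<rho>_def divide_simps)
  have "(\<Sum>\<sigma>\<in>configs n. \<Sum>\<sigma>'\<in>configs n. exp (y * ((\<Sum>i=1..n. \<sigma> ! (i - 1)) + (\<Sum>i=1..n. \<sigma>' ! (i - 1))))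
        * of_bool (\<epsilon> \<le> \<bar>overlap n \<sigma> \<sigma>' - (tanh y)\<^sup>2\<bar>))
      \<le> 2 * ((2 * cosh y)\<^sup>2 * \<rho>) ^ n" for n
  proof -
    let ?s = "\<lambda>\<sigma> \<sigma>'. y * ((\<Sum>i=1..n. \<sigma> ! (i - 1)) + (\<Sum>i=1..n. \<sigma>' ! (i - 1)))"
    let ?d = "\<lambda>\<sigma> \<sigma>'. \<Sum>i=1..n. \<sigma> ! (i - 1) * \<sigma>' ! (i - 1) :: real"
    have "(\<Sum>\<sigma>\<in>configs n. \<Sum>\<sigma>'\<in>configs n. exp (?s \<sigma> \<sigma>') * of_bool (\<epsilon> \<le> \<bar>overlap n \<sigma> \<sigma>' - \<mu>\<bar>))
      \<le> (\<Sum>\<sigma>\<in>configs n. \<Sum>\<sigma>'\<in>configs n.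
          exp (- a * (\<mu> + \<epsilon>)) ^ n * exp (?s \<sigma> \<sigma>' + a * ?d \<sigma> \<sigma>')
          + exp (a * (\<mu> - \<epsilon>)) ^ n * exp (?s \<sigma> \<sigma>' + (- a) * ?d \<sigma> \<sigma>'))"
    proof (intro sum_mono)
      fix \<sigma> \<sigma>' :: "real list"
      have R: "exp (- a * (\<mu> + \<epsilon>)) ^ n * exp (?s \<sigma> \<sigma>' + a * ?d \<sigma> \<sigma>')
          + exp (a * (\<mu> - \<epsilon>)) ^ n * exp (?s \<sigma> \<sigma>' + (- a) * ?d \<sigma> \<sigma>')
          = exp (?s \<sigma> \<sigma>') * (exp (a * (?d \<sigma> \<sigma>' - real n * (\<mu> + \<epsilon>))) + exp (a * (real n * (\<mu> - \<epsilon>) - ?d \<sigma> \<sigma>')))"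
        by (simp add: exp_of_nat_mult [symmetric] exp_add [symmetric] distrib_left) (simp add: algebra_simps)
      have "of_bool (\<epsilon> \<le> \<bar>overlap n \<sigma> \<sigma>' - \<mu>\<bar>) \<le>
          exp (a * (?d \<sigma> \<sigma>' - real n * (\<mu> + \<epsilon>))) + exp (a * (real n * (\<mu> - \<epsilon>) - ?d \<sigma> \<sigma>'))"
      proof (cases "\<epsilon> \<le> \<bar>overlap n \<sigma> \<sigma>' - \<mu>\<bar>")
        case True
        have ov: "?d \<sigma> \<sigma>' = real n * overlap n \<sigma> \<sigma>'" by (cases "n = 0") (auto simp: overlap_def)
        consider "\<mu> + \<epsilon> \<le> overlap n \<sigma> \<sigma>'" | "overlap n \<sigma> \<sigma>' \<le> \<mu> - \<epsilon>" using True by linarith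
        then show ?thesis
        proof cases
          case 1
          then have "0 \<le> a * (?d \<sigma> \<sigma>' - real n * (\<mu> + \<epsilon>))"
            unfolding ov right_diff_distrib [symmetric] using a by simp
          then have "1 \<le> exp (a * (?d \<sigma> \<sigma>' - real n * (\<mu> + \<epsilon>)))" by simp
          then show ?thesis using True by (simp add: add_increasing2)
        next
          case 2
          then have "0 \<le> a * (real n * (\<mu> - \<epsilon>) - ?d \<sigma> \<sigma>')"
            unfolding ov right_diff_distrib [symmetric] using a by simp
          then have "1 \<le> exp (a * (real n * (\<mu> - \<epsilon>) - ?d \<sigma> \<sigma>'))" by simp
          then show ?thesis using True by (simp add: add_increasing)
        qed
      qed (simp add: add_nonneg_nonneg)
      then show "exp (?s \<sigma> \<sigma>') * of_bool (\<epsilon> \<le> \<bar>overlap n \<sigma> \<sigma>' - \<mu>\<bar>) \<le> exp (- a * (\<mu> + \<epsilon>)) ^ n * exp (?s \<sigma> \<sigma>' + a * ?d \<sigma> \<sigma>')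
          + exp (a * (\<mu> - \<epsilon>)) ^ n * exp (?s \<sigma> \<sigma>' + (- a) * ?d \<sigma> \<sigma>')"
        unfolding R by (intro mult_left_mono) auto
    qed
    also have "\<dots> = exp (- a * (\<mu> + \<epsilon>)) ^ n * K a ^ n + exp (a * (\<mu> - \<epsilon>)) ^ n * K (- a) ^ n"
      unfolding sum.distrib sum_distrib_left [symmetric] sum_exp_field_dot A_def [symmetric] K_def by simp
    also have "\<dots> = r1 ^ n + r2 ^ n"
      unfolding r1_def r2_def power_mult_distrib by (simp add: mult.commute)
    also have "\<dots> \<le> (C * \<rho>) ^ n + (C * \<rho>) ^ n"
      unfolding \<rho>(3) using r1 r2 by (intro add_mono power_mono) auto
    finally show ?thesis by (simp add: \<mu>_def C_def)
  qed
  then show ?thesis using \<rho> by blast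
qed

definition gibbs_pair ::
    "(real list \<Rightarrow> real) \<Rightarrow> real \<Rightarrow> real \<Rightarrow> nat \<Rightarrow> (real list \<Rightarrow> real list \<Rightarrow> bool) \<Rightarrow> real" where
  "gibbs_pair u \<beta> h n B = (\<Sum>\<sigma>\<in>configs n. \<Sum>\<sigma>'\<in>configs n.
     gibbs_weight u \<beta> h n \<sigma> * gibbs_weight u \<beta> h n \<sigma>' * of_bool (B \<sigma> \<sigma>'))"

lemma gibbs_pair_mono:
  assumes "\<And>\<sigma> \<sigma>'. \<sigma> \<in> configs n \<Longrightarrow> \<sigma>' \<in> configs n \<Longrightarrow> B \<sigma> \<sigma>' \<Longrightarrow> B' \<sigma> \<sigma>'"
  shows "gibbs_pair u \<beta> h n B \<le> gibbs_pair u \<beta> h n B'"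
  unfolding gibbs_pair_def using assms
  by (intro sum_mono mult_left_mono mult_nonneg_nonneg gibbs_weight_nonneg) auto

lemma gibbs_pair_True: "gibbs_pair u \<beta> h n (\<lambda>_ _. True) = 1"
  by (simp add: gibbs_pair_def sum_distrib_left [symmetric] sum_gibbs_weight)

lemma gibbs_pair_bounds: "0 \<le> gibbs_pair u \<beta> h n B" "gibbs_pair u \<beta> h n B \<le> 1"
proof -
  show "0 \<le> gibbs_pair u \<beta> h n B"
    unfolding gibbs_pair_def by (intro sum_nonneg mult_nonneg_nonneg gibbs_weight_nonneg) auto
  show "gibbs_pair u \<beta> h n B \<le> 1"
    using gibbs_pair_mono [of n B "\<lambda>_ _. True" u \<beta> h] by (simp add: gibbs_pair_True)
qed

lemma gibbs_pair_disj_le: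
  "gibbs_pair u \<beta> h n (\<lambda>\<sigma> \<sigma>'. B \<sigma> \<sigma>' \<or> B' \<sigma> \<sigma>') \<le> gibbs_pair u \<beta> h n B + gibbs_pair u \<beta> h n B'"
  unfolding gibbs_pair_def sum.distrib [symmetric] distrib_left [symmetric]
  by (intro sum_mono mult_left_mono mult_nonneg_nonneg gibbs_weight_nonneg) auto

lemma gibbs_pair_not: "gibbs_pair u \<beta> h n (\<lambda>\<sigma> \<sigma>'. \<not> B \<sigma> \<sigma>') = 1 - gibbs_pair u \<beta> h n B"
proof -
  have "gibbs_pair u \<beta> h n (\<lambda>\<sigma> \<sigma>'. \<not> B \<sigma> \<sigma>') + gibbs_pair u \<beta> h n B = gibbs_pair u \<beta> h n (\<lambda>_ _. True)"
    unfolding gibbs_pair_def sum.distrib [symmetric] distrib_left [symmetric]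
    by (intro sum.cong refl arg_cong2 [where f = "(*)"]) auto
  then show ?thesis by (simp add: gibbs_pair_True)
qed

lemma (in prob_space) integrable_gibbs_pair:
  assumes "gaussian_disorder M U"
  shows "integrable M (\<lambda>\<omega>. gibbs_pair (\<lambda>v. U v \<omega>) \<beta> h n B)"
proof (rule integrable_const_bound [where B = 1])
  show "(\<lambda>\<omega>. gibbs_pair (\<lambda>v. U v \<omega>) \<beta> h n B) \<in> borel_measurable M"
    unfolding gibbs_pair_def gibbs_weight_def
    by (intro borel_measurable_sum borel_measurable_divide measurable_partition_fn assms
        measurable_compose [OF _ borel_measurable_exp] borel_measurable_times borel_measurable_const
        hamiltonian_measurable [OF prob_space_axioms assms]) auto
qed (use gibbs_pair_bounds in auto)

text \<open>
  Gibbs probabilities are at most one, hence bounded by their power \<open>\<theta> = \<beta>\<^sub>c / \<beta>\<close>. The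
  corresponding power of the sum of pair weights is bounded by the annealed sum at \<open>\<beta>\<^sub>c\<close>, where the
  spins are distributed as under the product measure with mean \<open>m\<^sup>*\<close>; the Chernoff bound then gains an
  exponential factor. That factor beats both the loss \<open>exp (\<beta>\<^sub>c\<^sup>2 k)\<close> from the common part of the
  paths and the fluctuation of \<open>Z\<^sub>n\<^sup>2\<^sup>\<theta>\<close> around its exponential order.
\<close>

lemma (in prob_space) early_split_overlap:
  assumes U: "gaussian_disorder M U" and h: "0 \<le> h" and \<beta>: "beta_c h < \<beta>" and \<epsilon>: "0 < \<epsilon>"
  shows "\<exists>\<delta>>0. \<forall>k. (\<forall>n. real (k n) \<le> \<delta> * real n) \<longrightarrow>
    (\<lambda>n. expectation (\<lambda>\<omega>. gibbs_pair (\<lambda>v. U v \<omega>) \<beta> h n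
      (\<lambda>\<sigma> \<sigma>'. take (k n) \<sigma> \<noteq> take (k n) \<sigma>' \<and> \<epsilon> \<le> \<bar>overlap n \<sigma> \<sigma>' - (m_star h)\<^sup>2\<bar>))) \<longlonglongrightarrow> 0"
proof -
  define b where "b = beta_c h"
  define f where "f = frozen_free_energy \<beta> h"
  define \<theta> where "\<theta> = b / \<beta>"
  have b: "0 < b" "b < \<beta>" using beta_c_pos \<beta> by (auto simp: b_def)
  have \<theta>: "0 < \<theta>" "\<theta> \<le> 1" "\<theta> * \<beta> = b" "\<theta> * f = psi h b"
    using b by (auto simp: \<theta>_def f_def frozen_free_energy_def b_def)
  obtain \<rho> where \<rho>: "0 < \<rho>" "\<rho> < 1" and chernoff: "\<And>n.
    (\<Sum>\<sigma>\<in>configs n. \<Sum>\<sigma>'\<in>configs n. exp (b * h * ((\<Sum>i=1..n. \<sigma> ! (i - 1)) + (\<Sum>i=1..n. \<sigma>' ! (i - 1))))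
        * of_bool (\<epsilon> \<le> \<bar>overlap n \<sigma> \<sigma>' - (m_star h)\<^sup>2\<bar>))
      \<le> 2 * ((2 * cosh (b * h))\<^sup>2 * \<rho>) ^ n"
    using overlap_chernoff [OF \<epsilon>, of "b * h"] by (auto simp: m_star_def b_def)
  \<comment> \<open>The losses amount to at most \<open>exp ((2 + b\<^sup>2) \<delta> n)\<close>; they may use up half of the Chernoff rate.\<close>
  define \<delta> where "\<delta> = - ln \<rho> / (2 * (2 + b\<^sup>2))"
  have \<delta>: "0 < \<delta>" "(2 + b\<^sup>2) * \<delta> = - ln \<rho> / 2"
  proof -
    have "0 < 2 + b\<^sup>2" by (simp add: add_pos_nonneg)
    then show "0 < \<delta>" "(2 + b\<^sup>2) * \<delta> = - ln \<rho> / 2"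
      using \<rho> by (auto simp: \<delta>_def divide_simps)
  qed
  have "(\<lambda>n. expectation (\<lambda>\<omega>. gibbs_pair (\<lambda>v. U v \<omega>) \<beta> h n
      (\<lambda>\<sigma> \<sigma>'. take (k n) \<sigma> \<noteq> take (k n) \<sigma>' \<and> \<epsilon> \<le> \<bar>overlap n \<sigma> \<sigma>' - (m_star h)\<^sup>2\<bar>))) \<longlonglongrightarrow> 0"
    if k: "\<And>n. real (k n) \<le> \<delta> * real n" for k
  proof -
    let ?B = "\<lambda>n \<sigma> \<sigma>'. take (k n) \<sigma> \<noteq> take (k n) \<sigma>' \<and> \<epsilon> \<le> \<bar>overlap n \<sigma> \<sigma>' - (m_star h)\<^sup>2\<bar>"
    let ?bad = "\<lambda>n. {\<omega> \<in> space M. partition_fn (\<lambda>v. U v \<omega>) \<beta> h n < exp (real n * (f - \<delta>))}"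
    have bound: "expectation (\<lambda>\<omega>. gibbs_pair (\<lambda>v. U v \<omega>) \<beta> h n (?B n))
      \<le> prob (?bad n) + 2 * exp (real n * (ln \<rho> / 2))" for n
    proof -
      let ?Z = "\<lambda>\<omega>. partition_fn (\<lambda>v. U v \<omega>) \<beta> h n"
      let ?F = "\<lambda>\<sigma>. \<Sum>i=1..n. \<sigma> ! (i - 1) :: real"
      let ?H = "\<lambda>\<omega> \<sigma>. hamiltonian (\<lambda>v. U v \<omega>) h n \<sigma>"
      note [measurable] = measurable_partition_fn [OF U]
      have bad [measurable]: "?bad n \<in> events" by measurable
      have ibad: "integrable M (indicat_real (?bad n))"
        by (rule integrable_real_indicator) (auto simp: emeasure_eq_measure)
      define c where "c = exp (- 2 * real n * \<theta> * (f - \<delta>))"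
      define S where "S \<omega> = (\<Sum>\<sigma>\<in>configs n. \<Sum>\<sigma>'\<in>configs n. exp (b * (?H \<omega> \<sigma> + ?H \<omega> \<sigma>')) * of_bool (?B n \<sigma> \<sigma>'))" for \<omega>
      have S0: "0 \<le> S \<omega>" for \<omega> unfolding S_def by (intro sum_nonneg) auto
      have term_int: "integrable M (\<lambda>\<omega>. exp (b * (?H \<omega> \<sigma> + ?H \<omega> \<sigma>')) * of_bool (?B n \<sigma> \<sigma>'))" 
        and term_le: "expectation (\<lambda>\<omega>. exp (b * (?H \<omega> \<sigma> + ?H \<omega> \<sigma>')) * of_bool (?B n \<sigma> \<sigma>'))
          \<le> exp (b\<^sup>2 * (real n + real (k n))) * (exp (b * h * (?F \<sigma> + ?F \<sigma>')) * of_bool (\<epsilon> \<le> \<bar>overlap n \<sigma> \<sigma>' - (m_star h)\<^sup>2\<bar>))"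
        if "\<sigma> \<in> configs n" "\<sigma>' \<in> configs n" for \<sigma> \<sigma>'
        using pair_exp_moment [OF U that, of "k n" b h] by (cases "?B n \<sigma> \<sigma>'"; simp add: mult.commute)+
      have S: "integrable M S"
        unfolding S_def by (intro Bochner_Integration.integrable_sum term_int)
      have "expectation S = (\<Sum>\<sigma>\<in>configs n. expectation (\<lambda>\<omega>. \<Sum>\<sigma>'\<in>configs n. exp (b * (?H \<omega> \<sigma> + ?H \<omega> \<sigma>')) * of_bool (?B n \<sigma> \<sigma>')))"
        unfolding S_def
        by (rule Bochner_Integration.integral_sum) (intro Bochner_Integration.integrable_sum term_int)
      also have "\<dots> = (\<Sum>\<sigma>\<in>configs n. \<Sum>\<sigma>'\<in>configs n. expectation (\<lambda>\<omega>. exp (b * (?H \<omega> \<sigma> + ?H \<omega> \<sigma>')) * of_bool (?B n \<sigma> \<sigma>')))"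
        by (rule sum.cong [OF refl], rule Bochner_Integration.integral_sum) (rule term_int)
      also have "\<dots> \<le> (\<Sum>\<sigma>\<in>configs n. \<Sum>\<sigma>'\<in>configs n. exp (b\<^sup>2 * (real n + real (k n))) *
          (exp (b * h * (?F \<sigma> + ?F \<sigma>')) * of_bool (\<epsilon> \<le> \<bar>overlap n \<sigma> \<sigma>' - (m_star h)\<^sup>2\<bar>)))"
        by (intro sum_mono term_le)
      also have "\<dots> \<le> exp (b\<^sup>2 * (real n + real (k n))) * (2 * ((2 * cosh (b * h))\<^sup>2 * \<rho>) ^ n)"
        unfolding sum_distrib_left [symmetric] by (intro mult_left_mono chernoff) auto
      finally have ES: "expectation S \<le> exp (b\<^sup>2 * (real n + real (k n))) * (2 * ((2 * cosh (b * h))\<^sup>2 * \<rho>) ^ n)" .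
      have le: "gibbs_pair (\<lambda>v. U v \<omega>) \<beta> h n (?B n) \<le> indicator (?bad n) \<omega> + c * S \<omega>" if "\<omega> \<in> space M" for \<omega>
      proof (cases "\<omega> \<in> ?bad n")
        case True
        have "0 \<le> c * S \<omega>" using S0 by (simp add: c_def)
        then show ?thesis using True gibbs_pair_bounds(2) [of "\<lambda>v. U v \<omega>" \<beta> h n "?B n"] by simp
      next
        case False
        define G where "G = gibbs_pair (\<lambda>v. U v \<omega>) \<beta> h n (?B n)"
        define A where "A = (\<Sum>\<sigma>\<in>configs n. \<Sum>\<sigma>'\<in>configs n. exp (\<beta> * (?H \<omega> \<sigma> + ?H \<omega> \<sigma>')) * of_bool (?B n \<sigma> \<sigma>'))"
        have A0: "0 \<le> A" unfolding A_def by (intro sum_nonneg) auto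
        have Z: "exp (real n * (f - \<delta>)) \<le> ?Z \<omega>" "0 < ?Z \<omega>"
          using False that partition_fn_pos by auto
        have G: "G = A / (?Z \<omega>)\<^sup>2"
          unfolding G_def gibbs_pair_def gibbs_weight_def A_def sum_divide_distrib
          by (intro sum.cong refl) (simp add: power2_eq_square distrib_left exp_add)
        have "G \<le> G powr \<theta>"
        proof (cases "G = 0")
          case False
          then show ?thesis
            using gibbs_pair_bounds [of "\<lambda>v. U v \<omega>" \<beta> h n "?B n"] powr_mono' [of \<theta> 1 G] \<theta> by (simp add: G_def)
        qed simp
        also have "\<dots> = A powr \<theta> / ((?Z \<omega>)\<^sup>2) powr \<theta>"
          unfolding G using A0 by (simp add: powr_divide)
        also have "\<dots> \<le> A powr \<theta> / (exp (2 * real n * (f - \<delta>))) powr \<theta>"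
        proof (intro divide_left_mono powr_mono2)
          have "exp (2 * real n * (f - \<delta>)) = (exp (real n * (f - \<delta>)))\<^sup>2"
            by (simp add: exp_double [symmetric] mult_ac)
          then show "exp (2 * real n * (f - \<delta>)) \<le> (?Z \<omega>)\<^sup>2"
            using Z by (simp add: power_mono)
        qed (use \<theta> Z in auto)
        also have "\<dots> = c * A powr \<theta>"
          by (simp add: c_def powr_def exp_minus divide_inverse mult_ac)
        also have "\<dots> \<le> c * S \<omega>"
        proof (intro mult_left_mono)
          have "A powr \<theta> \<le> (\<Sum>\<sigma>\<in>configs n. (\<Sum>\<sigma>'\<in>configs n. exp (\<beta> * (?H \<omega> \<sigma> + ?H \<omega> \<sigma>')) * of_bool (?B n \<sigma> \<sigma>')) powr \<theta>)"
            unfolding A_def by (intro sum_powr_le sum_nonneg \<theta>) auto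
          also have "\<dots> \<le> (\<Sum>\<sigma>\<in>configs n. \<Sum>\<sigma>'\<in>configs n. (exp (\<beta> * (?H \<omega> \<sigma> + ?H \<omega> \<sigma>')) * of_bool (?B n \<sigma> \<sigma>')) powr \<theta>)"
            by (intro sum_mono sum_powr_le \<theta>) auto
          also have "\<dots> = S \<omega>"
            unfolding S_def \<theta>(3) [symmetric] by (intro sum.cong refl) (simp add: powr_def mult_ac)
          finally show "A powr \<theta> \<le> S \<omega>" .
        qed (simp add: c_def)
        finally show ?thesis using False by (simp add: G_def)
      qed
      have "expectation (\<lambda>\<omega>. gibbs_pair (\<lambda>v. U v \<omega>) \<beta> h n (?B n)) \<le> expectation (\<lambda>\<omega>. indicator (?bad n) \<omega> + c * S \<omega>)"
        by (intro integral_mono le integrable_gibbs_pair U Bochner_Integration.integrable_add ibad integrable_mult_right S)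
      also have "\<dots> = prob (?bad n) + c * expectation S"
        using ibad S by simp
      also have "c * expectation S \<le> c * (exp (b\<^sup>2 * (real n + real (k n))) * (2 * ((2 * cosh (b * h))\<^sup>2 * \<rho>) ^ n))"
        using ES by (intro mult_left_mono) (auto simp: c_def)
      also have "\<dots> \<le> 2 * exp (real n * (ln \<rho> / 2))"
      proof -
        have \<rho>n: "\<rho> ^ n = exp (real n * ln \<rho>)" using \<rho> by (simp add: exp_of_nat_mult)
        have cosh: "((2 * cosh (b * h))\<^sup>2) ^ n = exp (2 * real n * psi h b - real n * b\<^sup>2)"
        proof -
          have "exp (2 * real n * psi h b) = (exp (real n * psi h b))\<^sup>2"
            by (simp add: exp_double [symmetric] mult_ac)
          also have "\<dots> = (exp (real n * b\<^sup>2 / 2))\<^sup>2 * ((2 * cosh (b * h))\<^sup>2) ^ n"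
          proof -
            have "(p * q ^ n)\<^sup>2 = p\<^sup>2 * (q\<^sup>2) ^ n" for p q :: real
              by (simp add: power_mult_distrib power_mult [symmetric] mult.commute)
            then show ?thesis unfolding exp_psi .
          qed
          also have "(exp (real n * b\<^sup>2 / 2))\<^sup>2 = exp (real n * b\<^sup>2)"
            by (simp add: exp_double [symmetric])
          finally show ?thesis by (simp add: exp_diff)
        qed
        have "c * (exp (b\<^sup>2 * (real n + real (k n))) * (2 * ((2 * cosh (b * h))\<^sup>2 * \<rho>) ^ n))
            = 2 * exp (2 * real n * \<theta> * \<delta> + b\<^sup>2 * real (k n) + real n * ln \<rho>)"
          unfolding c_def power_mult_distrib [of "(2 * cosh (b * h))\<^sup>2"] \<rho>n cosh \<theta>(4) [symmetric]
          by (simp add: exp_add [symmetric] algebra_simps)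
        also have "\<dots> \<le> 2 * exp (real n * (ln \<rho> / 2))"
        proof -
          have "2 * real n * \<theta> * \<delta> \<le> 2 * real n * 1 * \<delta>"
            using \<theta> \<delta> by (intro mult_right_mono mult_left_mono) auto
          moreover have "b\<^sup>2 * real (k n) \<le> b\<^sup>2 * (\<delta> * real n)"
            using k by (intro mult_left_mono) auto
          moreover have "2 * real n * 1 * \<delta> + b\<^sup>2 * (\<delta> * real n) = real n * ((2 + b\<^sup>2) * \<delta>)"
            by (simp add: algebra_simps)
          ultimately have "2 * real n * \<theta> * \<delta> + b\<^sup>2 * real (k n) + real n * ln \<rho> \<le> real n * (ln \<rho> / 2)"
            unfolding \<delta>(2) by (simp add: algebra_simps)
          then show ?thesis by simp
        qed
        finally show ?thesis .
      qed
      finally show ?thesis by simp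
    qed
    have "(\<lambda>n. prob (?bad n)) \<longlonglongrightarrow> 0"
      unfolding f_def by (rule partition_fn_lower_prob [OF U h \<beta> \<delta>(1)])
    moreover have "(\<lambda>n. 2 * exp (real n * (ln \<rho> / 2))) \<longlonglongrightarrow> 0"
    proof -
      have "ln \<rho> < 0" using \<rho> by simp
      then show ?thesis by real_asymp
    qed
    ultimately have lim: "(\<lambda>n. prob (?bad n) + 2 * exp (real n * (ln \<rho> / 2))) \<longlonglongrightarrow> 0"
      using tendsto_add_zero by blast
    show ?thesis
    proof (rule tendsto_sandwich [OF _ _ tendsto_const lim])
      show "\<forall>\<^sub>F n in sequentially. 0 \<le> expectation (\<lambda>\<omega>. gibbs_pair (\<lambda>v. U v \<omega>) \<beta> h n (?B n))"
        by (intro always_eventually allI Bochner_Integration.integral_nonneg gibbs_pair_bounds)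
    qed (intro always_eventually allI bound)
  qed
  then show ?thesis using \<delta>(1) by blast
qed

section \<open>The limit of the overlap law\<close>

lemma config_nth:
  assumes "\<sigma> \<in> configs n" "i \<in> {1..n}"
  shows "\<sigma> ! (i - 1) = 1 \<or> \<sigma> ! (i - 1) = -1"
proof -
  have "\<sigma> ! (i - 1) \<in> set \<sigma>" using assms by (intro nth_mem) (auto simp: configs_def)
  then show ?thesis using assms(1) by (auto simp: configs_def)
qed

lemma overlap_le_1:
  assumes "\<sigma> \<in> configs n" "\<sigma>' \<in> configs n"
  shows "overlap n \<sigma> \<sigma>' \<le> 1"
proof -
  have "(\<Sum>i=1..n. \<sigma> ! (i - 1) * \<sigma>' ! (i - 1)) \<le> (\<Sum>i=1..n. 1)"
  proof (rule sum_mono)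
    fix i assume i: "i \<in> {1..n}"
    show "\<sigma> ! (i - 1) * \<sigma>' ! (i - 1) \<le> 1"
      using config_nth [OF assms(1) i] config_nth [OF assms(2) i] by auto
  qed
  then show ?thesis by (cases "n = 0") (auto simp: overlap_def divide_simps)
qed

lemma overlap_ge_of_common_prefix:
  assumes "\<sigma> \<in> configs n" "\<sigma>' \<in> configs n" "take j \<sigma> = take j \<sigma>'" "j \<le> n" "0 < n"
  shows "2 * real j / real n - 1 \<le> overlap n \<sigma> \<sigma>'"
proof -
  have "2 * real j - real n = (\<Sum>i=1..n. 2 * of_bool (i \<le> j) - 1)"
  proof -
    have "(\<Sum>i=1..n. of_bool (i \<le> j)) = (\<Sum>i=1..j. 1 :: real)"
      using assms by (intro sum.mono_neutral_cong_right) auto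
    then show ?thesis by (simp add: sum_subtractf sum_distrib_left [symmetric])
  qed
  also have "\<dots> \<le> (\<Sum>i=1..n. \<sigma> ! (i - 1) * \<sigma>' ! (i - 1))"
  proof (rule sum_mono)
    fix i assume i: "i \<in> {1..n}"
    show "2 * of_bool (i \<le> j) - 1 \<le> \<sigma> ! (i - 1) * \<sigma>' ! (i - 1)"
    proof (cases "i \<le> j")
      case True
      then have "\<sigma> ! (i - 1) = \<sigma>' ! (i - 1)"
        using nth_take [of "i - 1" j \<sigma>] nth_take [of "i - 1" j \<sigma>'] assms(3) i by auto
      then show ?thesis using True config_nth [OF assms(2) i] by auto
    next
      case False
      then show ?thesis
        using config_nth [OF assms(1) i] config_nth [OF assms(2) i] by auto
    qed
  qed
  finally have "2 * real j - real n \<le> (\<Sum>i=1..n. \<sigma> ! (i - 1) * \<sigma>' ! (i - 1))" .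
  then have "(2 * real j - real n) / real n \<le> overlap n \<sigma> \<sigma>'"
    by (simp add: overlap_def divide_right_mono)
  then show ?thesis using assms(5) by (simp add: diff_divide_distrib)
qed

lemma cdf_mean_overlap_law:
  assumes M: "prob_space M" and U: "gaussian_disorder M U"
  shows "cdf (mean_overlap_law M U \<beta> h n) x =
    (\<integral>\<omega>. gibbs_pair (\<lambda>v. U v \<omega>) \<beta> h n (\<lambda>\<sigma> \<sigma>'. overlap n \<sigma> \<sigma>' \<le> x) \<partial>M)"
proof -
  have eq: "gibbs_overlap_prob u \<beta> h n {..x} = gibbs_pair u \<beta> h n (\<lambda>\<sigma> \<sigma>'. overlap n \<sigma> \<sigma>' \<le> x)" for u
    unfolding gibbs_overlap_prob_eq_sum gibbs_pair_def sum.cartesian_product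
    by (intro sum.cong refl) (auto simp: gibbs_weight_def indicator_def)
  have "cdf (mean_overlap_law M U \<beta> h n) x = enn2real (ennreal (\<integral>\<omega>. gibbs_overlap_prob (\<lambda>v. U v \<omega>) \<beta> h n {..x} \<partial>M))"
    unfolding cdf_def measure_def by (subst emeasure_mean_overlap_law [OF M U]) auto
  also have "\<dots> = (\<integral>\<omega>. gibbs_overlap_prob (\<lambda>v. U v \<omega>) \<beta> h n {..x} \<partial>M)"
    by (intro enn2real_ennreal Bochner_Integration.integral_nonneg gibbs_overlap_prob_bounds)
  finally show ?thesis unfolding eq .
qed

lemma cdf_dirac_mixture:
  assumes "0 \<le> w" "w \<le> 1"
  shows "cdf (dirac_mixture w x y) z = w * of_bool (x \<le> z) + (1 - w) * of_bool (y \<le> z)"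
proof -
  let ?m = "w * of_bool (x \<le> z) + (1 - w) * of_bool (y \<le> z)"
  have "emeasure (dirac_mixture w x y) {..z} = ennreal ?m"
    using assms by (subst emeasure_dirac_mixture) (auto simp: indicator_def ennreal_plus [symmetric] simp del: ennreal_plus)
  moreover have "0 \<le> ?m" using assms by (intro add_nonneg_nonneg) auto
  ultimately show ?thesis
    unfolding cdf_def measure_def by (simp only: enn2real_ennreal)
qed

text \<open>
  Pairs of replicas fall into three classes. Those that separate before level \<open>k \<le> 2 a n\<close> have
  hypercube overlap near \<open>(m\<^sup>*)\<^sup>2\<close>. Those that agree up to level \<open>j \<ge> (1 - 2 a) n\<close> have overlap
  near \<open>1\<close>. The remaining ones have negligible probability, because the coincidence probabilities at
  levels \<open>k\<close> and \<open>j\<close> have the same limit.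
\<close>

lemma (in prob_space) overlap_cdf_limit:
  assumes U: "gaussian_disorder M U" and h: "0 < h" and \<beta>: "beta_c h < \<beta>"
    and x: "x < 1" "x \<noteq> (m_star h)\<^sup>2"
  shows "(\<lambda>n. expectation (\<lambda>\<omega>. gibbs_pair (\<lambda>v. U v \<omega>) \<beta> h n (\<lambda>\<sigma> \<sigma>'. overlap n \<sigma> \<sigma>' \<le> x)))
    \<longlonglongrightarrow> beta_c h / \<beta> * of_bool ((m_star h)\<^sup>2 \<le> x)"
proof -
  define \<mu> where "\<mu> = (m_star h)\<^sup>2"
  define w where "w = beta_c h / \<beta>"
  define E where "E n B = expectation (\<lambda>\<omega>. gibbs_pair (\<lambda>v. U v \<omega>) \<beta> h n B)" for n B
  have E_mono: "E n B \<le> E n B'"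
    if "\<And>\<sigma> \<sigma>'. \<sigma> \<in> configs n \<Longrightarrow> \<sigma>' \<in> configs n \<Longrightarrow> B \<sigma> \<sigma>' \<Longrightarrow> B' \<sigma> \<sigma>'" for n B B'
    unfolding E_def by (intro integral_mono integrable_gibbs_pair U gibbs_pair_mono that)
  have E_disj: "E n (\<lambda>\<sigma> \<sigma>'. B \<sigma> \<sigma>' \<or> B' \<sigma> \<sigma>') \<le> E n B + E n B'" for n B B'
  proof -
    have "E n (\<lambda>\<sigma> \<sigma>'. B \<sigma> \<sigma>' \<or> B' \<sigma> \<sigma>')
        \<le> expectation (\<lambda>\<omega>. gibbs_pair (\<lambda>v. U v \<omega>) \<beta> h n B + gibbs_pair (\<lambda>v. U v \<omega>) \<beta> h n B')"
      unfolding E_def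
      by (intro integral_mono Bochner_Integration.integrable_add integrable_gibbs_pair U gibbs_pair_disj_le)
    then show ?thesis
      using integrable_gibbs_pair [OF U] by (simp add: E_def)
  qed
  have E_not: "E n (\<lambda>\<sigma> \<sigma>'. \<not> B \<sigma> \<sigma>') = 1 - E n B" for n B
    using integrable_gibbs_pair [OF U] by (simp add: E_def gibbs_pair_not prob_space)
  have E_co: "E n (\<lambda>\<sigma> \<sigma>'. take i \<sigma> = take i \<sigma>') = expectation (\<lambda>\<omega>. coincidence (\<lambda>v. U v \<omega>) \<beta> h n i)"
    if "i \<le> n" for n i
    unfolding E_def gibbs_pair_def coincidence_eq_pair_sum [OF that] ..
  define \<epsilon> where "\<epsilon> = \<bar>x - \<mu>\<bar>"
  have \<epsilon>: "0 < \<epsilon>" using x by (simp add: \<epsilon>_def \<mu>_def)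
  obtain \<delta> where \<delta>: "\<delta> > 0" and early: "\<And>k. (\<And>n. real (k n) \<le> \<delta> * real n) \<Longrightarrow>
    (\<lambda>n. E n (\<lambda>\<sigma> \<sigma>'. take (k n) \<sigma> \<noteq> take (k n) \<sigma>' \<and> \<epsilon> \<le> \<bar>overlap n \<sigma> \<sigma>' - \<mu>\<bar>)) \<longlonglongrightarrow> 0"
    using early_split_overlap [OF U less_imp_le [OF h] \<beta> \<epsilon>] unfolding E_def \<mu>_def by blast
  define a where "a = min (\<delta> / 2) (min (1 / 4) ((1 - x) / 8))"
  have a: "0 < a" "2 * a \<le> \<delta>" "a \<le> 1 / 4" "8 * a \<le> 1 - x" 
  proof -
    have le: "a \<le> \<delta> / 2" "a \<le> 1 / 4" "a \<le> (1 - x) / 8"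
      unfolding a_def by (intro min.cobounded1 min.cobounded2 min.coboundedI2)+
    show "2 * a \<le> \<delta>" using le(1) by linarith
    show "a \<le> 1 / 4" by (rule le(2))
    show "8 * a \<le> 1 - x" using le(3) by (simp add: pos_le_divide_eq mult.commute)
    show "0 < a" using \<delta> x by (simp add: a_def)
  qed
  \<comment> \<open>\<open>k n\<close> lies between \<open>a n\<close> and \<open>2 a n\<close>, and \<open>j n\<close> between \<open>(1 - 2 a) n\<close> and
  \<open>(1 - a) n\<close>, for large \<open>n\<close>: far enough from the ends for the coincidence probabilities to converge,
  and close enough to them to determine the overlap.\<close>
  define k where "k n = nat \<lfloor>2 * a * real n\<rfloor>" for n
  define j where "j n = nat \<lfloor>(1 - a) * real n\<rfloor>" for n
  have k_le: "real (k n) \<le> 2 * a * real n" for n using a by (simp add: k_def)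
  have j_le: "real (j n) \<le> (1 - a) * real n" for n using a by (simp add: j_def)
  have "real (k n) \<le> \<delta> * real n" for n
    using mult_right_mono [OF a(2), of "real n"] by (intro order.trans [OF k_le]) auto
  note split0 = early [OF this]
  define s where "s n = E n (\<lambda>\<sigma> \<sigma>'. take (k n) \<sigma> \<noteq> take (k n) \<sigma>' \<and> \<epsilon> \<le> \<bar>overlap n \<sigma> \<sigma>' - \<mu>\<bar>)" for n
  have "\<forall>\<^sub>F n in sequentially. \<bar>E n (\<lambda>\<sigma> \<sigma>'. overlap n \<sigma> \<sigma>' \<le> x) - w * of_bool (\<mu> \<le> x)\<bar> < e" if e: "0 < e" for e
  proof -
    have e4: "0 < e / 4" using e by simp
    have "\<forall>\<^sub>F n in sequentially. s n < e / 4"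
      using split0 e4 unfolding s_def by (rule order_tendstoD)
    moreover have "\<forall>\<^sub>F n in sequentially. 1 / a \<le> real n"
      by real_asymp
    ultimately show ?thesis
      using coincidence_limit [OF U less_imp_le [OF h] \<beta> a(1) e4] eventually_gt_at_top [of 0]
    proof eventually_elim
      case (elim n)
      have n: "0 < real n" using elim by simp
      have na: "1 \<le> a * real n" using elim(2) a by (simp add: field_simps)
      have k: "a * real n \<le> real (k n)"
        using na by (simp add: k_def) linarith
      have j: "(1 - 2 * a) * real n \<le> real (j n)"
      proof -
        have "(1 - a) * real n - 1 \<le> real (j n)"
          using a by (simp add: j_def)
        then show ?thesis using na by (simp add: algebra_simps)
      qed
      have "2 * a * real n \<le> 1 * real n" "(1 - a) * real n \<le> 1 * real n"
        using a by (intro mult_right_mono; simp)+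
      then have kn: "k n \<le> n" and jn: "j n \<le> n" using k_le [of n] j_le [of n] by linarith+
      have "2 * a * real n \<le> (1 - 2 * a) * real n"
        using a by (intro mult_right_mono) auto
      then have kj: "k n \<le> j n" using k_le [of n] j by linarith
      define P where "P i = E n (\<lambda>\<sigma> \<sigma>'. take i \<sigma> = take i \<sigma>')" for i
      have Pk: "P (k n) \<le> 1 - w + e / 4" and Pj: "1 - w - e / 4 \<le> P (j n)"
        and Pk': "1 - w - e / 4 \<le> P (k n)"
      proof -
        show "P (k n) \<le> 1 - w + e / 4"
          using elim(3) kn k by (simp add: P_def E_co w_def)
        show *: "1 - w - e / 4 \<le> P (j n)"
          using elim(3) jn j_le [of n] by (simp add: P_def E_co w_def)
        have "P (j n) \<le> P (k n)"
          unfolding P_def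
        proof (rule E_mono)
          fix \<sigma> \<sigma>' :: "real list" assume "take (j n) \<sigma> = take (j n) \<sigma>'"
          from arg_cong [OF this, of "take (k n)"] show "take (k n) \<sigma> = take (k n) \<sigma>'"
            using kj by (simp add: min_def)
        qed
        then show "1 - w - e / 4 \<le> P (k n)" using * by linarith
      qed
      have late: "\<not> overlap n \<sigma> \<sigma>' \<le> x"
        if "\<sigma> \<in> configs n" "\<sigma>' \<in> configs n" "take (j n) \<sigma> = take (j n) \<sigma>'" for \<sigma> \<sigma>'
      proof -
        have "x < 1 - 4 * a" using a by linarith
        also have "1 - 4 * a \<le> 2 * real (j n) / real n - 1"
          using j n by (simp add: field_simps)
        also have "\<dots> \<le> overlap n \<sigma> \<sigma>'"
          by (rule overlap_ge_of_common_prefix [OF that jn]) (use n in simp)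
        finally show ?thesis by simp
      qed
      have s: "s n < e / 4" by (rule elim(1))
      show ?case
      proof (cases "\<mu> \<le> x")
        case True
        then have \<epsilon>': "x = \<mu> + \<epsilon>" by (simp add: \<epsilon>_def)
        have "E n (\<lambda>\<sigma> \<sigma>'. overlap n \<sigma> \<sigma>' \<le> x) \<le> E n (\<lambda>\<sigma> \<sigma>'. \<not> take (j n) \<sigma> = take (j n) \<sigma>')"
          using late by (intro E_mono) blast
        also have "\<dots> = 1 - P (j n)" unfolding E_not P_def ..
        finally have 1: "E n (\<lambda>\<sigma> \<sigma>'. overlap n \<sigma> \<sigma>' \<le> x) \<le> w + e / 4" using Pj by linarith
        have "1 - P (k n) = E n (\<lambda>\<sigma> \<sigma>'. \<not> take (k n) \<sigma> = take (k n) \<sigma>')" unfolding E_not P_def ..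
        also have "\<dots> \<le> E n (\<lambda>\<sigma> \<sigma>'. overlap n \<sigma> \<sigma>' \<le> x \<or>
            (take (k n) \<sigma> \<noteq> take (k n) \<sigma>' \<and> \<epsilon> \<le> \<bar>overlap n \<sigma> \<sigma>' - \<mu>\<bar>))"
          by (intro E_mono) (auto simp: \<epsilon>')
        also have "\<dots> \<le> E n (\<lambda>\<sigma> \<sigma>'. overlap n \<sigma> \<sigma>' \<le> x) + s n"
          unfolding s_def by (rule E_disj)
        finally have "w - e / 2 \<le> E n (\<lambda>\<sigma> \<sigma>'. overlap n \<sigma> \<sigma>' \<le> x)" using Pk s by linarith
        then show ?thesis using 1 True e by (simp add: abs_le_iff)
      next
        case False
        then have \<epsilon>': "x = \<mu> - \<epsilon>" by (simp add: \<epsilon>_def)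
        have "E n (\<lambda>\<sigma> \<sigma>'. overlap n \<sigma> \<sigma>' \<le> x \<or> take (j n) \<sigma> = take (j n) \<sigma>')
          \<le> E n (\<lambda>\<sigma> \<sigma>'. (take (k n) \<sigma> \<noteq> take (k n) \<sigma>' \<and> \<epsilon> \<le> \<bar>overlap n \<sigma> \<sigma>' - \<mu>\<bar>)
              \<or> take (k n) \<sigma> = take (k n) \<sigma>')"
        proof (rule E_mono)
          fix \<sigma> \<sigma>' :: "real list" assume B: "overlap n \<sigma> \<sigma>' \<le> x \<or> take (j n) \<sigma> = take (j n) \<sigma>'"
          have "take (k n) \<sigma> = take (k n) \<sigma>'" if "take (j n) \<sigma> = take (j n) \<sigma>'"
            using arg_cong [OF that, of "take (k n)"] kj by (simp add: min_def)
          then show "(take (k n) \<sigma> \<noteq> take (k n) \<sigma>' \<and> \<epsilon> \<le> \<bar>overlap n \<sigma> \<sigma>' - \<mu>\<bar>)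
              \<or> take (k n) \<sigma> = take (k n) \<sigma>'"
            using B \<epsilon>' by linarith
        qed
        also have "\<dots> \<le> s n + P (k n)" unfolding s_def P_def by (rule E_disj)
        also have "E n (\<lambda>\<sigma> \<sigma>'. overlap n \<sigma> \<sigma>' \<le> x \<or> take (j n) \<sigma> = take (j n) \<sigma>')
            = E n (\<lambda>\<sigma> \<sigma>'. overlap n \<sigma> \<sigma>' \<le> x) + P (j n)"
        proof -
          have "gibbs_pair u \<beta> h n (\<lambda>\<sigma> \<sigma>'. overlap n \<sigma> \<sigma>' \<le> x \<or> take (j n) \<sigma> = take (j n) \<sigma>')
              = gibbs_pair u \<beta> h n (\<lambda>\<sigma> \<sigma>'. overlap n \<sigma> \<sigma>' \<le> x) + gibbs_pair u \<beta> h n (\<lambda>\<sigma> \<sigma>'. take (j n) \<sigma> = take (j n) \<sigma>')" for u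
            unfolding gibbs_pair_def sum.distrib [symmetric] distrib_left [symmetric]
            using late by (intro sum.cong refl arg_cong2 [where f = "(*)"]) auto
          then show ?thesis
            using integrable_gibbs_pair [OF U] by (simp add: E_def P_def)
        qed
        finally have "E n (\<lambda>\<sigma> \<sigma>'. overlap n \<sigma> \<sigma>' \<le> x) \<le> 3 * e / 4" using Pj Pk s by linarith
        moreover have "0 \<le> E n (\<lambda>\<sigma> \<sigma>'. overlap n \<sigma> \<sigma>' \<le> x)"
          unfolding E_def by (intro Bochner_Integration.integral_nonneg gibbs_pair_bounds)
        ultimately show ?thesis using False e by simp
      qed
    qed
  qed
  then show ?thesis
    unfolding E_def [symmetric] w_def [symmetric] \<mu>_def [symmetric] tendsto_iff dist_real_def by blast
qed

theorem theorem2: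
  fixes M :: "'a measure" and U :: "real list \<Rightarrow> 'a \<Rightarrow> real" and h \<beta> :: real
  assumes "prob_space M"
    and "gaussian_disorder M U"
    and "h > 0"
    and "\<beta> > beta_c h"
  shows "weak_conv_m (\<lambda>n. mean_overlap_law M U \<beta> h n)
           (dirac_mixture (beta_c h / \<beta>) ((m_star h)\<^sup>2) 1)"
  unfolding weak_conv_m_def weak_conv_def
proof (intro allI impI)
  interpret prob_space M by (rule assms)
  define w where "w = beta_c h / \<beta>"
  define \<mu> where "\<mu> = (m_star h)\<^sup>2"
  have w: "0 < w" "w < 1" using beta_c_pos [of h] assms(4) by (auto simp: w_def)
  have \<mu>: "\<mu> < 1"
    using tanh_real_lt_1 [of "beta_c h * h"] tanh_real_gt_neg1 [of "beta_c h * h"]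
    by (simp add: \<mu>_def m_star_def abs_square_less_1 abs_less_iff)
  note cdf = cdf_mean_overlap_law [OF assms(1,2)]
  have lim: "cdf (dirac_mixture w \<mu> 1) = (\<lambda>z. w * of_bool (\<mu> \<le> z) + (1 - w) * of_bool (1 \<le> z))"
    using w by (intro ext cdf_dirac_mixture) auto
  fix x assume "isCont (cdf (dirac_mixture (beta_c h / \<beta>) ((m_star h)\<^sup>2) 1)) x"
  then have cont: "isCont (cdf (dirac_mixture w \<mu> 1)) x" by (simp add: w_def \<mu>_def)
  have "(\<lambda>n. cdf (mean_overlap_law M U \<beta> h n) x) \<longlonglongrightarrow> cdf (dirac_mixture w \<mu> 1) x"
  proof (cases "x < 1")
    case True
    \<comment> \<open>The limit law has an atom at \<open>\<mu>\<close>, so its distribution function jumps there.\<close>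
    have "x \<noteq> \<mu>"
    proof
      assume "x = \<mu>"
      then have "(cdf (dirac_mixture w \<mu> 1) \<longlongrightarrow> w) (at_left x)"
        using cont \<mu> unfolding isCont_def lim by (auto intro: filterlim_mono [OF _ order.refl at_le])
      moreover have "(cdf (dirac_mixture w \<mu> 1) \<longlongrightarrow> 0) (at_left x)"
      proof (rule tendsto_eventually)
        show "\<forall>\<^sub>F z in at_left x. cdf (dirac_mixture w \<mu> 1) z = 0"
          unfolding eventually_at_left_field lim
          using \<open>x = \<mu>\<close> \<mu> by (intro exI [of _ "x - 1"]) auto
      qed
      ultimately have "w = 0" by (rule tendsto_unique [rotated]) simp
      then show False using w by simp
    qed
    then show ?thesis
      using overlap_cdf_limit [OF assms(2,3,4) True] True
      unfolding cdf lim by (simp add: w_def \<mu>_def)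
  next
    case False
    have "gibbs_pair u \<beta> h n (\<lambda>\<sigma> \<sigma>'. overlap n \<sigma> \<sigma>' \<le> x) = 1" for u n
    proof (rule antisym [OF gibbs_pair_bounds(2)])
      have "gibbs_pair u \<beta> h n (\<lambda>_ _. True) \<le> gibbs_pair u \<beta> h n (\<lambda>\<sigma> \<sigma>'. overlap n \<sigma> \<sigma>' \<le> x)"
        using False overlap_le_1 by (intro gibbs_pair_mono) (meson linorder_not_less order.trans)
      then show "1 \<le> gibbs_pair u \<beta> h n (\<lambda>\<sigma> \<sigma>'. overlap n \<sigma> \<sigma>' \<le> x)"
        by (simp add: gibbs_pair_True)
    qed
    then show ?thesis
      using False \<mu> unfolding cdf lim by (simp add: prob_space)
  qed
  then show "(\<lambda>n. cdf (mean_overlap_law M U \<beta> h n) x)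
      \<longlonglongrightarrow> cdf (dirac_mixture (beta_c h / \<beta>) ((m_star h)\<^sup>2) 1) x"
    by (simp add: w_def \<mu>_def)
qed

end
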